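(* A pre-proof net is sequentializable if and only if it is a proof net.
   Context: Write ⅋ for par. MLL formulas over atoms $\mathcal A$: $\mathcal A\mid\mathcal A^\perp\mid\mathsf 1\mid\bot\mid F\otimes F\mid F⅋F$. Linkings: $\mathsf 1\mid a\otimes a^\perp\mid a^\perp\otimes a\mid \bot\otimes L\mid L\otimes\bot\mid L⅋L$. A pre-proof graph $\langle P\mid\Gamma\rangle$ is a linking tree $P$ and a sequent forest $\Gamma$ whose sets of leaves coincide. A switching deletes, at each ⅋-node, one of its two child edges; the graph is correct if all switchings are connected and acyclic. Pre-proof graphs are identified by the smallest equivalence $\sim$ with: $P[Q⅋R]\sim P[R⅋Q]$, $P[(Q⅋R)⅋S]\sim P[Q⅋(R⅋S)]$, $P[Q\otimes R]\sim P[R\otimes Q]$, $P[\bot_i\otimes(Q\otimes\bot_j)]\sim P[(\bot_i\otimes Q)\otimes\bot_j]$, and $P[Q⅋(R\otimes\bot_i)]\sim P[(Q⅋R)\otimes\bot_i]$ provided in every switching with also the edge between $\bot_i$ and its parent removed, no node of $Q$ is connected to $\bot_i$. A pre-proof net is a $\sim$-class; it is a proof net if one (equivalently every) member is correct. Cut-free sequent proofs translate into pre-proof graphs by: $\mathsf{id}$ gives $\langle a\otimes a^\perp\mid a,a^\perp\rangle$; $\mathsf 1$ gives $\langle\mathsf1\mid\mathsf1\rangle$; exchange keeps $P$; $\bot$-rule sends $\langle P\mid\Gamma\rangle$ to $\langle\bot\otimes P\mid\bot,\Gamma\rangle$; ⅋-rule sends $\langle P\mid A,B,\Gamma\rangle$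 to $\langle P\mid A⅋B,\Gamma\rangle$; $\otimes$-rule combines $\langle P\mid\Gamma,A\rangle$ and $\langle Q\mid B,\Delta\rangle$ into $\langle P⅋Q\mid\Gamma,A\otimes B,\Delta\rangle$. A pre-proof net is sequentializable if one of its representatives is obtained from a sequent proof via this translation. *)

theory Defs
  imports "HOL-Library.Multiset"
begin

datatype 'a lit = Pos 'a | Neg 'a | LOne | LBot

text \<open>Binary trees with tensor and par nodes.  Leaves carry a name (of type 'v),
  which identifies a leaf of the linking with the corresponding leaf of the sequent
  forest, together with its label.  A member of Gamma is an MLL formula whose
  atom/unit occurrences are named.\<close>
datatype ('v, 'a) tree =
    Leaf "'v \<times> 'a lit"
  | Tens "('v, 'a) tree" "('v, 'a) tree"
  | Parr "('v, 'a) tree" "('v, 'a) tree"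

fun leaves :: "('v, 'a) tree \<Rightarrow> ('v \<times> 'a lit) list" where
  "leaves (Leaf l) = [l]"
| "leaves (Tens A B) = leaves A @ leaves B"
| "leaves (Parr A B) = leaves A @ leaves B"

abbreviation names :: "('v, 'a) tree \<Rightarrow> 'v set" where
  "names T \<equiv> fst ` set (leaves T)"

inductive is_linking :: "('v, 'a) tree \<Rightarrow> bool" where
  lk_one: "is_linking (Leaf (x, LOne))"
| lk_ax1: "is_linking (Tens (Leaf (x, Pos a)) (Leaf (y, Neg a)))"
| lk_ax2: "is_linking (Tens (Leaf (y, Neg a)) (Leaf (x, Pos a)))"
| lk_botl: "is_linking L \<Longrightarrow> is_linking (Tens (Leaf (x, LBot)) L)"
| lk_botr: "is_linking L \<Longrightarrow> is_linking (Tens L (Leaf (x, LBot)))"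
| lk_par: "is_linking L \<Longrightarrow> is_linking L' \<Longrightarrow> is_linking (Parr L L')"

definition pre_proof_graph :: "('v, 'a) tree \<Rightarrow> ('v, 'a) tree list \<Rightarrow> bool" where
  "pre_proof_graph P \<Gamma> \<longleftrightarrow>
     is_linking P \<and>
     distinct (map fst (leaves P)) \<and>
     distinct (map fst (concat (map leaves \<Gamma>))) \<and>
     set (leaves P) = set (concat (map leaves \<Gamma>))"

text \<open>Nodes: leaves (shared between P and Gamma, identified by name), internal
  nodes of P (by position), internal nodes of the i-th tree of Gamma (by position).\<close>
datatype 'v node = LN 'v | PN "bool list" | GN nat "bool list"

fun nid :: "(bool list \<Rightarrow> 'v node) \<Rightarrow> bool list \<Rightarrow> ('v, 'a) tree \<Rightarrow> 'v node" where
  "nid mk p (Leaf l) = LN (fst l)"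
| "nid mk p (Tens A B) = mk p"
| "nid mk p (Parr A B) = mk p"

fun tnodes :: "(bool list \<Rightarrow> 'v node) \<Rightarrow> bool list \<Rightarrow> ('v, 'a) tree \<Rightarrow> 'v node set" where
  "tnodes mk p (Leaf l) = {LN (fst l)}"
| "tnodes mk p (Tens A B) = insert (mk p) (tnodes mk (p @ [False]) A \<union> tnodes mk (p @ [True]) B)"
| "tnodes mk p (Parr A B) = insert (mk p) (tnodes mk (p @ [False]) A \<union> tnodes mk (p @ [True]) B)"

text \<open>Edges (parent, child, k): k = None for an edge below a tensor node,
  k = Some b for the left (b = False) / right (b = True) edge below a par node.\<close>
fun tedges :: "(bool list \<Rightarrow> 'v node) \<Rightarrow> bool list \<Rightarrow> ('v, 'a) tree
                 \<Rightarrow> ('v node \<times> 'v node \<times> bool option) set" where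
  "tedges mk p (Leaf l) = {}"
| "tedges mk p (Tens A B) =
     {(mk p, nid mk (p @ [False]) A, None), (mk p, nid mk (p @ [True]) B, None)}
     \<union> tedges mk (p @ [False]) A \<union> tedges mk (p @ [True]) B"
| "tedges mk p (Parr A B) =
     {(mk p, nid mk (p @ [False]) A, Some False), (mk p, nid mk (p @ [True]) B, Some True)}
     \<union> tedges mk (p @ [False]) A \<union> tedges mk (p @ [True]) B"

definition gnodes :: "('v, 'a) tree \<Rightarrow> ('v, 'a) tree list \<Rightarrow> 'v node set" where
  "gnodes P \<Gamma> = tnodes PN [] P \<union> (\<Union>i<length \<Gamma>. tnodes (GN i) [] (\<Gamma> ! i))"

definition gedges :: "('v, 'a) tree \<Rightarrow> ('v, 'a) tree list
                        \<Rightarrow> ('v node \<times> 'v node \<times> bool option) set" where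
  "gedges P \<Gamma> = tedges PN [] P \<union> (\<Union>i<length \<Gamma>. tedges (GN i) [] (\<Gamma> ! i))"

text \<open>A switching s chooses, at each par node u, which child edge to delete
  (the one on side s u).\<close>
definition switch_edges :: "('v node \<Rightarrow> bool) \<Rightarrow> ('v node \<times> 'v node \<times> bool option) set
                              \<Rightarrow> ('v node \<times> 'v node \<times> bool option) set" where
  "switch_edges s E = {(u, c, k) \<in> E. k \<noteq> Some (s u)}"

definition adj :: "('v node \<times> 'v node \<times> bool option) set \<Rightarrow> 'v node \<Rightarrow> 'v node \<Rightarrow> bool" where
  "adj E u v \<longleftrightarrow> (\<exists>k. (u, v, k) \<in> E \<or> (v, u, k) \<in> E)"

definition connected_graph :: "'v node set \<Rightarrow> ('v node \<times> 'v node \<times> bool option) set \<Rightarrow> bool" where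
  "connected_graph V E \<longleftrightarrow> (\<forall>u\<in>V. \<forall>v\<in>V. (adj E)\<^sup>*\<^sup>* u v)"

text \<open>A cycle: at least three distinct vertices, consecutive ones (cyclically) adjacent.
  (The graphs considered have no loops and no parallel edges.)\<close>
definition acyclic_graph :: "'v node set \<Rightarrow> ('v node \<times> 'v node \<times> bool option) set \<Rightarrow> bool" where
  "acyclic_graph V E \<longleftrightarrow>
     \<not> (\<exists>cyc. 3 \<le> length cyc \<and> distinct cyc \<and> set cyc \<subseteq> V \<and>
            (\<forall>i<length cyc. adj E (cyc ! i) (cyc ! ((i + 1) mod length cyc))))"

definition correct :: "('v, 'a) tree \<Rightarrow> ('v, 'a) tree list \<Rightarrow> bool" where
  "correct P \<Gamma> \<longleftrightarrow>
     (\<forall>s. connected_graph (gnodes P \<Gamma>) (switch_edges s (gedges P \<Gamma>)) \<and>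
          acyclic_graph (gnodes P \<Gamma>) (switch_edges s (gedges P \<Gamma>)))"

fun subt :: "('v, 'a) tree \<Rightarrow> bool list \<Rightarrow> ('v, 'a) tree option" where
  "subt T [] = Some T"
| "subt (Leaf l) (b # p) = None"
| "subt (Tens A B) (b # p) = subt (if b then B else A) p"
| "subt (Parr A B) (b # p) = subt (if b then B else A) p"

fun repl :: "('v, 'a) tree \<Rightarrow> bool list \<Rightarrow> ('v, 'a) tree \<Rightarrow> ('v, 'a) tree" where
  "repl T [] S = S"
| "repl (Leaf l) (b # p) S = Leaf l"
| "repl (Tens A B) (b # p) S = (if b then Tens A (repl B p S) else Tens (repl A p S) B)"
| "repl (Parr A B) (b # p) S = (if b then Parr A (repl B p S) else Parr (repl A p S) B)"

text \<open>Context-free rewrite rules (oriented; the equivalence is the symmetric closure).\<close>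
inductive basic_rw :: "('v, 'a) tree \<Rightarrow> ('v, 'a) tree \<Rightarrow> bool" where
  par_comm: "basic_rw (Parr Q R) (Parr R Q)"
| par_assoc: "basic_rw (Parr (Parr Q R) S) (Parr Q (Parr R S))"
| tens_comm: "basic_rw (Tens Q R) (Tens R Q)"
| bot_assoc: "basic_rw (Tens (Leaf (i, LBot)) (Tens Q (Leaf (j, LBot))))
                        (Tens (Tens (Leaf (i, LBot)) Q) (Leaf (j, LBot)))"

text \<open>Side condition of the bot-jump rule P[Q par (R tensor bot_i)] ~ P[(Q par R) tensor bot_i],
  where the redex Q par (R tensor bot_i) sits at position c of P: in every switching of the
  graph, with also the edge between bot_i and its parent removed, no node of Q is
  connected to bot_i.\<close>
definition jump_ok :: "('v, 'a) tree \<Rightarrow> ('v, 'a) tree list \<Rightarrow> bool list \<Rightarrow> ('v, 'a) tree \<Rightarrow> 'v \<Rightarrow> bool" where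
  "jump_ok P \<Gamma> c Q i \<longleftrightarrow>
     (\<forall>s. \<forall>q\<in>tnodes PN (c @ [False]) Q.
        \<not> (adj (switch_edges s (gedges P \<Gamma>) - {(PN (c @ [True]), LN i, None)}))\<^sup>*\<^sup>* q (LN i))"

definition sim_step :: "('v, 'a) tree list \<Rightarrow> ('v, 'a) tree \<Rightarrow> ('v, 'a) tree \<Rightarrow> bool" where
  "sim_step \<Gamma> P P' \<longleftrightarrow>
     (\<exists>c T T'. subt P c = Some T \<and> P' = repl P c T' \<and>
        (basic_rw T T' \<or>
         (\<exists>Q R i. T = Parr Q (Tens R (Leaf (i, LBot))) \<and>
                  T' = Tens (Parr Q R) (Leaf (i, LBot)) \<and> jump_ok P \<Gamma> c Q i)))"

definition sim :: "('v, 'a) tree list \<Rightarrow> ('v, 'a) tree \<Rightarrow> ('v, 'a) tree \<Rightarrow> bool" where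
  "sim \<Gamma> = (symclp (sim_step \<Gamma>))\<^sup>*\<^sup>*"

text \<open>seq_graph P Gamma: the pre-proof graph (P | Gamma) is the translation of some cut-free
  MLL sequent proof (of the sequent Gamma with leaf names erased); leaves introduced by
  the id, 1 and bot rules get fresh names.\<close>
inductive seq_graph :: "('v, 'a) tree \<Rightarrow> ('v, 'a) tree list \<Rightarrow> bool" where
  sq_id: "x \<noteq> y \<Longrightarrow>
    seq_graph (Tens (Leaf (x, Pos a)) (Leaf (y, Neg a))) [Leaf (x, Pos a), Leaf (y, Neg a)]"
| sq_one: "seq_graph (Leaf (x, LOne)) [Leaf (x, LOne)]"
| sq_exch: "seq_graph P \<Gamma> \<Longrightarrow> mset \<Gamma>' = mset \<Gamma> \<Longrightarrow> seq_graph P \<Gamma>'"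
| sq_bot: "seq_graph P \<Gamma> \<Longrightarrow> x \<notin> names P \<Longrightarrow>
    seq_graph (Tens (Leaf (x, LBot)) P) (Leaf (x, LBot) # \<Gamma>)"
| sq_par: "seq_graph P (A # B # \<Gamma>) \<Longrightarrow> seq_graph P (Parr A B # \<Gamma>)"
| sq_tens: "seq_graph P (\<Gamma> @ [A]) \<Longrightarrow> seq_graph Q (B # \<Delta>) \<Longrightarrow> names P \<inter> names Q = {} \<Longrightarrow>
    seq_graph (Parr P Q) (\<Gamma> @ [Tens A B] @ \<Delta>)"

text \<open>The pre-proof net of (P | Gamma) is its sim-class.\<close>
definition sequentializable :: "('v, 'a) tree \<Rightarrow> ('v, 'a) tree list \<Rightarrow> bool" where
  "sequentializable P \<Gamma> \<longleftrightarrow> (\<exists>P'. sim \<Gamma> P P' \<and> seq_graph P' \<Gamma>)"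

definition proof_net :: "('v, 'a) tree \<Rightarrow> ('v, 'a) tree list \<Rightarrow> bool" where
  "proof_net P \<Gamma> \<longleftrightarrow> (\<exists>P'. sim \<Gamma> P P' \<and> correct P' \<Gamma>)"

end

theory Submission
  imports Defs
begin

text \<open>
  A switching of a tree is flattened to a graph on its leaves: every node is represented by a leaf
  that the switching connects to it, and every tensor contributes one edge between the
  representatives of its two children.  A pre-proof graph is correct iff all these leaf graphs
  connect all leaves and the number of leaves exceeds the number of tensors by one.  In this form
  translations of sequent proofs are correct by an immediate induction.

  Conversely, in a correct graph a bottom tensored with a par can always jump inside the par, so that
  the linking becomes, up to equivalence, a par of blocks: an axiom or a 1 tensored with bottoms.
  Each block is itself the translation of a sequent proof, and it remains to perform the
  tensor and par rules of \<open>\<Gamma>\<close> from the leaves downwards.  Contracting the blocks to vertices, a tensor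
  without further tensors above it can be performed as soon as all leaves on its left belong to one
  block and all leaves on its right belong to one block.  Such a tensor exists: otherwise pick a minimal
  tensor \<open>t\<close> and blocks \<open>a\<close>, \<open>b\<close> on its two sides, identify \<open>a\<close> with \<open>b\<close> and regard \<open>t\<close> as a par.
  The result is again correct, so by induction it has such a tensor, which in the original graph must
  be a minimal tensor with blocks exactly \<open>{a, b}\<close> on one side and a single block on the other.  Every minimal
  tensor provides at least two pairs \<open>{a, b}\<close>, different tensors provide different pairs (two equal pairs would
  be parallel edges in some switching), and each pair determines a different minimal tensor, so that
  twice the number of minimal tensors is at most that number.
\<close>

section \<open>Undirected graphs\<close>

text \<open>Acyclicity is hard to carry through contractions, so it is traded for a number. The
  numbers of leaves and tensors do not depend on the switching, a connected graph on n vertices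
  needs n - 1 edges, and coinciding tensor edges only make an edge set smaller. Hence connectedness
  of all switchings together with the count forces, in each of them, every tensor to contribute its
  own edge and every edge to be a bridge; most later contradictions exhibit a redundant edge. The
  second source of strength is that each leaf of a subtree represents its root in some switching, so
  one statement about all switchings yields statements about all choices of leaves on the two sides
  of a tensor. The obstacle is that the representative of a tensor is tied to an end of its own
  edge, while a par or a jumped bottom separates the two; restoring connectedness after such a
  change is the task of the exchange arguments. Performing tensors from the leaves downwards,
  instead of splitting the graph at a final tensor, keeps the set of leaves fixed throughout: a step
  only merges two blocks.\<close>

definition conn :: "'b set set \<Rightarrow> 'b \<Rightarrow> 'b \<Rightarrow> bool" where
  "conn D = (\<lambda>x y. {x, y} \<in> D)\<^sup>*\<^sup>*"

definition spans :: "'b set set \<Rightarrow> 'b set \<Rightarrow> bool" where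
  "spans D V \<longleftrightarrow> (\<forall>x\<in>V. \<forall>y\<in>V. conn D x y)"

text \<open>Bridge form of acyclicity; loops are excluded as well, because \<open>conn\<close> is
  reflexive. It suits an induction that inserts edges one by one.\<close>

definition forest :: "'b set set \<Rightarrow> bool" where
  "forest D \<longleftrightarrow> (\<forall>u v. {u, v} \<in> D \<longrightarrow> \<not> conn (D - {{u, v}}) u v)"

lemma conn_refl [simp]: "conn D x x"
  by (simp add: conn_def)

lemma conn_edge: "{x, y} \<in> D \<Longrightarrow> conn D x y"
  by (simp add: conn_def r_into_rtranclp)

lemma conn_trans [trans]: "conn D x y \<Longrightarrow> conn D y z \<Longrightarrow> conn D x z"
  unfolding conn_def by (rule rtranclp_trans)

lemma conn_sym: "conn D x y \<Longrightarrow> conn D y x"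
  unfolding conn_def
proof (induction rule: rtranclp_induct)
  case (step y z)
  then have "{z, y} \<in> D" by (simp add: insert_commute)
  then show ?case using step.IH by (rule converse_rtranclp_into_rtranclp)
qed simp

text \<open>Used in two ways: with the identity it compares edge sets, with a non-injective
  \<open>g\<close> it contracts vertices.\<close>

lemma conn_map:
  assumes "conn D x y" and "\<And>a b. {a, b} \<in> D \<Longrightarrow> conn D' (g a) (g b)"
  shows "conn D' (g x) (g y)"
  using assms(1) unfolding conn_def
proof (induction rule: rtranclp_induct)
  case (step y z)
  then show ?case
    using assms(2)[of y z] unfolding conn_def by (meson rtranclp_trans)
qed simp

lemma conn_mono: "conn D x y \<Longrightarrow> D \<subseteq> D' \<Longrightarrow> conn D' x y"
  by (rule conn_map[where g = "\<lambda>x. x"]) (auto intro: conn_edge)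

lemma conn_closed:
  assumes "conn D x y" "x \<in> U" "\<And>a b. {a, b} \<in> D \<Longrightarrow> a \<in> U \<Longrightarrow> b \<in> U"
  shows "y \<in> U"
  using assms(1) unfolding conn_def
proof (induction rule: rtranclp_induct)
  case (step y z)
  then show ?case using assms(3) by blast
qed (rule assms(2))

lemma conn_insert_cases:
  assumes "conn (insert {u, v} D) x y"
  shows "conn D x y \<or> (conn D x u \<and> conn D v y) \<or> (conn D x v \<and> conn D u y)"
  using assms unfolding conn_def[of "insert {u, v} D"]
proof (induction rule: rtranclp_induct)
  case (step y z)
  then consider "{y, z} \<in> D" | "y = u" "z = v" | "y = v" "z = u"
    by (auto simp: doubleton_eq_iff)
  then show ?case
  proof cases
    case 1
    then have "conn D y z" by (rule conn_edge)
    then show ?thesis using step.IH conn_trans[of D _ y z] by blast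
  next
    case 2
    then show ?thesis using step.IH by auto
  next
    case 3
    then show ?thesis using step.IH by auto
  qed
qed simp

lemma conn_redundant:
  assumes "conn D u v" "conn (insert {u, v} D) x y"
  shows "conn D x y"
proof -
  have "conn D v u" using assms(1) by (rule conn_sym)
  then show ?thesis
    using conn_insert_cases[OF assms(2)] assms(1) conn_trans[of D x] conn_trans[of D u v]
      conn_trans[of D v u] by blast
qed

lemma spans_redundant: "conn D u v \<Longrightarrow> spans (insert {u, v} D) V \<Longrightarrow> spans D V"
  unfolding spans_def by (blast intro: conn_redundant)

text \<open>The values of \<open>c\<close> stand for the connected components, which can thus be
  counted without forming a quotient. Inserting an edge merges at most two components, and exactly
  two if it is a bridge; both bounds go through one induction because they concern the same
  \<open>c\<close>.\<close>

lemma component_function: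
  assumes "finite D"
  shows "\<exists>c :: 'b \<Rightarrow> 'b. (\<forall>x y. conn D x y \<longleftrightarrow> c x = c y) \<and>
    (\<forall>V. finite V \<longrightarrow> card V \<le> card D + card (c ` V) \<and>
      ((\<forall>e\<in>D. \<exists>u\<in>V. \<exists>v\<in>V. e = {u, v}) \<longrightarrow> forest D \<longrightarrow> card D + card (c ` V) \<le> card V))"
  using assms
proof (induction D rule: finite_induct)
  case empty
  have "conn {} x y \<longleftrightarrow> x = y" for x y :: 'b
  proof
    assume "conn {} x y"
    then have "y \<in> {x}" by (rule conn_closed) simp_all
    then show "x = y" by simp
  qed simp
  then show ?case
    by (intro exI[of _ "\<lambda>x. x"]) simp
next
  case (insert e D)
  from insert.IH obtain c :: "'b \<Rightarrow> 'b" where c: "\<forall>x y. conn D x y \<longleftrightarrow> c x = c y"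
    and cards: "\<forall>V. finite V \<longrightarrow> card V \<le> card D + card (c ` V) \<and>
      ((\<forall>e\<in>D. \<exists>u\<in>V. \<exists>v\<in>V. e = {u, v}) \<longrightarrow> forest D \<longrightarrow> card D + card (c ` V) \<le> card V)"
    by (elim exE conjE)
  have c: "conn D x y \<longleftrightarrow> c x = c y" for x y using c by simp
  have card1: "card V \<le> card D + card (c ` V)" if "finite V" for V
    using cards[rule_format, OF that] by (rule conjunct1)
  have card2: "card D + card (c ` V) \<le> card V"
    if "finite V" "\<forall>e\<in>D. \<exists>u\<in>V. \<exists>v\<in>V. e = {u, v}" "forest D" for V
    using cards[rule_format, OF that(1)] that(2,3) by blast
  have sub: "forest D" if "forest (insert e D)"
    unfolding forest_def
  proof (intro allI impI notI)
    fix u v assume uv: "{u, v} \<in> D" and uv': "conn (D - {{u, v}}) u v"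
    from uv' have "conn (insert e D - {{u, v}}) u v"
      by (rule conn_mono) auto
    with that uv show False unfolding forest_def by blast
  qed
  show ?case
  proof (cases "\<exists>u v. e = {u, v}")
    \<comment> \<open>A member of the edge set that is no doubleton joins nothing: it only weakens
      the first bound and contradicts the premise of the second.\<close>
    case False
    have eq: "conn (insert e D) x y \<longleftrightarrow> conn D x y" for x y
    proof
      assume "conn (insert e D) x y"
      then show "conn D x y"
      proof (rule conn_map[where g = "\<lambda>x. x"])
        fix a b assume "{a, b} \<in> insert e D"
        with False have "{a, b} \<in> D" by blast
        then show "conn D a b" by (rule conn_edge)
      qed
    next
      assume "conn D x y"
      then show "conn (insert e D) x y" by (rule conn_mono) auto
    qed
    show ?thesis
    proof (intro exI[of _ c] conjI allI impI)
      fix V :: "'b set" assume "finite V"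
      then show "card V \<le> card (insert e D) + card (c ` V)"
        using card1[of V] insert.hyps by simp
    next
      fix V :: "'b set" assume "\<forall>e\<in>insert e D. \<exists>u\<in>V. \<exists>v\<in>V. e = {u, v}"
      with False show "card (insert e D) + card (c ` V) \<le> card V" by blast
    qed (simp add: eq c)
  next
    case True
    then obtain u v where e: "e = {u, v}" by blast
    \<comment> \<open>As in union-find, the component of \<open>v\<close> is redirected to that of
      \<open>u\<close>.\<close>
    define c' where "c' = (\<lambda>x. if c x = c v then c u else c x)"
    have c': "conn (insert e D) x y \<longleftrightarrow> c' x = c' y" for x y
    proof
      assume "conn (insert e D) x y"
      from conn_insert_cases[OF this[unfolded e]] show "c' x = c' y"
        unfolding c c'_def by auto
    next
      assume eq: "c' x = c' y"
      have *: "conn (insert e D) x y" if "c x = c y" for x y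
        by (rule conn_mono[of D]) (use that c in auto)
      have uv: "conn (insert e D) u v" by (simp add: conn_edge e)
      have vu: "conn (insert e D) v u" using uv by (rule conn_sym)
      consider "c x = c y" | "c x = c v" "c u = c y" | "c x = c u" "c v = c y"
        using eq unfolding c'_def by (auto split: if_splits)
      then show "conn (insert e D) x y"
      proof cases
        case 1
        then show ?thesis by (rule *)
      next
        case 2
        then show ?thesis using conn_trans[OF conn_trans[OF *[of x v] vu] *[of u y]] by blast
      next
        case 3
        then show ?thesis using conn_trans[OF conn_trans[OF *[of x u] uv] *[of v y]] by blast
      qed
    qed
    show ?thesis
    proof (intro exI[of _ c'] conjI allI impI)
      fix x y show "conn (insert e D) x y \<longleftrightarrow> c' x = c' y" by (rule c')
    next
      fix V :: "'b set" assume fin: "finite V"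
      have "c ` V \<subseteq> insert (c v) (c' ` V)" unfolding c'_def by auto
      then have "card (c ` V) \<le> card (insert (c v) (c' ` V))"
        using fin by (intro card_mono) auto
      also have "\<dots> \<le> card (c' ` V) + 1"
        using fin by (simp add: card_insert_if)
      finally have "card (c ` V) \<le> card (c' ` V) + 1" .
      then show "card V \<le> card (insert e D) + card (c' ` V)"
        using card1[OF fin] insert.hyps by simp
    next
      fix V :: "'b set" assume fin: "finite V"
        and V: "\<forall>e\<in>insert e D. \<exists>u\<in>V. \<exists>v\<in>V. e = {u, v}" and F: "forest (insert e D)"
      have "\<exists>u'\<in>V. \<exists>v'\<in>V. {u, v} = {u', v'}" using V unfolding e by simp
      then have "u \<in> V" "v \<in> V" by (auto simp: doubleton_eq_iff)
      have "\<not> conn D u v"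
      proof -
        have "\<not> conn (insert e D - {{u, v}}) u v" using F unfolding forest_def e by blast
        then show ?thesis using insert.hyps unfolding e by (simp add: Diff_insert_absorb)
      qed
      then have ne: "c u \<noteq> c v" by (simp add: c)
      have "c' ` V \<subseteq> c ` V - {c v}"
        unfolding c'_def using ne \<open>u \<in> V\<close> by auto
      then have "card (c' ` V) \<le> card (c ` V - {c v})"
        using fin by (intro card_mono) auto
      moreover have "card (c ` V - {c v}) + 1 = card (c ` V)"
        using fin \<open>v \<in> V\<close> by (metis Suc_eq_plus1 card_Suc_Diff1 finite_imageI imageI)
      moreover have "card D + card (c ` V) \<le> card V"
        using card2[OF fin _ sub[OF F]] V by blast
      ultimately show "card (insert e D) + card (c' ` V) \<le> card V"
        using insert.hyps by simp
    qed
  qed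
qed

lemma spans_card:
  assumes "finite D" "finite V" "spans D V"
  shows "card V \<le> card D + 1"
proof (cases "V = {}")
  case False
  then obtain x where "x \<in> V" by blast
  obtain c :: "'a \<Rightarrow> 'a" where c: "\<forall>x y. conn D x y \<longleftrightarrow> c x = c y"
    and card: "\<forall>V. finite V \<longrightarrow> card V \<le> card D + card (c ` V) \<and>
      ((\<forall>e\<in>D. \<exists>u\<in>V. \<exists>v\<in>V. e = {u, v}) \<longrightarrow> forest D \<longrightarrow> card D + card (c ` V) \<le> card V)"
    using component_function[OF assms(1)] by (elim exE conjE)
  have "card V \<le> card D + card (c ` V)"
    using card[rule_format, OF assms(2)] by (rule conjunct1)
  moreover have "c y = c x" if "y \<in> V" for y
    using assms(3) c that \<open>x \<in> V\<close> unfolding spans_def by blast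
  then have "c ` V \<subseteq> {c x}" by blast
  then have "card (c ` V) \<le> card {c x}" by (intro card_mono) auto
  ultimately show ?thesis by simp
qed simp

lemma forest_card:
  assumes "finite D" "finite V" "V \<noteq> {}" "\<forall>e\<in>D. \<exists>u\<in>V. \<exists>v\<in>V. e = {u, v}" "forest D"
  shows "card D + 1 \<le> card V"
proof -
  obtain c :: "'a \<Rightarrow> 'a" where
    card: "\<forall>V. finite V \<longrightarrow> card V \<le> card D + card (c ` V) \<and>
      ((\<forall>e\<in>D. \<exists>u\<in>V. \<exists>v\<in>V. e = {u, v}) \<longrightarrow> forest D \<longrightarrow> card D + card (c ` V) \<le> card V)"
    using component_function[OF assms(1)] by (elim exE conjE)
  have "card D + card (c ` V) \<le> card V"
    using card[rule_format, OF assms(2)] assms(4,5) by blast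
  moreover have "card (c ` V) > 0" using assms by (simp add: card_gt_0_iff)
  ultimately show ?thesis by simp
qed

text \<open>The set \<open>D\<close> is too small to connect \<open>V\<close> on its own, so the
  additional edge cannot be redundant. This is how the count takes the place of acyclicity.\<close>

lemma tight_spans_not_conn:
  assumes "finite D" "finite V" "card D + 1 < card V" "spans (insert {u, v} D) V"
  shows "\<not> conn D u v"
proof
  assume "conn D u v"
  then have "spans D V" using assms(4) by (rule spans_redundant)
  with spans_card[OF assms(1,2)] assms(3) show False by simp
qed

section \<open>Switchings as graphs on the leaves\<close>

text \<open>In \<open>sw T r E\<close>, the leaf \<open>r\<close> represents the root of \<open>T\<close>.  For a tensor it may be chosen on either side:
  both choices give the same connectivity, and having both simplifies the exchange arguments below.\<close>
inductive sw :: "('v, 'a) tree \<Rightarrow> 'v \<Rightarrow> 'v set set \<Rightarrow> bool" where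
  sw_leaf: "sw (Leaf l) (fst l) {}"
| sw_tens: "sw A a E \<Longrightarrow> sw B b F \<Longrightarrow> r \<in> {a, b} \<Longrightarrow> sw (Tens A B) r (insert {a, b} (E \<union> F))"
| sw_parr: "sw A a E \<Longrightarrow> sw B b F \<Longrightarrow> r \<in> {a, b} \<Longrightarrow> sw (Parr A B) r (E \<union> F)"

inductive_cases sw_leafE: "sw (Leaf l) r E"
inductive_cases sw_tensE: "sw (Tens A B) r E"
inductive_cases sw_parrE: "sw (Parr A B) r E"

fun ntens :: "('v, 'a) tree \<Rightarrow> nat" where
  "ntens (Leaf l) = 0"
| "ntens (Tens A B) = Suc (ntens A + ntens B)"
| "ntens (Parr A B) = ntens A + ntens B"

fun nparr :: "('v, 'a) tree \<Rightarrow> nat" where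
  "nparr (Leaf l) = 0"
| "nparr (Tens A B) = nparr A + nparr B"
| "nparr (Parr A B) = Suc (nparr A + nparr B)"

lemma sw_in_names: "sw T r E \<Longrightarrow> r \<in> names T"
  by (induction rule: sw.induct) auto

lemma sw_edges: "sw T r E \<Longrightarrow> e \<in> E \<Longrightarrow> \<exists>a\<in>names T. \<exists>b\<in>names T. e = {a, b}"
proof (induction arbitrary: e rule: sw.induct)
  case (sw_tens A a E B b F r)
  have "a \<in> names A" "b \<in> names B" by (rule sw_in_names[OF sw_tens.hyps(1)], rule sw_in_names[OF sw_tens.hyps(2)])
  moreover have "e = {a, b} \<or> e \<in> E \<or> e \<in> F" using sw_tens.prems by blast
  ultimately show ?case
    using sw_tens.IH(1)[of e] sw_tens.IH(2)[of e] unfolding leaves.simps set_append image_Un by blast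
next
  case (sw_parr A a E B b F r)
  then show ?case
    using sw_parr.IH(1)[of e] sw_parr.IH(2)[of e] unfolding leaves.simps set_append image_Un by blast
qed simp

text \<open>Equality may fail, as two tensors can contribute the same pair. The upper bound is the
  direction that matters: a coincidence leaves too few edges for connectedness.\<close>

lemma sw_card: "sw T r E \<Longrightarrow> finite E \<and> card E \<le> ntens T"
proof (induction rule: sw.induct)
  case (sw_tens A a E B b F r)
  have "card (insert {a, b} (E \<union> F)) \<le> Suc (card (E \<union> F))" by (rule card_insert_le_m1) auto
  also have "card (E \<union> F) \<le> card E + card F" by (rule card_Un_le)
  finally show ?case using sw_tens by simp
next
  case (sw_parr A a E B b F r)
  have "card (E \<union> F) \<le> card E + card F" by (rule card_Un_le)
  then show ?case using sw_parr by simp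
qed simp

abbreviation sws :: "('v, 'a) tree list \<Rightarrow> 'v set set list \<Rightarrow> bool" where
  "sws \<equiv> list_all2 (\<lambda>T E. \<exists>r. sw T r E)"

definition leaf_correct :: "('v, 'a) tree \<Rightarrow> ('v, 'a) tree list \<Rightarrow> bool" where
  "leaf_correct P \<Gamma> \<longleftrightarrow>
     (\<forall>r E Es. sw P r E \<longrightarrow> sws \<Gamma> Es \<longrightarrow> spans (E \<union> \<Union> (set Es)) (names P)) \<and>
     card (names P) = ntens P + sum_list (map ntens \<Gamma>) + 1"

lemma leaves_nonempty [simp]: "leaves T \<noteq> []"
  by (induction T) auto

section \<open>Switchings indexed by positions\<close>

text \<open>At a par the retained child is the one opposite to the side deleted by
  \<open>switch_edges\<close>. At a tensor, where \<open>switch_edges\<close> ignores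
  \<open>s\<close>, the same function is reused to choose the representative.\<close>

fun prep :: "('v node \<Rightarrow> bool) \<Rightarrow> (bool list \<Rightarrow> 'v node) \<Rightarrow> bool list \<Rightarrow> ('v, 'a) tree \<Rightarrow> 'v" where
  "prep s mk p (Leaf l) = fst l"
| "prep s mk p (Tens A B) = (if s (mk p) then prep s mk (p @ [False]) A else prep s mk (p @ [True]) B)"
| "prep s mk p (Parr A B) = (if s (mk p) then prep s mk (p @ [False]) A else prep s mk (p @ [True]) B)"

text \<open>Tensor nodes in \<open>D\<close> contribute no edge; this models the edge removed in the side condition of the jump rule.\<close>
fun pedg :: "'v node set \<Rightarrow> ('v node \<Rightarrow> bool) \<Rightarrow> (bool list \<Rightarrow> 'v node) \<Rightarrow> bool list
               \<Rightarrow> ('v, 'a) tree \<Rightarrow> 'v set set" where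
  "pedg D s mk p (Leaf l) = {}"
| "pedg D s mk p (Tens A B) =
     (if mk p \<in> D then {} else {{prep s mk (p @ [False]) A, prep s mk (p @ [True]) B}})
     \<union> (pedg D s mk (p @ [False]) A \<union> pedg D s mk (p @ [True]) B)"
| "pedg D s mk p (Parr A B) = pedg D s mk (p @ [False]) A \<union> pedg D s mk (p @ [True]) B"

lemma sw_pos:
  assumes "\<And>q. mk (p @ q) \<notin> D"
  shows "sw T (prep s mk p T) (pedg D s mk p T)"
  using assms
proof (induction T arbitrary: p)
  case (Leaf l)
  then show ?case by (simp add: sw_leaf)
next
  case (Tens A B)
  have A: "sw A (prep s mk (p @ [False]) A) (pedg D s mk (p @ [False]) A)"
    by (rule Tens.IH(1)) (use Tens.prems[of "False # _"] in simp)
  have B: "sw B (prep s mk (p @ [True]) B) (pedg D s mk (p @ [True]) B)"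
    by (rule Tens.IH(2)) (use Tens.prems[of "True # _"] in simp)
  have "mk p \<notin> D" using Tens.prems[of "[]"] by simp
  then show ?case
    using sw_tens[OF A B, of "prep s mk p (Tens A B)"] by auto
next
  case (Parr A B)
  have A: "sw A (prep s mk (p @ [False]) A) (pedg D s mk (p @ [False]) A)"
    by (rule Parr.IH(1)) (use Parr.prems[of "False # _"] in simp)
  have B: "sw B (prep s mk (p @ [True]) B) (pedg D s mk (p @ [True]) B)"
    by (rule Parr.IH(2)) (use Parr.prems[of "True # _"] in simp)
  show ?case
    using sw_parr[OF A B, of "prep s mk p (Parr A B)"] by auto
qed

lemma pos_cong:
  assumes "\<And>q. s (mk (p @ q)) = s' (mk (p @ q))"
  shows "prep s mk p T = prep s' mk p T \<and> pedg D s mk p T = pedg D s' mk p T"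
  using assms
proof (induction T arbitrary: p)
  case (Tens A B)
  have "prep s mk (p @ [False]) A = prep s' mk (p @ [False]) A \<and>
      pedg D s mk (p @ [False]) A = pedg D s' mk (p @ [False]) A"
    by (rule Tens.IH(1)) (use Tens.prems[of "False # _"] in simp)
  moreover have "prep s mk (p @ [True]) B = prep s' mk (p @ [True]) B \<and>
      pedg D s mk (p @ [True]) B = pedg D s' mk (p @ [True]) B"
    by (rule Tens.IH(2)) (use Tens.prems[of "True # _"] in simp)
  ultimately show ?case using Tens.prems[of "[]"] by simp
next
  case (Parr A B)
  have "prep s mk (p @ [False]) A = prep s' mk (p @ [False]) A \<and>
      pedg D s mk (p @ [False]) A = pedg D s' mk (p @ [False]) A"
    by (rule Parr.IH(1)) (use Parr.prems[of "False # _"] in simp)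
  moreover have "prep s mk (p @ [True]) B = prep s' mk (p @ [True]) B \<and>
      pedg D s mk (p @ [True]) B = pedg D s' mk (p @ [True]) B"
    by (rule Parr.IH(2)) (use Parr.prems[of "True # _"] in simp)
  ultimately show ?case using Parr.prems[of "[]"] by simp
qed simp

text \<open>The two subtrees occupy disjoint sets of positions, so their switchings and the value at
  the root can be prescribed independently.\<close>

lemma pos_combine:
  assumes "inj mk"
  shows "\<exists>s. s (mk p) = b \<and>
    prep s mk (p @ [False]) A = prep s1 mk (p @ [False]) A \<and>
    pedg D s mk (p @ [False]) A = pedg D s1 mk (p @ [False]) A \<and>
    prep s mk (p @ [True]) B = prep s2 mk (p @ [True]) B \<and>
    pedg D s mk (p @ [True]) B = pedg D s2 mk (p @ [True]) B"
proof -
  define s where "s = (\<lambda>u. if u = mk p then b else if \<exists>q. u = mk (p @ False # q) then s1 u else s2 u)"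
  have eq: "mk q = mk q' \<longleftrightarrow> q = q'" for q q' using assms by (simp add: inj_eq)
  have "prep s mk (p @ [False]) A = prep s1 mk (p @ [False]) A \<and>
      pedg D s mk (p @ [False]) A = pedg D s1 mk (p @ [False]) A"
    by (rule pos_cong) (simp add: s_def eq)
  moreover have "prep s mk (p @ [True]) B = prep s2 mk (p @ [True]) B \<and>
      pedg D s mk (p @ [True]) B = pedg D s2 mk (p @ [True]) B"
    by (rule pos_cong) (simp add: s_def eq)
  moreover have "s (mk p) = b" by (simp add: s_def)
  ultimately show ?thesis by blast
qed

lemma sw_pos_ex:
  assumes "inj mk" "sw T r E"
  shows "\<exists>s. prep s mk p T = r \<and> pedg {} s mk p T = E"
  using assms(2)
proof (induction arbitrary: p rule: sw.induct)
  case (sw_leaf l)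
  then show ?case by simp
next
  case (sw_tens A a E B b F r)
  obtain s1 where s1: "prep s1 mk (p @ [False]) A = a" "pedg {} s1 mk (p @ [False]) A = E"
    using sw_tens.IH(1) by blast
  obtain s2 where s2: "prep s2 mk (p @ [True]) B = b" "pedg {} s2 mk (p @ [True]) B = F"
    using sw_tens.IH(2) by blast
  obtain s where "s (mk p) = (r = a)" "prep s mk (p @ [False]) A = a" "pedg {} s mk (p @ [False]) A = E"
    "prep s mk (p @ [True]) B = b" "pedg {} s mk (p @ [True]) B = F"
    using pos_combine[OF assms(1), of p "r = a" A s1 "{}" B s2] s1 s2 by blast
  then show ?case using sw_tens.hyps by (intro exI[of _ s]) auto
next
  case (sw_parr A a E B b F r)
  obtain s1 where s1: "prep s1 mk (p @ [False]) A = a" "pedg {} s1 mk (p @ [False]) A = E"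
    using sw_parr.IH(1) by blast
  obtain s2 where s2: "prep s2 mk (p @ [True]) B = b" "pedg {} s2 mk (p @ [True]) B = F"
    using sw_parr.IH(2) by blast
  obtain s where "s (mk p) = (r = a)" "prep s mk (p @ [False]) A = a" "pedg {} s mk (p @ [False]) A = E"
    "prep s mk (p @ [True]) B = b" "pedg {} s mk (p @ [True]) B = F"
    using pos_combine[OF assms(1), of p "r = a" A s1 "{}" B s2] s1 s2 by blast
  then show ?case using sw_parr.hyps by (intro exI[of _ s]) auto
qed

lemma sw_ex: "\<exists>r E. sw T r E"
  \<comment> \<open>Even a constant naming of the positions yields a switching, since nothing is
    deleted.\<close>
  using sw_pos[of "\<lambda>_. LN undefined" "[]" "{}" T] by blast

text \<open>Choosing at every node the side that contains \<open>x\<close> is always allowed. This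
  freedom is what the exchange arguments exploit.\<close>

lemma sw_root_ex: "x \<in> names T \<Longrightarrow> \<exists>E. sw T x E"
proof (induction T)
  case (Leaf l)
  then show ?case using sw_leaf by fastforce
next
  case (Tens A B)
  then consider "x \<in> names A" | "x \<in> names B" by auto
  then show ?case
  proof cases
    case 1
    then obtain E where "sw A x E" using Tens.IH by blast
    moreover obtain b F where "sw B b F" using sw_ex[of B] by blast
    ultimately show ?thesis using sw_tens[of A x E B b F x] by auto
  next
    case 2
    then obtain F where "sw B x F" using Tens.IH by blast
    moreover obtain a E where "sw A a E" using sw_ex[of A] by blast
    ultimately show ?thesis using sw_tens[of A a E B x F x] by auto
  qed
next
  case (Parr A B)
  then consider "x \<in> names A" | "x \<in> names B" by auto
  then show ?case
  proof cases
    case 1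
    then obtain E where "sw A x E" using Parr.IH by blast
    moreover obtain b F where "sw B b F" using sw_ex[of B] by blast
    ultimately show ?thesis using sw_parr[of A x E B b F x] by auto
  next
    case 2
    then obtain F where "sw B x F" using Parr.IH by blast
    moreover obtain a E where "sw A a E" using sw_ex[of A] by blast
    ultimately show ?thesis using sw_parr[of A a E B x F x] by auto
  qed
qed

lemma subt_append: "subt T (p @ q) = (case subt T p of None \<Rightarrow> None | Some U \<Rightarrow> subt U q)"
  by (induction T p rule: subt.induct) auto

lemma tedges_subt:
  "(u, c, k) \<in> tedges mk p T \<Longrightarrow> \<exists>q A B. u = mk (p @ q) \<and>
    (subt T q = Some (Tens A B) \<and> k = None \<and>
       (c = nid mk (p @ q @ [False]) A \<or> c = nid mk (p @ q @ [True]) B) \<or>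
     subt T q = Some (Parr A B) \<and>
       (k = Some False \<and> c = nid mk (p @ q @ [False]) A \<or> k = Some True \<and> c = nid mk (p @ q @ [True]) B))"
proof (induction T arbitrary: p)
  case (Tens X Y)
  then consider "(u, c, k) \<in> {(mk p, nid mk (p @ [False]) X, None), (mk p, nid mk (p @ [True]) Y, None)}"
    | "(u, c, k) \<in> tedges mk (p @ [False]) X" | "(u, c, k) \<in> tedges mk (p @ [True]) Y" by auto
  then show ?case
  proof cases
    case 1
    then show ?thesis by (intro exI[of _ "[]"] exI[of _ X] exI[of _ Y]) auto
  next
    case 2
    then show ?thesis
      using Tens.IH(1)[OF 2] by (elim exE) (rule exI[of _ "False # _"], auto)
  next
    case 3
    then show ?thesis
      using Tens.IH(2)[OF 3] by (elim exE) (rule exI[of _ "True # _"], auto)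
  qed
next
  case (Parr X Y)
  then consider "(u, c, k) \<in> {(mk p, nid mk (p @ [False]) X, Some False), (mk p, nid mk (p @ [True]) Y, Some True)}"
    | "(u, c, k) \<in> tedges mk (p @ [False]) X" | "(u, c, k) \<in> tedges mk (p @ [True]) Y" by auto
  then show ?case
  proof cases
    case 1
    then show ?thesis by (intro exI[of _ "[]"] exI[of _ X] exI[of _ Y]) auto
  next
    case 2
    then show ?thesis
      using Parr.IH(1)[OF 2] by (elim exE) (rule exI[of _ "False # _"], auto)
  next
    case 3
    then show ?thesis
      using Parr.IH(2)[OF 3] by (elim exE) (rule exI[of _ "True # _"], auto)
  qed
qed simp

lemma pedg_subt:
  "subt T q = Some (Tens A B) \<Longrightarrow> mk (p @ q) \<notin> D \<Longrightarrow>
    {prep s mk (p @ q @ [False]) A, prep s mk (p @ q @ [True]) B} \<in> pedg D s mk p T"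
proof (induction T q arbitrary: p rule: subt.induct)
  case (1 T)
  then show ?case by simp
next
  case (3 X Y b q)
  then show ?case using "3.IH"[of "p @ [b]"] by (cases b) auto
next
  case (4 X Y b q)
  then show ?case using "4.IH"[of "p @ [b]"] by (cases b) auto
qed simp

section \<open>Switchings of the graph and switchings of the leaves\<close>

text \<open>A retraction of the whole graph onto its leaves; \<open>the\<close> is meaningful
  because only positions of actual nodes are looked up.\<close>

definition rep_node :: "('v, 'a) tree \<Rightarrow> ('v, 'a) tree list \<Rightarrow> ('v node \<Rightarrow> bool) \<Rightarrow> 'v node \<Rightarrow> 'v" where
  "rep_node P \<Gamma> s u = (case u of LN x \<Rightarrow> x
     | PN p \<Rightarrow> prep s PN p (the (subt P p))
     | GN i p \<Rightarrow> prep s (GN i) p (the (subt (\<Gamma> ! i) p)))"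

definition graph_edg :: "'v node set \<Rightarrow> ('v, 'a) tree \<Rightarrow> ('v, 'a) tree list \<Rightarrow> ('v node \<Rightarrow> bool) \<Rightarrow> 'v set set" where
  "graph_edg D P \<Gamma> s = pedg D s PN [] P \<union> (\<Union>i<length \<Gamma>. pedg D s (GN i) [] (\<Gamma> ! i))"

text \<open>A surviving edge either collapses, because its ends have the same representative, or
  leads to the other side of a tensor and becomes that tensor's leaf edge. At a tensor in
  \<open>D\<close> no leaf edge is available, whence the demand that the edge collapses.\<close>

lemma tree_edge_conn:
  assumes e: "(u, c, k) \<in> tedges mk [] T" "k \<noteq> Some (s u)" "u \<in> D \<longrightarrow> f c = f u"
    and f: "\<And>x. f (LN x) = x" "\<And>q. f (mk q) = prep s mk q (the (subt T q))"
  shows "conn (pedg D s mk [] T) (f u) (f c)"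
proof -
  obtain q A B where u: "u = mk q" and c:
    "subt T q = Some (Tens A B) \<and> k = None \<and>
       (c = nid mk (q @ [False]) A \<or> c = nid mk (q @ [True]) B) \<or>
     subt T q = Some (Parr A B) \<and>
       (k = Some False \<and> c = nid mk (q @ [False]) A \<or> k = Some True \<and> c = nid mk (q @ [True]) B)"
    using tedges_subt[OF e(1)] by auto
  have nid: "f (nid mk (q @ p) U) = prep s mk (q @ p) U" if "subt T (q @ p) = Some U" for p U
    using that f by (cases U) auto
  show ?thesis
  proof (cases "u \<in> D")
    case True
    then show ?thesis using e(3) by simp
  next
    case False
    from c show ?thesis
    proof (elim disjE conjE)
      assume T: "subt T q = Some (Tens A B)"
      have A: "f (nid mk (q @ [False]) A) = prep s mk (q @ [False]) A"
        by (rule nid) (simp add: subt_append T)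
      have B: "f (nid mk (q @ [True]) B) = prep s mk (q @ [True]) B"
        by (rule nid) (simp add: subt_append T)
      have ed: "{prep s mk (q @ [False]) A, prep s mk (q @ [True]) B} \<in> pedg D s mk [] T"
        using pedg_subt[OF T, of mk "[]" D s] False u by simp
      have u': "f u = (if s u then prep s mk (q @ [False]) A else prep s mk (q @ [True]) B)"
        using f(2) T u by simp
      {
        assume "c = nid mk (q @ [False]) A"
        then show ?thesis
          using A u' conn_edge[OF ed] by (auto intro: conn_sym)
      next
        assume "c = nid mk (q @ [True]) B"
        then show ?thesis
          using B u' conn_edge[OF ed] by auto
      }
    next
      assume T: "subt T q = Some (Parr A B)" and "k = Some False" "c = nid mk (q @ [False]) A"
      moreover have "f (nid mk (q @ [False]) A) = prep s mk (q @ [False]) A"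
        by (rule nid) (simp add: subt_append T)
      ultimately show ?thesis using e(2) f(2) u by simp
    next
      assume T: "subt T q = Some (Parr A B)" and "k = Some True" "c = nid mk (q @ [True]) B"
      moreover have "f (nid mk (q @ [True]) B) = prep s mk (q @ [True]) B"
        by (rule nid) (simp add: subt_append T)
      ultimately show ?thesis using e(2) f(2) u by simp
    qed
  qed
qed

text \<open>Projection to representatives maps paths to paths. Allowing a subset \<open>E\<close> of
  the switching covers the side condition of the jump rule, where one more edge is removed.\<close>

lemma graph_to_leaf:
  assumes path: "(adj E)\<^sup>*\<^sup>* u v" and E: "E \<subseteq> switch_edges s (gedges P \<Gamma>)"
    and D: "\<And>u c k. (u, c, k) \<in> E \<Longrightarrow> u \<in> D \<Longrightarrow> rep_node P \<Gamma> s c = rep_node P \<Gamma> s u"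
  shows "conn (graph_edg D P \<Gamma> s) (rep_node P \<Gamma> s u) (rep_node P \<Gamma> s v)"
  using path
proof (induction rule: rtranclp_induct)
  case base
  then show ?case by simp
next
  case (step v w)
  have *: "conn (graph_edg D P \<Gamma> s) (rep_node P \<Gamma> s u) (rep_node P \<Gamma> s c)" if ed: "(u, c, k) \<in> E" for u c k
  proof -
    from ed E have k: "k \<noteq> Some (s u)" and "(u, c, k) \<in> gedges P \<Gamma>"
      unfolding switch_edges_def by auto
    then consider "(u, c, k) \<in> tedges PN [] P" |
      i where "i < length \<Gamma>" "(u, c, k) \<in> tedges (GN i) [] (\<Gamma> ! i)"
      unfolding gedges_def by auto
    then show ?thesis
    proof cases
      case 1
      have "conn (pedg D s PN [] P) (rep_node P \<Gamma> s u) (rep_node P \<Gamma> s c)"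
        using D[OF ed] by (intro tree_edge_conn[where s = s, OF 1 k]) (auto simp: rep_node_def)
      then show ?thesis by (rule conn_mono) (auto simp: graph_edg_def)
    next
      case 2
      have "conn (pedg D s (GN i) [] (\<Gamma> ! i)) (rep_node P \<Gamma> s u) (rep_node P \<Gamma> s c)"
        using D[OF ed] by (intro tree_edge_conn[where s = s, OF 2(2) k]) (auto simp: rep_node_def)
      then show ?thesis by (rule conn_mono) (use 2(1) in \<open>auto simp: graph_edg_def\<close>)
    qed
  qed
  have "conn (graph_edg D P \<Gamma> s) (rep_node P \<Gamma> s v) (rep_node P \<Gamma> s w)"
    using step(2) * conn_sym unfolding adj_def by metis
  with step.IH show ?case by (rule conn_trans)
qed

section \<open>From connectivity of leaves back to connectivity of nodes\<close>

abbreviation linked :: "('v node \<times> 'v node \<times> bool option) set \<Rightarrow> 'v node \<Rightarrow> 'v node \<Rightarrow> bool" where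
  "linked E \<equiv> (adj E)\<^sup>*\<^sup>*"

lemma adj_sym: "adj E u v \<Longrightarrow> adj E v u"
  unfolding adj_def by blast

lemma adj_rtrancl_sym: "linked E u v \<Longrightarrow> linked E v u"
  by (induction rule: rtranclp_induct) (auto intro: converse_rtranclp_into_rtranclp adj_sym)

text \<open>The claims are proved together because the leaf edge of a tensor is realised by a path
  through the tensor node, which needs the first claim for both children.\<close>

lemma leaf_to_tree:
  assumes "{(u, c, k) \<in> tedges mk p T. k \<noteq> Some (s u)} \<subseteq> E"
  shows "linked E (nid mk p T) (LN (prep s mk p T)) \<and>
    (\<forall>a b. {a, b} \<in> pedg {} s mk p T \<longrightarrow> linked E (LN a) (LN b)) \<and>
    (\<forall>u\<in>tnodes mk p T. \<exists>x\<in>names T. linked E u (LN x))"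
  using assms
proof (induction T arbitrary: p)
  case (Leaf l)
  then show ?case by auto
next
  case (Tens A B)
  have A: "linked E (nid mk (p @ [False]) A) (LN (prep s mk (p @ [False]) A))"
    "\<And>a b. {a, b} \<in> pedg {} s mk (p @ [False]) A \<Longrightarrow> linked E (LN a) (LN b)"
    "\<And>u. u\<in>tnodes mk (p @ [False]) A \<Longrightarrow> \<exists>x\<in>names A. linked E u (LN x)"
    using Tens.IH(1)[of "p @ [False]"] Tens.prems by auto
  have B: "linked E (nid mk (p @ [True]) B) (LN (prep s mk (p @ [True]) B))"
    "\<And>a b. {a, b} \<in> pedg {} s mk (p @ [True]) B \<Longrightarrow> linked E (LN a) (LN b)"
    "\<And>u. u\<in>tnodes mk (p @ [True]) B \<Longrightarrow> \<exists>x\<in>names B. linked E u (LN x)"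
    using Tens.IH(2)[of "p @ [True]"] Tens.prems by auto
  have "adj E (mk p) (nid mk (p @ [False]) A)" "adj E (mk p) (nid mk (p @ [True]) B)"
    using Tens.prems unfolding adj_def by fastforce+
  then have rA: "linked E (mk p) (LN (prep s mk (p @ [False]) A))"
    and rB: "linked E (mk p) (LN (prep s mk (p @ [True]) B))"
    using A(1) B(1) by (auto intro: converse_rtranclp_into_rtranclp)
  have AB: "linked E (LN (prep s mk (p @ [False]) A)) (LN (prep s mk (p @ [True]) B))"
    using adj_rtrancl_sym[OF rA] rB by (rule rtranclp_trans)
  have inA: "prep s mk (p @ [False]) A \<in> names A"
    using sw_in_names[OF sw_pos[of mk "p @ [False]" "{}" A s]] by simp
  show ?case
  proof (intro conjI allI impI ballI)
    show "linked E (nid mk p (Tens A B)) (LN (prep s mk p (Tens A B)))"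
      using rA rB by simp
  next
    fix a b assume "{a, b} \<in> pedg {} s mk p (Tens A B)"
    then show "linked E (LN a) (LN b)"
      using A(2)[of a b] B(2)[of a b] AB adj_rtrancl_sym[OF AB] by (auto simp: doubleton_eq_iff)
  next
    fix u assume "u \<in> tnodes mk p (Tens A B)"
    then consider "u = mk p" | "u \<in> tnodes mk (p @ [False]) A" | "u \<in> tnodes mk (p @ [True]) B" by auto
    then show "\<exists>x\<in>names (Tens A B). linked E u (LN x)"
    proof cases
      case 1
      then show ?thesis using rA inA unfolding leaves.simps set_append image_Un by blast
    next
      case 2
      then show ?thesis using A(3) unfolding leaves.simps set_append image_Un by blast
    next
      case 3
      then show ?thesis using B(3) unfolding leaves.simps set_append image_Un by blast
    qed
  qed
next
  case (Parr A B)
  have A: "linked E (nid mk (p @ [False]) A) (LN (prep s mk (p @ [False]) A))"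
    "\<And>a b. {a, b} \<in> pedg {} s mk (p @ [False]) A \<Longrightarrow> linked E (LN a) (LN b)"
    "\<And>u. u\<in>tnodes mk (p @ [False]) A \<Longrightarrow> \<exists>x\<in>names A. linked E u (LN x)"
    using Parr.IH(1)[of "p @ [False]"] Parr.prems by auto
  have B: "linked E (nid mk (p @ [True]) B) (LN (prep s mk (p @ [True]) B))"
    "\<And>a b. {a, b} \<in> pedg {} s mk (p @ [True]) B \<Longrightarrow> linked E (LN a) (LN b)"
    "\<And>u. u\<in>tnodes mk (p @ [True]) B \<Longrightarrow> \<exists>x\<in>names B. linked E u (LN x)"
    using Parr.IH(2)[of "p @ [True]"] Parr.prems by auto
  have "s (mk p) \<Longrightarrow> adj E (mk p) (nid mk (p @ [False]) A)"
    "\<not> s (mk p) \<Longrightarrow> adj E (mk p) (nid mk (p @ [True]) B)"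
    using Parr.prems unfolding adj_def by fastforce+
  then have r: "linked E (mk p) (LN (prep s mk p (Parr A B)))"
    using A(1) B(1) by (auto intro: converse_rtranclp_into_rtranclp)
  have inA: "prep s mk p (Parr A B) \<in> names (Parr A B)"
    using sw_in_names[OF sw_pos[of mk p "{}" "Parr A B" s]] by simp
  show ?case
  proof (intro conjI allI impI ballI)
    show "linked E (nid mk p (Parr A B)) (LN (prep s mk p (Parr A B)))"
      using r by simp
  next
    fix a b assume "{a, b} \<in> pedg {} s mk p (Parr A B)"
    then show "linked E (LN a) (LN b)"
      using A(2)[of a b] B(2)[of a b] by auto
  next
    fix u assume "u \<in> tnodes mk p (Parr A B)"
    then consider "u = mk p" | "u \<in> tnodes mk (p @ [False]) A" | "u \<in> tnodes mk (p @ [True]) B" by auto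
    then show "\<exists>x\<in>names (Parr A B). linked E u (LN x)"
    proof cases
      case 1
      then show ?thesis using r inA by blast
    next
      case 2
      then show ?thesis using A(3) unfolding leaves.simps set_append image_Un by blast
    next
      case 3
      then show ?thesis using B(3) unfolding leaves.simps set_append image_Un by blast
    qed
  qed
qed

lemma connected_graph_if_spans:
  assumes sp: "spans (graph_edg {} P \<Gamma> s) N" and NP: "names P \<subseteq> N" and N\<Gamma>: "\<And>T. T \<in> set \<Gamma> \<Longrightarrow> names T \<subseteq> N"
  shows "connected_graph (gnodes P \<Gamma>) (switch_edges s (gedges P \<Gamma>))"
proof -
  let ?E = "switch_edges s (gedges P \<Gamma>)"
  have P: "{(u, c, k) \<in> tedges PN [] P. k \<noteq> Some (s u)} \<subseteq> ?E"
    unfolding switch_edges_def gedges_def by auto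
  have G: "{(u, c, k) \<in> tedges (GN i) [] (\<Gamma> ! i). k \<noteq> Some (s u)} \<subseteq> ?E" if "i < length \<Gamma>" for i
    using that unfolding switch_edges_def gedges_def by auto
  have ed: "linked ?E (LN a) (LN b)" if "{a, b} \<in> graph_edg {} P \<Gamma> s" for a b
    using that leaf_to_tree[OF P] leaf_to_tree[OF G] unfolding graph_edg_def by blast
  have leaf: "linked ?E (LN a) (LN b)" if "conn (graph_edg {} P \<Gamma> s) a b" for a b
    using that unfolding conn_def
  proof (induction rule: rtranclp_induct)
    case (step y z)
    then show ?case using ed[of y z] by (meson rtranclp_trans)
  qed simp
  have node: "\<exists>x\<in>N. linked ?E u (LN x)" if "u \<in> gnodes P \<Gamma>" for u
    using that unfolding gnodes_def
  proof (elim UnE UN_E)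
    assume "u \<in> tnodes PN [] P"
    then show ?thesis using leaf_to_tree[OF P] NP by blast
  next
    fix i assume i: "i \<in> {..<length \<Gamma>}" "u \<in> tnodes (GN i) [] (\<Gamma> ! i)"
    then obtain x where "x \<in> names (\<Gamma> ! i)" "linked ?E u (LN x)"
      using leaf_to_tree[OF G[of i]] by blast
    then show ?thesis using N\<Gamma>[of "\<Gamma> ! i"] i(1) by (meson lessThan_iff nth_mem subsetD)
  qed
  show ?thesis
    unfolding connected_graph_def
  proof (intro ballI)
    fix u v assume "u \<in> gnodes P \<Gamma>" "v \<in> gnodes P \<Gamma>"
    then obtain x y where "x \<in> N" "y \<in> N" "linked ?E u (LN x)" "linked ?E v (LN y)"
      using node by blast
    moreover from this sp have "linked ?E (LN x) (LN y)"
      unfolding spans_def using leaf by blast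
    ultimately show "linked ?E u v"
      using adj_rtrancl_sym rtranclp_trans by metis
  qed
qed

section \<open>Counting nodes and edges\<close>

fun ipos :: "bool list \<Rightarrow> ('v, 'a) tree \<Rightarrow> bool list set" where
  "ipos p (Leaf l) = {}"
| "ipos p (Tens A B) = insert p (ipos (p @ [False]) A \<union> ipos (p @ [True]) B)"
| "ipos p (Parr A B) = insert p (ipos (p @ [False]) A \<union> ipos (p @ [True]) B)"

lemma ipos_prefix: "q \<in> ipos p T \<Longrightarrow> \<exists>r. q = p @ r"
  by (induction T arbitrary: p) fastforce+

lemma ipos_disjoint:
  "p \<notin> ipos (p @ [b]) A" "ipos (p @ [False]) A \<inter> ipos (p @ [True]) B = {}"
  using ipos_prefix[of _ "p @ [b]" A] ipos_prefix[of _ "p @ [False]" A] ipos_prefix[of _ "p @ [True]" B]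
  by fastforce+

lemma finite_ipos [simp]: "finite (ipos p T)"
  by (induction T arbitrary: p) auto

lemma card_ipos: "card (ipos p T) = ntens T + nparr T"
  by (induction T arbitrary: p) (auto simp: ipos_disjoint card_Un_disjoint)

lemma tnodes_eq: "tnodes mk p T = LN ` names T \<union> mk ` ipos p T"
  by (induction T arbitrary: p) auto

lemma gnodes_eq:
  assumes "set (leaves P) = set (concat (map leaves \<Gamma>))"
  shows "gnodes P \<Gamma> = LN ` names P \<union>
    (PN ` ipos [] P \<union> (\<lambda>(i, q). GN i q) ` (SIGMA i:{..<length \<Gamma>}. ipos [] (\<Gamma> ! i)))"
proof -
  have "set (leaves (\<Gamma> ! i)) \<subseteq> set (leaves P)" if "i < length \<Gamma>" for i
    using assms nth_mem[OF that] by auto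
  then have sub: "(\<Union>i<length \<Gamma>. LN ` names (\<Gamma> ! i)) \<subseteq> LN ` names P"
    by (intro UN_least image_mono) simp
  have GN: "(\<lambda>(i, q). GN i q) ` (SIGMA i:{..<length \<Gamma>}. ipos [] (\<Gamma> ! i)) =
      (\<Union>i<length \<Gamma>. GN i ` ipos [] (\<Gamma> ! i))" by auto
  have absorb: "L \<union> A \<union> (M \<union> G) = L \<union> (A \<union> G)" if "M \<subseteq> L" for L A M G :: "'a node set"
    using that by blast
  show ?thesis
    unfolding gnodes_def tnodes_eq UN_Un_distrib GN by (rule absorb[OF sub])
qed

lemma sum_list_nth: "(\<Sum>i<length xs. f (xs ! i)) = sum_list (map f xs)" for f :: "'b \<Rightarrow> nat"
  by (simp add: sum_list_sum_nth atLeast0LessThan)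

text \<open>Linking and forest share their leaves, so these are counted once; inner nodes of
  different trees differ by their constructors or indices.\<close>

lemma card_gnodes:
  assumes "set (leaves P) = set (concat (map leaves \<Gamma>))"
  shows "finite (gnodes P \<Gamma>) \<and> card (gnodes P \<Gamma>) =
    card (names P) + (ntens P + nparr P) + sum_list (map (\<lambda>T. ntens T + nparr T) \<Gamma>)"
proof -
  define G where "G = (SIGMA i:{..<length \<Gamma>}. ipos [] (\<Gamma> ! i))"
  define Ls :: "'a node set" where "Ls = LN ` names P"
  define Ps :: "'a node set" where "Ps = PN ` ipos [] P"
  define Gs :: "'a node set" where "Gs = (\<lambda>(i, q). GN i q) ` G"
  have "card G = (\<Sum>i<length \<Gamma>. card (ipos [] (\<Gamma> ! i)))" by (simp add: G_def card_SigmaI)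
  then have "card G = sum_list (map (\<lambda>T. ntens T + nparr T) \<Gamma>)"
    using sum_list_nth[of "\<lambda>T. ntens T + nparr T" \<Gamma>] by (simp add: card_ipos)
  moreover have "card Gs = card G"
    unfolding Gs_def by (rule card_image) (auto simp: inj_on_def)
  moreover have "card Ps = ntens P + nparr P"
    unfolding Ps_def by (simp add: card_image inj_on_def card_ipos)
  moreover have "card Ls = card (names P)"
    unfolding Ls_def by (rule card_image) (auto simp: inj_on_def)
  moreover have fin: "finite G" "finite Ls" "finite Ps" "finite Gs"
    unfolding G_def Ls_def Ps_def Gs_def by auto
  moreover have "card (Ls \<union> (Ps \<union> Gs)) = card Ls + card (Ps \<union> Gs)"
    using fin by (intro card_Un_disjoint) (auto simp: Ls_def Ps_def Gs_def)
  moreover have "card (Ps \<union> Gs) = card Ps + card Gs"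
    using fin by (intro card_Un_disjoint) (auto simp: Ls_def Ps_def Gs_def)
  moreover have "gnodes P \<Gamma> = Ls \<union> (Ps \<union> Gs)"
    unfolding gnodes_eq[OF assms] Ls_def Ps_def Gs_def G_def ..
  ultimately show ?thesis by simp
qed

lemma tedges_fst: "(u, c, k) \<in> tedges mk p T \<Longrightarrow> u \<in> mk ` ipos p T"
  by (induction T arbitrary: p) auto

lemma finite_tedges [simp]: "finite (tedges mk p T)"
  by (induction T arbitrary: p) auto

lemma finite_switch_edges: "finite E \<Longrightarrow> finite (switch_edges s E)"
  unfolding switch_edges_def by (rule finite_subset[of _ E]) auto

text \<open>The critical case is a tensor of two leaves: disjoint names keep its two edges from
  coinciding.\<close>

lemma nid_eq:
  assumes "inj mk" "\<And>q x. mk q \<noteq> LN x" "names A \<inter> names B = {}"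
  shows "nid mk (p @ [False]) A \<noteq> nid mk (p @ [True]) B"
  using assms assms(2)[symmetric] by (cases A; cases B) (auto simp: inj_eq)

text \<open>A tensor keeps both of its edges and a par exactly one, whichever side is deleted; hence
  the number is the same for all switchings.\<close>

lemma card_switch_tedges:
  assumes "inj mk" "\<And>q x. mk q \<noteq> LN x" "distinct (map fst (leaves T))"
  shows "card (switch_edges s (tedges mk p T)) = 2 * ntens T + nparr T"
  using assms(3)
proof (induction T arbitrary: p)
  case (Leaf l)
  have "switch_edges s {} = {}" by (auto simp: switch_edges_def)
  then show ?case by simp
next
  case (Tens A B)
  let ?R = "{(mk p, nid mk (p @ [False]) A, None), (mk p, nid mk (p @ [True]) B, None :: bool option)}"
  let ?A = "switch_edges s (tedges mk (p @ [False]) A)"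
  let ?B = "switch_edges s (tedges mk (p @ [True]) B)"
  have sub: "?A \<subseteq> tedges mk (p @ [False]) A" "?B \<subseteq> tedges mk (p @ [True]) B"
    unfolding switch_edges_def by auto
  have eq: "switch_edges s (tedges mk p (Tens A B)) = ?R \<union> (?A \<union> ?B)"
    unfolding switch_edges_def by auto
  have "names A \<inter> names B = {}" using Tens.prems by auto
  then have R: "card ?R = 2"
    using nid_eq[OF assms(1,2), of A B p] by simp
  have AB: "?A \<inter> ?B = {}"
    using sub tedges_fst[of _ _ _ mk "p @ [False]" A] tedges_fst[of _ _ _ mk "p @ [True]" B]
      ipos_disjoint(2)[of p A B] assms(1) by (fastforce simp: inj_eq)
  have RAB: "?R \<inter> (?A \<union> ?B) = {}"
    using sub tedges_fst[of "mk p" _ _ mk "p @ [False]" A] tedges_fst[of "mk p" _ _ mk "p @ [True]" B]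
      ipos_disjoint(1)[of p False A] ipos_disjoint(1)[of p True B] assms(1) by (fastforce simp: inj_eq)
  have "card (?R \<union> (?A \<union> ?B)) = card ?R + (card ?A + card ?B)"
    by (subst card_Un_disjoint, simp, simp add: finite_switch_edges, rule RAB)
      (subst card_Un_disjoint, simp_all add: finite_switch_edges AB)
  then show ?case using Tens R eq by simp
next
  case (Parr A B)
  let ?R = "{(mk p, if s (mk p) then nid mk (p @ [False]) A else nid mk (p @ [True]) B, Some (\<not> s (mk p)))}"
  let ?A = "switch_edges s (tedges mk (p @ [False]) A)"
  let ?B = "switch_edges s (tedges mk (p @ [True]) B)"
  have sub: "?A \<subseteq> tedges mk (p @ [False]) A" "?B \<subseteq> tedges mk (p @ [True]) B"
    unfolding switch_edges_def by auto
  have eq: "switch_edges s (tedges mk p (Parr A B)) = ?R \<union> (?A \<union> ?B)"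
    unfolding switch_edges_def by auto
  have AB: "?A \<inter> ?B = {}"
    using sub tedges_fst[of _ _ _ mk "p @ [False]" A] tedges_fst[of _ _ _ mk "p @ [True]" B]
      ipos_disjoint(2)[of p A B] assms(1) by (fastforce simp: inj_eq)
  have RAB: "?R \<inter> (?A \<union> ?B) = {}"
    using sub tedges_fst[of "mk p" _ _ mk "p @ [False]" A] tedges_fst[of "mk p" _ _ mk "p @ [True]" B]
      ipos_disjoint(1)[of p False A] ipos_disjoint(1)[of p True B] assms(1) by (fastforce simp: inj_eq)
  have "card (?R \<union> (?A \<union> ?B)) = card ?R + (card ?A + card ?B)"
    by (subst card_Un_disjoint, simp, simp add: finite_switch_edges, rule RAB)
      (subst card_Un_disjoint, simp_all add: finite_switch_edges AB)
  then show ?case using Parr eq by simp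
qed

lemma finite_gedges [simp]: "finite (gedges P \<Gamma>)"
  unfolding gedges_def by simp

lemma card_switch_gedges:
  assumes "distinct (map fst (leaves P))" "distinct (map fst (concat (map leaves \<Gamma>)))"
  shows "card (switch_edges s (gedges P \<Gamma>)) =
    2 * ntens P + nparr P + sum_list (map (\<lambda>T. 2 * ntens T + nparr T) \<Gamma>)"
proof -
  let ?P = "switch_edges s (tedges PN [] P)"
  let ?G = "\<lambda>i. switch_edges s (tedges (GN i) [] (\<Gamma> ! i))"
  have eq: "switch_edges s (gedges P \<Gamma>) = ?P \<union> (\<Union>i<length \<Gamma>. ?G i)"
    unfolding gedges_def switch_edges_def by auto
  have fG: "u \<in> range (GN i)" if "(u, c, k) \<in> ?G i" for u c k i
    using that tedges_fst[of u c k "GN i" "[]" "\<Gamma> ! i"] unfolding switch_edges_def by auto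
  have fP: "u \<in> range PN" if "(u, c, k) \<in> ?P" for u c k
    using that tedges_fst[of u c k PN "[]" P] unfolding switch_edges_def by auto
  have "?P \<inter> (\<Union>i<length \<Gamma>. ?G i) = {}" using fP fG by fastforce
  then have 1: "card (?P \<union> (\<Union>i<length \<Gamma>. ?G i)) = card ?P + card (\<Union>i<length \<Gamma>. ?G i)"
    by (intro card_Un_disjoint) (auto simp: finite_switch_edges)
  have 2: "card (\<Union>i<length \<Gamma>. ?G i) = (\<Sum>i<length \<Gamma>. card (?G i))"
  proof (rule card_UN_disjoint)
    show "\<forall>i\<in>{..<length \<Gamma>}. \<forall>j\<in>{..<length \<Gamma>}. i \<noteq> j \<longrightarrow> ?G i \<inter> ?G j = {}"
    proof (intro ballI impI equals0I)
      fix i j x assume "i \<noteq> j" "x \<in> ?G i \<inter> ?G j"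
      then show False using fG[of "fst x" "fst (snd x)" "snd (snd x)" i]
          fG[of "fst x" "fst (snd x)" "snd (snd x)" j] by auto
    qed
  qed (auto simp: finite_switch_edges)
  have d: "distinct (map fst (leaves (\<Gamma> ! i)))" if "i < length \<Gamma>" for i
  proof -
    have "\<Gamma> = take i \<Gamma> @ \<Gamma> ! i # drop (Suc i) \<Gamma>" using that by (rule id_take_nth_drop)
    then have "concat (map leaves \<Gamma>) =
        concat (map leaves (take i \<Gamma>)) @ leaves (\<Gamma> ! i) @ concat (map leaves (drop (Suc i) \<Gamma>))"
      by (metis concat.simps(2) concat_append list.simps(9) map_append)
    then show ?thesis using assms(2) by simp
  qed
  have 3: "card (?G i) = 2 * ntens (\<Gamma> ! i) + nparr (\<Gamma> ! i)" if "i < length \<Gamma>" for i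
    by (rule card_switch_tedges) (use d[OF that] in \<open>auto simp: inj_def\<close>)
  have 4: "card ?P = 2 * ntens P + nparr P"
    by (rule card_switch_tedges) (use assms(1) in \<open>auto simp: inj_def\<close>)
  have "(\<Sum>i<length \<Gamma>. card (?G i)) = sum_list (map (\<lambda>T. 2 * ntens T + nparr T) \<Gamma>)"
    using 3 sum_list_nth[of "\<lambda>T. 2 * ntens T + nparr T" \<Gamma>] by simp
  then show ?thesis using 1 2 4 eq by simp
qed

text \<open>Serves to exclude loops and edges present in both directions. Leaves are shared between
  trees and get an arbitrary value; they are never parents.\<close>

fun depth :: "'v node \<Rightarrow> nat" where
  "depth (LN x) = 0"
| "depth (PN q) = length q"
| "depth (GN i q) = length q"

lemma gedges_subt:
  assumes "(u, c, k) \<in> gedges P \<Gamma>"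
  obtains mk T q A B b where "mk = PN \<and> T = P \<or> (\<exists>i. mk = GN i \<and> T = \<Gamma> ! i \<and> i < length \<Gamma>)" "u = mk q"
    "subt T q = Some (Tens A B) \<and> k = None \<or> subt T q = Some (Parr A B) \<and> k = Some b"
    "c = nid mk (q @ [b]) (if b then B else A)"
proof -
  consider "(u, c, k) \<in> tedges PN [] P" |
      i where "i < length \<Gamma>" "(u, c, k) \<in> tedges (GN i) [] (\<Gamma> ! i)"
    using assms unfolding gedges_def by auto
  then show ?thesis
  proof cases
    case 1
    obtain q A B where "u = PN q"
      "subt P q = Some (Tens A B) \<and> k = None \<and>
         (c = nid PN (q @ [False]) A \<or> c = nid PN (q @ [True]) B) \<or>
       subt P q = Some (Parr A B) \<and>
         (k = Some False \<and> c = nid PN (q @ [False]) A \<or> k = Some True \<and> c = nid PN (q @ [True]) B)"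
      using tedges_subt[OF 1] by auto
    then show ?thesis
      using that[of PN P q A B False] that[of PN P q A B True] by auto
  next
    case 2
    obtain q A B where "u = GN i q"
      "subt (\<Gamma> ! i) q = Some (Tens A B) \<and> k = None \<and>
         (c = nid (GN i) (q @ [False]) A \<or> c = nid (GN i) (q @ [True]) B) \<or>
       subt (\<Gamma> ! i) q = Some (Parr A B) \<and>
         (k = Some False \<and> c = nid (GN i) (q @ [False]) A \<or> k = Some True \<and> c = nid (GN i) (q @ [True]) B)"
      using tedges_subt[OF 2(2)] by auto
    then show ?thesis
      using that[of "GN i" "\<Gamma> ! i" q A B False] that[of "GN i" "\<Gamma> ! i" q A B True] 2(1) by auto
  qed
qed

lemma gedges_depth:
  assumes "(u, c, k) \<in> gedges P \<Gamma>"
  shows "(\<exists>x. c = LN x) \<or> depth c = Suc (depth u)" "\<nexists>x. u = LN x"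
proof -
  obtain mk T q A B b where *: "mk = PN \<and> T = P \<or> (\<exists>i. mk = GN i \<and> T = \<Gamma> ! i \<and> i < length \<Gamma>)" "u = mk q"
    "subt T q = Some (Tens A B) \<and> k = None \<or> subt T q = Some (Parr A B) \<and> k = Some b"
    "c = nid mk (q @ [b]) (if b then B else A)"
    using assms by (rule gedges_subt)
  have "nid mk (q @ [b]) C = mk (q @ [b]) \<or> (\<exists>x. nid mk (q @ [b]) C = LN x)" for C :: "('a, 'b) tree"
    by (cases C) auto
  then have "c = mk (q @ [b]) \<or> (\<exists>x. c = LN x)" using *(4) by simp
  then show "(\<exists>x. c = LN x) \<or> depth c = Suc (depth u)" using *(1,2) by auto
  show "\<nexists>x. u = LN x" using * by auto
qed

text \<open>The parent determines the label: a tensor has unlabelled edges only, and of a par the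
  switching leaves a single side.\<close>

lemma gedges_label:
  assumes "(u, c, k) \<in> switch_edges s (gedges P \<Gamma>)" "(u, c', k') \<in> switch_edges s (gedges P \<Gamma>)"
  shows "k = k'"
proof -
  have e: "(u, c, k) \<in> gedges P \<Gamma>" "(u, c', k') \<in> gedges P \<Gamma>" and k: "k \<noteq> Some (s u)" "k' \<noteq> Some (s u)"
    using assms unfolding switch_edges_def by auto
  obtain mk T q A B b where 1: "mk = PN \<and> T = P \<or> (\<exists>i. mk = GN i \<and> T = \<Gamma> ! i \<and> i < length \<Gamma>)" "u = mk q"
    "subt T q = Some (Tens A B) \<and> k = None \<or> subt T q = Some (Parr A B) \<and> k = Some b"
    "c = nid mk (q @ [b]) (if b then B else A)"
    using e(1) by (rule gedges_subt)
  obtain mk' T' q' A' B' b' where 2: "mk' = PN \<and> T' = P \<or> (\<exists>i. mk' = GN i \<and> T' = \<Gamma> ! i \<and> i < length \<Gamma>)" "u = mk' q'"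
    "subt T' q' = Some (Tens A' B') \<and> k' = None \<or> subt T' q' = Some (Parr A' B') \<and> k' = Some b'"
    "c' = nid mk' (q' @ [b']) (if b' then B' else A')"
    using e(2) by (rule gedges_subt)
  have "T = T' \<and> q = q'" using 1(1,2) 2(1,2) by auto
  then show ?thesis using 1(3) 2(3) k by auto
qed

section \<open>Correctness of switchings as connectedness and a count\<close>

definition uedges :: "('v node \<times> 'v node \<times> bool option) set \<Rightarrow> 'v node set set" where
  "uedges E = (\<lambda>(u, c, k). {u, c}) ` E"

lemma adj_uedges: "adj E u v \<longleftrightarrow> {u, v} \<in> uedges E"
  unfolding adj_def uedges_def by (force simp: doubleton_eq_iff)

lemma adj_conn: "(adj E)\<^sup>*\<^sup>* = conn (uedges E)"
  unfolding conn_def adj_uedges ..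

text \<open>Forgetting direction and label identifies no edges: \<open>depth\<close> rules out
  reversed copies and \<open>gedges_label\<close> rules out a second label.\<close>

lemma card_uedges:
  "card (uedges (switch_edges s (gedges P \<Gamma>))) = card (switch_edges s (gedges P \<Gamma>))"
  unfolding uedges_def
proof (rule card_image, rule inj_onI)
  fix x y assume xy: "x \<in> switch_edges s (gedges P \<Gamma>)" "y \<in> switch_edges s (gedges P \<Gamma>)"
    "(case x of (u, c, k) \<Rightarrow> {u, c}) = (case y of (u, c, k) \<Rightarrow> {u, c})"
  obtain u c k u' c' k' where x: "x = (u, c, k)" and y: "y = (u', c', k')" by (cases x, cases y)
  have e: "(u, c, k) \<in> gedges P \<Gamma>" "(u', c', k') \<in> gedges P \<Gamma>"
    using xy x y unfolding switch_edges_def by auto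
  consider "u = u'" "c = c'" | "u = c'" "c = u'"
    using xy(3) unfolding x y by (auto simp: doubleton_eq_iff)
  then show "x = y"
  proof cases
    case 1
    then show ?thesis using gedges_label xy(1,2) unfolding x y by blast
  next
    case 2
    then show ?thesis using gedges_depth[OF e(1)] gedges_depth[OF e(2)] by auto
  qed
qed

lemma simple_path:
  assumes "r\<^sup>*\<^sup>* x y"
  shows "\<exists>xs. xs \<noteq> [] \<and> hd xs = x \<and> last xs = y \<and> distinct xs \<and> successively r xs"
  using assms
proof (induction rule: rtranclp_induct)
  case base
  then show ?case by (intro exI[of _ "[x]"]) simp
next
  case (step y z)
  then obtain xs where xs: "xs \<noteq> []" "hd xs = x" "last xs = y" "distinct xs" "successively r xs"
    by blast
  show ?case
  proof (cases "z \<in> set xs")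
    case True
    then obtain ys zs where "xs = ys @ z # zs" by (meson split_list)
    then show ?thesis
      using xs by (intro exI[of _ "ys @ [z]"]) (auto simp: successively_append_iff hd_append)
  next
    case False
    then show ?thesis
      using xs step(2) by (intro exI[of _ "xs @ [z]"]) (auto simp: successively_append_iff)
  qed
qed

lemma gedges_nodes:
  assumes "(u, c, k) \<in> gedges P \<Gamma>"
  shows "u \<in> gnodes P \<Gamma>" "c \<in> gnodes P \<Gamma>" "u \<noteq> c"
proof -
  have *: "u \<in> tnodes mk p T \<and> c \<in> tnodes mk p T" if "(u, c, k) \<in> tedges mk p T"
    for mk p and T :: "('a, 'b) tree"
    using that
  proof (induction T arbitrary: p)
    case (Tens A B)
    have "nid mk q C \<in> tnodes mk q C" for q and C :: "('a, 'b) tree" by (cases C) auto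
    with Tens show ?case by auto
  next
    case (Parr A B)
    have "nid mk q C \<in> tnodes mk q C" for q and C :: "('a, 'b) tree" by (cases C) auto
    with Parr show ?case by auto
  qed simp
  show "u \<in> gnodes P \<Gamma>" "c \<in> gnodes P \<Gamma>"
    using assms * unfolding gedges_def gnodes_def by blast+
  show "u \<noteq> c" using gedges_depth[OF assms] by auto
qed

text \<open>An edge that is no bridge closes a simple path to a cycle. The path has at least three
  vertices because it avoids that edge.\<close>

lemma forest_if_acyclic:
  assumes ac: "acyclic_graph (gnodes P \<Gamma>) (switch_edges s (gedges P \<Gamma>))"
  shows "forest (uedges (switch_edges s (gedges P \<Gamma>)))"
  unfolding forest_def
proof (intro allI impI notI)
  let ?U = "uedges (switch_edges s (gedges P \<Gamma>))"
  fix u v assume uv: "{u, v} \<in> ?U" and c: "conn (?U - {{u, v}}) u v"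
  have node: "a \<in> gnodes P \<Gamma>" "b \<in> gnodes P \<Gamma>" "a \<noteq> b" if "{a, b} \<in> ?U" for a b
    using that gedges_nodes[of a b _ P \<Gamma>] gedges_nodes[of b a _ P \<Gamma>] unfolding uedges_def switch_edges_def
    by (auto simp: doubleton_eq_iff)
  obtain xs where xs: "xs \<noteq> []" "hd xs = u" "last xs = v" "distinct xs"
    "successively (\<lambda>x y. {x, y} \<in> ?U - {{u, v}}) xs"
    using simple_path[OF c[unfolded conn_def]] by blast
  have step: "{xs ! i, xs ! Suc i} \<in> ?U - {{u, v}}" if "Suc i < length xs" for i
    using xs(5) that unfolding successively_conv_nth by blast
  have len: "3 \<le> length xs"
  proof (rule ccontr)
    assume "\<not> 3 \<le> length xs"
    moreover have "length xs \<noteq> 0" using xs(1) by simp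
    moreover have "length xs \<noteq> 1"
      using xs(2,3) node(3)[OF uv] by (metis One_nat_def hd_conv_nth last_conv_nth xs(1) diff_Suc_1)
    ultimately have l: "length xs = 2" by linarith
    then have "xs ! 0 = u" "xs ! 1 = v"
      using xs(1,2,3) by (auto simp: hd_conv_nth last_conv_nth)
    then show False using step[of 0] l by simp
  qed
  have "adj (switch_edges s (gedges P \<Gamma>)) (xs ! i) (xs ! ((i + 1) mod length xs))"
    if i: "i < length xs" for i
  proof (cases "Suc i < length xs")
    case True
    then show ?thesis using step[OF True] by (simp add: adj_uedges)
  next
    case False
    then have "i = length xs - 1" using i by simp
    moreover from this have "i + 1 = length xs" using i by simp
    then have "(i + 1) mod length xs = 0" by simp
    ultimately show ?thesis
      using xs(1,2,3) uv by (simp add: adj_uedges hd_conv_nth last_conv_nth insert_commute)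
  qed
  moreover have "set xs \<subseteq> gnodes P \<Gamma>"
  proof
    fix x assume "x \<in> set xs"
    then obtain i where i: "i < length xs" "x = xs ! i" by (auto simp: in_set_conv_nth)
    show "x \<in> gnodes P \<Gamma>"
    proof (cases "Suc i < length xs")
      case True
      then show ?thesis using step[OF True] node(1)[of "xs ! i" "xs ! Suc i"] i by simp
    next
      case False
      then have "i = length xs - 1" using i by simp
      then have "x = v" using xs(1,3) i by (simp add: last_conv_nth)
      then show ?thesis using node(2)[OF uv] by simp
    qed
  qed
  ultimately show False using ac len xs(4) unfolding acyclic_graph_def by blast
qed

text \<open>The closing edge of a cycle could be dropped without losing connectedness, leaving fewer
  edges than connectedness needs.\<close>

lemma acyclic_if_tight:
  assumes fin: "finite (uedges E)" "finite V" and card: "card V = card (uedges E) + 1"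
    and con: "connected_graph V E"
  shows "acyclic_graph V E"
  unfolding acyclic_graph_def
proof (intro notI, elim exE conjE)
  let ?U = "uedges E"
  fix cyc assume len: "3 \<le> length cyc" and dist: "distinct cyc"
    and ed: "\<forall>i<length cyc. adj E (cyc ! i) (cyc ! ((i + 1) mod length cyc))"
  have len0: "0 < length cyc" using len by linarith
  define n where "n = length cyc"
  define e where "e = {cyc ! (n - 1), cyc ! 0}"
  have "Suc (n - 1) = n" using len n_def by simp
  then have "e \<in> ?U"
    using ed[rule_format, of "n - 1"] len unfolding e_def n_def adj_uedges by simp
  have "conn (?U - {e}) (cyc ! 0) (cyc ! i)" if "i < n" for i
    using that
  proof (induction i)
    case 0
    then show ?case by simp
  next
    case (Suc i)
    have "{cyc ! i, cyc ! Suc i} \<in> ?U"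
      using ed[rule_format, of i] Suc.prems unfolding adj_uedges n_def by simp
    moreover have "{cyc ! i, cyc ! Suc i} \<noteq> e"
    proof
      assume "{cyc ! i, cyc ! Suc i} = e"
      then consider "cyc ! Suc i = cyc ! 0" | "cyc ! i = cyc ! 0" "cyc ! Suc i = cyc ! (n - 1)"
        unfolding e_def doubleton_eq_iff by blast
      then show False
      proof cases
        case 1
        then have "Suc i = 0" using Suc.prems nth_eq_iff_index_eq[OF dist _ len0, of "Suc i"] n_def by simp
        then show ?thesis by simp
      next
        case 2
        then have "i = 0" using Suc.prems nth_eq_iff_index_eq[OF dist _ len0, of i] n_def by simp
        moreover have "Suc i = n - 1"
          using 2 Suc.prems nth_eq_iff_index_eq[OF dist, of "Suc i" "n - 1"] n_def by simp
        ultimately show ?thesis using len n_def by simp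
      qed
    qed
    ultimately have "conn (?U - {e}) (cyc ! i) (cyc ! Suc i)" by (intro conn_edge) simp
    then show ?case using Suc.IH Suc.prems conn_trans by (metis Suc_lessD)
  qed
  from conn_sym[OF this[of "n - 1"]]
  have c: "conn (?U - {e}) (cyc ! (n - 1)) (cyc ! 0)" using len n_def by simp
  have "spans ?U V" using con unfolding connected_graph_def spans_def adj_conn .
  moreover have "?U = insert e (?U - {e})" using \<open>e \<in> ?U\<close> by blast
  ultimately have "spans (?U - {e}) V" using spans_redundant[OF c] unfolding e_def by simp
  then have "card V \<le> card (?U - {e}) + 1" using fin by (intro spans_card) auto
  moreover have "card (?U - {e}) < card ?U" using fin(1) \<open>e \<in> ?U\<close> by (rule card_Diff1_less)
  ultimately show False using card by simp
qed

lemma sws_card: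
  "sws \<Gamma> Es \<Longrightarrow>
    finite (\<Union> (set Es)) \<and> card (\<Union> (set Es)) \<le> sum_list (map ntens \<Gamma>)"
proof (induction rule: list_all2_induct)
  case (Cons T \<Gamma> E Es)
  then obtain r where "sw T r E" by blast
  from sw_card[OF this] Cons.IH show ?case
    using card_Un_le[of E "\<Union> (set Es)"] by simp
qed simp

lemma sws_ex: "\<exists>Es. sws \<Gamma> Es"
proof (induction \<Gamma>)
  case (Cons T \<Gamma>)
  then obtain Es where "sws \<Gamma> Es" by blast
  moreover obtain r E where "sw T r E" using sw_ex[of T] by blast
  ultimately have "sws (T # \<Gamma>) (E # Es)" by auto
  then show ?case by blast
qed simp

lemma sws_pos:
  "sws \<Gamma> (map (\<lambda>i. pedg {} s (GN i) [] (\<Gamma> ! i)) [0..<length \<Gamma>])"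
  unfolding list_all2_conv_all_nth using sw_pos[of "GN _" "[]" "{}"] by (auto intro!: exI)

lemma graph_edg_sws:
  "graph_edg {} P \<Gamma> s = pedg {} s PN [] P \<union>
     \<Union> (set (map (\<lambda>i. pedg {} s (GN i) [] (\<Gamma> ! i)) [0..<length \<Gamma>]))"
  unfolding graph_edg_def by auto

text \<open>Inner nodes of different trees are different, so the switchings chosen for the single
  trees merge into one function on nodes.\<close>

lemma sws_graph_ex:
  assumes "sw P r E" "sws \<Gamma> Es"
  shows "\<exists>s. graph_edg {} P \<Gamma> s = E \<union> \<Union> (set Es)"
proof -
  obtain sP where sP: "pedg {} sP PN [] P = E"
    using sw_pos_ex[OF _ assms(1), of PN "[]"] by (auto simp: inj_def)
  have "\<exists>s. pedg {} s (GN i) [] (\<Gamma> ! i) = Es ! i" if i: "i < length \<Gamma>" for i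
  proof -
    obtain r' where "sw (\<Gamma> ! i) r' (Es ! i)"
      using assms(2) i unfolding list_all2_conv_all_nth by blast
    from sw_pos_ex[OF _ this, of "GN i" "[]"] show ?thesis by (auto simp: inj_def)
  qed
  then obtain sG where sG: "\<And>i. i < length \<Gamma> \<Longrightarrow> pedg {} (sG i) (GN i) [] (\<Gamma> ! i) = Es ! i"
    by metis
  define s where "s = (\<lambda>u. case u of GN i q \<Rightarrow> sG i u | _ \<Rightarrow> sP u)"
  have "pedg {} s PN [] P = pedg {} sP PN [] P"
    by (rule pos_cong[THEN conjunct2]) (simp add: s_def)
  moreover have "pedg {} s (GN i) [] (\<Gamma> ! i) = pedg {} (sG i) (GN i) [] (\<Gamma> ! i)" for i
    by (rule pos_cong[THEN conjunct2]) (simp add: s_def)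
  moreover have "length Es = length \<Gamma>" using assms(2) by (simp add: list_all2_lengthD)
  ultimately have "graph_edg {} P \<Gamma> s = E \<union> (\<Union>i<length Es. Es ! i)"
    unfolding graph_edg_def using sP sG by auto
  also have "(\<Union>i<length Es. Es ! i) = \<Union> (set Es)"
    unfolding set_conv_nth by blast
  finally show ?thesis by blast
qed

text \<open>With L leaves, t tensors and p pars in total, the graph has L + t + p nodes, and every
  switching has 2t + p edges. The tree equation "nodes = edges + 1" therefore reads L = t +
  1.\<close>

theorem correct_iff_leaf_correct:
  assumes pre: "pre_proof_graph P \<Gamma>"
  shows "correct P \<Gamma> \<longleftrightarrow> leaf_correct P \<Gamma>"
proof -
  have dP: "distinct (map fst (leaves P))" and dG: "distinct (map fst (concat (map leaves \<Gamma>)))"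
    and leq: "set (leaves P) = set (concat (map leaves \<Gamma>))"
    using pre unfolding pre_proof_graph_def by auto
  note cV = card_gnodes[OF leq]
  have cE: "card (uedges (switch_edges s (gedges P \<Gamma>))) =
      2 * ntens P + nparr P + sum_list (map (\<lambda>T. 2 * ntens T + nparr T) \<Gamma>)" for s
    by (simp add: card_uedges card_switch_gedges[OF dP dG])
  have fE: "finite (uedges (switch_edges s (gedges P \<Gamma>)))" for s
    unfolding uedges_def by (simp add: finite_switch_edges)
  have sums: "sum_list (map (\<lambda>T. 2 * ntens T + nparr T) \<Gamma>) =
      sum_list (map ntens \<Gamma>) + sum_list (map (\<lambda>T. ntens T + nparr T) \<Gamma>)"
    by (simp flip: sum_list_addf add: add.assoc mult_2)
  have LN: "LN x \<in> gnodes P \<Gamma>" if "x \<in> names P" for x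
    using that unfolding gnodes_def tnodes_eq by blast
  show ?thesis
  proof
    assume cor: "correct P \<Gamma>"
    have sp: "spans (E \<union> \<Union> (set Es)) (names P)"
      if E: "sw P r E" "sws \<Gamma> Es" for r E Es
    proof -
      obtain s where s: "graph_edg {} P \<Gamma> s = E \<union> \<Union> (set Es)"
        using sws_graph_ex[OF E] by blast
      show ?thesis
        unfolding spans_def
      proof (intro ballI)
        fix x y assume "x \<in> names P" "y \<in> names P"
        then have "(adj (switch_edges s (gedges P \<Gamma>)))\<^sup>*\<^sup>* (LN x) (LN y)"
          using cor LN unfolding correct_def connected_graph_def by blast
        from graph_to_leaf[OF this order_refl, of "{}"] s
        show "conn (E \<union> \<Union> (set Es)) x y" by (simp add: rep_node_def)
      qed
    qed
    obtain r E Es where E: "sw P r E" "sws \<Gamma> Es"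
      using sw_ex sws_ex by metis
    have "card (names P) \<le> card (E \<union> \<Union> (set Es)) + 1"
      using sp[OF E] sw_card[OF E(1)] sws_card[OF E(2)] by (intro spans_card) auto
    also have "card (E \<union> \<Union> (set Es)) \<le> ntens P + sum_list (map ntens \<Gamma>)"
      using card_Un_le[of E "\<Union> (set Es)"] sw_card[OF E(1)] sws_card[OF E(2)] by linarith
    finally have le: "card (names P) \<le> ntens P + sum_list (map ntens \<Gamma>) + 1" by simp
    \<comment> \<open>Any switching would do: all have the same number of edges, and acyclicity of
      one already bounds the number of leaves from below.\<close>
    let ?U = "uedges (switch_edges (\<lambda>_. True) (gedges P \<Gamma>))"
    have "card ?U + 1 \<le> card (gnodes P \<Gamma>)"
    proof (rule forest_card)
      show "\<forall>e\<in>?U. \<exists>u\<in>gnodes P \<Gamma>. \<exists>v\<in>gnodes P \<Gamma>. e = {u, v}"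
        using gedges_nodes[of _ _ _ P \<Gamma>] unfolding uedges_def switch_edges_def by fastforce
      show "forest ?U"
        using cor unfolding correct_def by (intro forest_if_acyclic) blast
      show "gnodes P \<Gamma> \<noteq> {}" using LN sw_in_names[OF E(1)] by blast
    qed (use fE cV in auto)
    then have "ntens P + sum_list (map ntens \<Gamma>) + 1 \<le> card (names P)"
      using cE[of "\<lambda>_. True"] cV sums by linarith
    with le sp show "leaf_correct P \<Gamma>" unfolding leaf_correct_def by (meson le_antisym)
  next
    assume leaf_correct: "leaf_correct P \<Gamma>"
    show "correct P \<Gamma>"
      unfolding correct_def
    proof
      fix s
      have sp: "spans (graph_edg {} P \<Gamma> s) (names P)"
        unfolding graph_edg_sws using leaf_correct sw_pos[of PN "[]" "{}" P s] sws_pos[of \<Gamma> s]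
        unfolding leaf_correct_def by blast
      have con: "connected_graph (gnodes P \<Gamma>) (switch_edges s (gedges P \<Gamma>))"
        by (rule connected_graph_if_spans[OF sp]) (use leq in auto)
      moreover have "card (gnodes P \<Gamma>) = card (uedges (switch_edges s (gedges P \<Gamma>))) + 1"
        using cE[of s] cV sums leaf_correct unfolding leaf_correct_def by linarith
      ultimately show "connected_graph (gnodes P \<Gamma>) (switch_edges s (gedges P \<Gamma>)) \<and>
          acyclic_graph (gnodes P \<Gamma>) (switch_edges s (gedges P \<Gamma>))"
        using acyclic_if_tight[OF fE _ _ con] cV by blast
    qed
  qed
qed

section \<open>Sequent proofs translate to correct graphs\<close>

lemma spans_insert_glue:
  assumes "spans D U" "spans D' W" "x \<in> U" "y \<in> W" "{x, y} \<in> E" "D \<subseteq> E" "D' \<subseteq> E"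
  shows "spans E (U \<union> W)"
proof -
  have U: "conn E a x" if "a \<in> U" for a
    using assms(1,3,6) that unfolding spans_def by (blast intro: conn_mono)
  have W: "conn E a y" if "a \<in> W" for a
    using assms(2,4,7) that unfolding spans_def by (blast intro: conn_mono)
  have "conn E y x" using conn_sym[OF conn_edge[OF assms(5)]] .
  then have "conn E a x" if "a \<in> U \<union> W" for a
    using that U W conn_trans[of E a y x] by blast
  then show ?thesis
    unfolding spans_def using conn_trans conn_sym by (metis (no_types))
qed

lemma sws_cong_mset:
  assumes "sws \<Gamma>' Es" "mset \<Gamma>' = mset \<Gamma>"
  obtains Es' where "sws \<Gamma> Es'" "set Es' = set Es"
proof -
  obtain Es' where "sws \<Gamma> Es'" "mset Es' = mset Es"
    using list_all2_reorder_left_invariance[OF assms(1), of \<Gamma>] assms(2) by metis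
  then show ?thesis using that by (metis set_mset_mset)
qed

lemma seq_graph_leaves: "seq_graph P \<Gamma> \<Longrightarrow> set (leaves P) = set (concat (map leaves \<Gamma>))"
proof (induction rule: seq_graph.induct)
  case (sq_exch P \<Gamma> \<Gamma>')
  then have "set \<Gamma>' = set \<Gamma>" by (metis set_mset_mset)
  then show ?case using sq_exch.IH by simp
qed auto

lemma leaf_correct_spans:
  "leaf_correct P \<Gamma> \<Longrightarrow> sw P r E \<Longrightarrow> sws \<Gamma> Es \<Longrightarrow> spans (E \<union> \<Union> (set Es)) (names P)"
  unfolding leaf_correct_def by blast

text \<open>The par rule changes neither the tensors nor the edge sets of switchings. The bottom and
  tensor rules add one tensor and join two connected sets of leaves by its edge.\<close>

lemma seq_graph_leaf_correct: "seq_graph P \<Gamma> \<Longrightarrow> leaf_correct P \<Gamma>"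
proof (induction rule: seq_graph.induct)
  case (sq_id x y a)
  have "spans E {x, y}" if "{x, y} \<in> E" for E
    using conn_edge[OF that] conn_sym[OF conn_edge[OF that]] unfolding spans_def by auto
  then show ?case
    using sq_id unfolding leaf_correct_def by (auto elim!: sw_tensE sw_leafE)
next
  case (sq_one x)
  then show ?case unfolding leaf_correct_def by (auto simp: spans_def)
next
  case (sq_exch P \<Gamma> \<Gamma>')
  have "sum_list (map ntens \<Gamma>') = sum_list (map ntens \<Gamma>)"
    using sq_exch.hyps by (metis mset_map sum_mset_sum_list)
  moreover have "spans (E \<union> \<Union> (set Es)) (names P)"
    if E: "sw P r E" "sws \<Gamma>' Es" for r E Es
  proof -
    obtain Es' where "sws \<Gamma> Es'" "set Es' = set Es"
      using sws_cong_mset[OF E(2)] sq_exch.hyps by metis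
    then show ?thesis using leaf_correct_spans[OF sq_exch.IH E(1)] by metis
  qed
  ultimately show ?case using sq_exch.IH unfolding leaf_correct_def by simp
next
  case (sq_bot P \<Gamma> x)
  have "card (names (Tens (Leaf (x, LBot)) P)) = card (names P) + 1"
    using sq_bot.hyps by simp
  moreover have "spans (E \<union> \<Union> (set Es)) (names (Tens (Leaf (x, LBot)) P))"
    if E: "sw (Tens (Leaf (x, LBot)) P) r E"
      "sws (Leaf (x, LBot) # \<Gamma>) Es" for r E Es
  proof -
    obtain b F where F: "sw P b F" "E = insert {x, b} F"
      using E(1) by (auto elim!: sw_tensE sw_leafE)
    obtain Es' where Es': "sws \<Gamma> Es'" "Es = {} # Es'"
      using E(2) by (auto simp: list_all2_Cons1 elim!: sw_leafE)
    have "spans (F \<union> \<Union> (set Es')) (names P)" using leaf_correct_spans[OF sq_bot.IH F(1) Es'(1)] .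
    then have "spans (E \<union> \<Union> (set Es)) ({x} \<union> names P)"
      by (rule spans_insert_glue[of "{}", where x = x and y = b, rotated])
        (use F Es' sw_in_names[OF F(1)] in \<open>auto simp: spans_def\<close>)
    then show ?thesis by simp
  qed
  ultimately show ?case using sq_bot.IH unfolding leaf_correct_def by simp
next
  case (sq_par P A B \<Gamma>)
  have "spans (E \<union> \<Union> (set Es)) (names P)"
    if E: "sw P r E" "sws (Parr A B # \<Gamma>) Es" for r E Es
  proof -
    obtain F Es' r where F: "sw (Parr A B) r F" "sws \<Gamma> Es'" "Es = F # Es'"
      using E(2) by (auto simp: list_all2_Cons1)
    obtain a EA b EB where "sw A a EA" "sw B b EB" "F = EA \<union> EB"
      using F(1) by (auto elim: sw_parrE)
    then have "sws (A # B # \<Gamma>) (EA # EB # Es')"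
      using F(2) by auto
    then show ?thesis
      using leaf_correct_spans[OF sq_par.IH E(1)] \<open>F = EA \<union> EB\<close> F(3) by (metis Sup_insert Un_assoc list.simps(15))
  qed
  then show ?case using sq_par.IH unfolding leaf_correct_def by simp
next
  case (sq_tens P \<Gamma> A Q B \<Delta>)
  have "card (names (Parr P Q)) = card (names P) + card (names Q)"
    using sq_tens.hyps by (simp add: image_Un card_Un_disjoint)
  moreover have "spans (E \<union> \<Union> (set Es)) (names (Parr P Q))"
    if E: "sw (Parr P Q) r E" "sws (\<Gamma> @ [Tens A B] @ \<Delta>) Es" for r E Es
  proof -
    obtain p EP q EQ where P: "sw P p EP" and Q: "sw Q q EQ" and EE: "E = EP \<union> EQ"
      using E(1) by (auto elim: sw_parrE)
    obtain Es1 F r Es2 where Es: "sws \<Gamma> Es1" "sw (Tens A B) r F"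
      "sws \<Delta> Es2" "Es = Es1 @ F # Es2"
      using E(2) by (auto simp: list_all2_append1 list_all2_Cons1)
    obtain a EA b EB where A: "sw A a EA" and B: "sw B b EB" and F: "F = insert {a, b} (EA \<union> EB)"
      using Es(2) by (auto elim: sw_tensE)
    have "spans (EP \<union> \<Union> (set (Es1 @ [EA]))) (names P)"
      by (rule leaf_correct_spans[OF sq_tens.IH(1) P]) (use A Es(1) in \<open>auto intro!: list_all2_appendI\<close>)
    moreover have "spans (EQ \<union> \<Union> (set (EB # Es2))) (names Q)"
      by (rule leaf_correct_spans[OF sq_tens.IH(2) Q]) (use B Es(3) in auto)
    moreover have "a \<in> names P"
      using seq_graph_leaves[OF sq_tens.hyps(1)] sw_in_names[OF A] by auto
    moreover have "b \<in> names Q"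
      using seq_graph_leaves[OF sq_tens.hyps(2)] sw_in_names[OF B] by auto
    ultimately have "spans (E \<union> \<Union> (set Es)) (names P \<union> names Q)"
      by (rule spans_insert_glue) (use EE F Es(4) in auto)
    then show ?thesis by (simp add: image_Un)
  qed
  ultimately show ?case using sq_tens.IH unfolding leaf_correct_def by simp
qed

section \<open>Equivalence preserves pre-proof graphs\<close>

lemma subt_repl: "subt P c = Some T \<Longrightarrow> subt (repl P c T') c = Some T'"
  by (induction P c rule: subt.induct) auto

lemma repl_repl: "subt P c = Some T \<Longrightarrow> repl (repl P c T') c T = P"
  by (induction P c rule: subt.induct) auto

lemma repl_repl2: "subt P c = Some T \<Longrightarrow> repl (repl P c T') c T'' = repl P c T''"
  by (induction P c rule: subt.induct) auto

lemma repl_same: "subt P c = Some T \<Longrightarrow> repl P c T = P"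
  by (induction P c rule: subt.induct) auto

lemma mset_leaves_repl:
  "subt P c = Some T \<Longrightarrow> mset (leaves T') = mset (leaves T) \<Longrightarrow> mset (leaves (repl P c T')) = mset (leaves P)"
  by (induction P c rule: subt.induct) auto

inductive_cases linking_leafE: "is_linking (Leaf l)"
inductive_cases linking_tensE: "is_linking (Tens A B)"
inductive_cases linking_parrE: "is_linking (Parr A B)"

lemma linking_Tens_iff:
  "is_linking (Tens A B) \<longleftrightarrow>
     (\<exists>x y a. A = Leaf (x, Pos a) \<and> B = Leaf (y, Neg a)) \<or>
     (\<exists>x y a. A = Leaf (y, Neg a) \<and> B = Leaf (x, Pos a)) \<or>
     (\<exists>x. A = Leaf (x, LBot) \<and> is_linking B) \<or> (\<exists>x. B = Leaf (x, LBot) \<and> is_linking A)"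
  by (auto elim: linking_tensE intro: is_linking.intros)

lemma linking_Parr_iff: "is_linking (Parr A B) \<longleftrightarrow> is_linking A \<and> is_linking B"
  by (auto elim: linking_parrE intro: is_linking.intros)

lemma linking_Leaf_iff: "is_linking (Leaf l) \<longleftrightarrow> snd l = LOne"
  by (cases l) (auto elim: linking_leafE intro: is_linking.intros)

lemmas linking_iffs = linking_Tens_iff linking_Parr_iff linking_Leaf_iff

text \<open>Atoms and bottoms inside a linking are not linkings themselves, which is why leaves are
  excluded; every other subterm of a linking is one.\<close>

lemma linking_repl:
  assumes "is_linking P" "subt P c = Some T" "\<nexists>l. T = Leaf l" "is_linking T \<Longrightarrow> is_linking T'"
  shows "is_linking (repl P c T')"
  using assms
proof (induction arbitrary: c rule: is_linking.induct)
  case (lk_one x)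
  then show ?case by (cases c) (auto intro: is_linking.intros)
next
  case (lk_ax1 x a y)
  then show ?case
    by (cases c) (auto intro: is_linking.intros split: if_splits elim: subt.elims)
next
  case (lk_ax2 y a x)
  then show ?case
    by (cases c) (auto intro: is_linking.intros split: if_splits elim: subt.elims)
next
  case (lk_botl L x)
  then show ?case
    by (cases c) (auto intro: is_linking.intros split: if_splits elim: subt.elims)
next
  case (lk_botr L x)
  then show ?case
    by (cases c) (auto intro: is_linking.intros split: if_splits elim: subt.elims)
next
  case (lk_par L L')
  then show ?case
    by (cases c) (auto intro: is_linking.intros split: if_splits)
qed

lemma basic_rw_props:
  assumes "basic_rw T T'"
  shows "is_linking T \<longleftrightarrow> is_linking T'" "mset (leaves T) = mset (leaves T')"
    "\<nexists>l. T = Leaf l" "\<nexists>l. T' = Leaf l"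
  using assms by (cases; auto simp: linking_iffs)+

lemma pre_proof_graph_mset:
  assumes "mset (leaves P) = mset (leaves P')" "is_linking P'" "pre_proof_graph P \<Gamma>"
  shows "pre_proof_graph P' \<Gamma>"
proof -
  have "set (leaves P) = set (leaves P')" using assms(1) by (metis set_mset_mset)
  moreover have "distinct (map fst (leaves P')) \<longleftrightarrow> distinct (map fst (leaves P))"
    using assms(1) by (metis mset_map mset_eq_imp_distinct_iff)
  ultimately show ?thesis using assms(2,3) unfolding pre_proof_graph_def by simp
qed

lemma pre_proof_graph_repl:
  assumes "subt P c = Some T" "is_linking T \<longleftrightarrow> is_linking T'" "mset (leaves T) = mset (leaves T')"
    "\<nexists>l. T = Leaf l" "\<nexists>l. T' = Leaf l"
  shows "pre_proof_graph P \<Gamma> \<longleftrightarrow> pre_proof_graph (repl P c T') \<Gamma>"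
proof
  assume "pre_proof_graph P \<Gamma>"
  then show "pre_proof_graph (repl P c T') \<Gamma>"
    using linking_repl[OF _ assms(1,4)] assms(2) mset_leaves_repl[OF assms(1), of T'] assms(3)
      pre_proof_graph_mset[of P "repl P c T'" \<Gamma>] unfolding pre_proof_graph_def by auto
next
  assume "pre_proof_graph (repl P c T') \<Gamma>"
  moreover from this have "is_linking P"
    using linking_repl[OF _ subt_repl[OF assms(1), of T'] assms(5), where T' = T] assms(2)
    unfolding repl_repl[OF assms(1)] pre_proof_graph_def by blast
  ultimately show "pre_proof_graph P \<Gamma>"
    using mset_leaves_repl[OF assms(1), of T'] assms(3) pre_proof_graph_mset[of "repl P c T'" P \<Gamma>] by simp
qed

lemma sim_step_pre:
  assumes "sim_step \<Gamma> P P'"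
  shows "pre_proof_graph P \<Gamma> \<longleftrightarrow> pre_proof_graph P' \<Gamma>"
proof -
  obtain c T T' where c: "subt P c = Some T" "P' = repl P c T'"
    "basic_rw T T' \<or> (\<exists>Q R i. T = Parr Q (Tens R (Leaf (i, LBot))) \<and> T' = Tens (Parr Q R) (Leaf (i, LBot)))"
    using assms unfolding sim_step_def by blast
  have "is_linking T \<longleftrightarrow> is_linking T'" "mset (leaves T) = mset (leaves T')"
    "\<nexists>l. T = Leaf l" "\<nexists>l. T' = Leaf l"
    using c(3) basic_rw_props[of T T'] by (auto simp: linking_iffs)
  then show ?thesis using pre_proof_graph_repl[OF c(1)] c(2) by blast
qed

lemma sim_pre: "sim \<Gamma> P P' \<Longrightarrow> pre_proof_graph P \<Gamma> \<Longrightarrow> pre_proof_graph P' \<Gamma>"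
  unfolding sim_def
  by (induction rule: rtranclp_induct) (auto simp: symclp_def sim_step_pre)

section \<open>Pushing bottoms inward\<close>

text \<open>The edges \<open>K t\<close> of a context depend on the representative \<open>t\<close> of its hole only through edges at \<open>t\<close>.\<close>
definition hole_switching ::
  "('v, 'a) tree \<Rightarrow> bool list \<Rightarrow> ('v \<Rightarrow> 'v) \<Rightarrow> ('v \<Rightarrow> 'v set set) \<Rightarrow> bool" where
  "hole_switching P c f K \<longleftrightarrow> (f = (\<lambda>x. x) \<or> (\<exists>y. f = (\<lambda>_. y))) \<and>
    (\<forall>T' t E. sw T' t E \<longrightarrow> sw (repl P c T') (f t) (E \<union> K t)) \<and>
    (\<forall>x y e. e \<in> K x \<longrightarrow> x \<notin> e \<longrightarrow> e \<in> K y)"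

text \<open>The flag \<open>g\<close> tells which side represents the new root. If it is the
  sibling, the representative no longer depends on the hole; this is why
  \<open>hole_switching\<close> admits the identity and constant functions.\<close>

lemma hole_switching_Tens:
  assumes H: "hole_switching H c f K" and X: "sw X x F"
  shows "hole_switching (Tens H X) (False # c) (if g then f else (\<lambda>_. x)) (\<lambda>t. insert {f t, x} (K t \<union> F))"
    and "hole_switching (Tens X H) (True # c) (if g then f else (\<lambda>_. x)) (\<lambda>t. insert {f t, x} (K t \<union> F))"
proof -
  have f: "f = (\<lambda>x. x) \<or> (\<exists>y. f = (\<lambda>_. y))" and K: "\<forall>x y e. e \<in> K x \<longrightarrow> x \<notin> e \<longrightarrow> e \<in> K y"
    and plug: "\<And>T' t E. sw T' t E \<Longrightarrow> sw (repl H c T') (f t) (E \<union> K t)"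
    using H unfolding hole_switching_def by blast+
  have "sw (Tens (repl H c T') X) r (E \<union> insert {f t, x} (K t \<union> F))"
    "sw (Tens X (repl H c T')) r (E \<union> insert {f t, x} (K t \<union> F))" if "sw T' t E" "r \<in> {f t, x}" for T' t E r
    using sw_tens[OF plug[OF that(1)] X, of r] sw_tens[OF X plug[OF that(1)], of r] that(2)
    by (auto simp: Un_ac insert_commute)
  then show "hole_switching (Tens H X) (False # c) (if g then f else (\<lambda>_. x)) (\<lambda>t. insert {f t, x} (K t \<union> F))"
    "hole_switching (Tens X H) (True # c) (if g then f else (\<lambda>_. x)) (\<lambda>t. insert {f t, x} (K t \<union> F))"
    unfolding hole_switching_def using f K by auto
qed

lemma hole_switching_Parr:
  assumes H: "hole_switching H c f K" and X: "sw X x F"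
  shows "hole_switching (Parr H X) (False # c) (if g then f else (\<lambda>_. x)) (\<lambda>t. (K t \<union> F))"
    and "hole_switching (Parr X H) (True # c) (if g then f else (\<lambda>_. x)) (\<lambda>t. (K t \<union> F))"
proof -
  have f: "f = (\<lambda>x. x) \<or> (\<exists>y. f = (\<lambda>_. y))" and K: "\<forall>x y e. e \<in> K x \<longrightarrow> x \<notin> e \<longrightarrow> e \<in> K y"
    and plug: "\<And>T' t E. sw T' t E \<Longrightarrow> sw (repl H c T') (f t) (E \<union> K t)"
    using H unfolding hole_switching_def by blast+
  have "sw (Parr (repl H c T') X) r (E \<union> (K t \<union> F))"
    "sw (Parr X (repl H c T')) r (E \<union> (K t \<union> F))" if "sw T' t E" "r \<in> {f t, x}" for T' t E r
    using sw_parr[OF plug[OF that(1)] X, of r] sw_parr[OF X plug[OF that(1)], of r] that(2)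
    by (auto simp: Un_ac insert_commute)
  then show "hole_switching (Parr H X) (False # c) (if g then f else (\<lambda>_. x)) (\<lambda>t. (K t \<union> F))"
    "hole_switching (Parr X H) (True # c) (if g then f else (\<lambda>_. x)) (\<lambda>t. (K t \<union> F))"
    unfolding hole_switching_def using f K by auto
qed

text \<open>Separates a switching at \<open>c\<close> into the part inside the hole and a context
  part that sees the inside only through its representative. Deleted nodes are confined to the hole,
  so the context part is an ordinary switching.\<close>

lemma context_switching:
  assumes "subt P c = Some T" "\<And>q. mk (p @ q) \<in> D \<Longrightarrow> \<exists>q'. q = c @ q'"
  shows "\<exists>f K. prep s mk p P = f (prep s mk (p @ c) T) \<and>
    pedg D s mk p P = pedg D s mk (p @ c) T \<union> K (prep s mk (p @ c) T) \<and> hole_switching P c f K"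
  using assms
proof (induction P c arbitrary: p rule: subt.induct)
  case (1 U)
  then show ?case
    by (intro exI[of _ "\<lambda>x. x"] exI[of _ "\<lambda>_. {}"]) (auto simp: hole_switching_def)
next
  case (3 X Y b c)
  have prems: "subt (if b then Y else X) c = Some T" "\<And>q. mk (p @ q) \<in> D \<Longrightarrow> \<exists>q'. q = (b # c) @ q'"
    using "3.prems" by auto
  show ?case
  proof (cases b)
    case True
    have sib: "sw X (prep s mk (p @ [False]) X) (pedg D s mk (p @ [False]) X)"
      by (rule sw_pos) (use prems(2)[of "False # _"] True in auto)
    have "mk p \<notin> D" using prems(2)[of "[]"] by auto
    moreover obtain f K where "prep s mk (p @ [True]) Y = f (prep s mk (p @ True # c) T)"
      "pedg D s mk (p @ [True]) Y = pedg D s mk (p @ True # c) T \<union> K (prep s mk (p @ True # c) T)"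
      and hole: "hole_switching Y c f K"
      using "3.IH"[of "p @ [True]"] prems(1) True prems(2)[of "True # _"] by auto
    ultimately show ?thesis
      using hole_switching_Tens(2)[OF hole sib, of "\<not> s (mk p)"] True
      by (intro exI conjI) (assumption | auto)+
  next
    case False
    have sib: "sw Y (prep s mk (p @ [True]) Y) (pedg D s mk (p @ [True]) Y)"
      by (rule sw_pos) (use prems(2)[of "True # _"] False in auto)
    have "mk p \<notin> D" using prems(2)[of "[]"] by auto
    moreover obtain f K where "prep s mk (p @ [False]) X = f (prep s mk (p @ False # c) T)"
      "pedg D s mk (p @ [False]) X = pedg D s mk (p @ False # c) T \<union> K (prep s mk (p @ False # c) T)"
      and hole: "hole_switching X c f K"
      using "3.IH"[of "p @ [False]"] prems(1) False prems(2)[of "False # _"] by auto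
    ultimately show ?thesis
      using hole_switching_Tens(1)[OF hole sib, of "s (mk p)"] False
      by (intro exI conjI) (assumption | auto)+
  qed
next
  case (4 X Y b c)
  have prems: "subt (if b then Y else X) c = Some T" "\<And>q. mk (p @ q) \<in> D \<Longrightarrow> \<exists>q'. q = (b # c) @ q'"
    using "4.prems" by auto
  show ?case
  proof (cases b)
    case True
    have sib: "sw X (prep s mk (p @ [False]) X) (pedg D s mk (p @ [False]) X)"
      by (rule sw_pos) (use prems(2)[of "False # _"] True in auto)
    have "mk p \<notin> D" using prems(2)[of "[]"] by auto
    moreover obtain f K where "prep s mk (p @ [True]) Y = f (prep s mk (p @ True # c) T)"
      "pedg D s mk (p @ [True]) Y = pedg D s mk (p @ True # c) T \<union> K (prep s mk (p @ True # c) T)"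
      and hole: "hole_switching Y c f K"
      using "4.IH"[of "p @ [True]"] prems(1) True prems(2)[of "True # _"] by auto
    ultimately show ?thesis
      using hole_switching_Parr(2)[OF hole sib, of "\<not> s (mk p)"] True
      by (intro exI conjI) (assumption | auto)+
  next
    case False
    have sib: "sw Y (prep s mk (p @ [True]) Y) (pedg D s mk (p @ [True]) Y)"
      by (rule sw_pos) (use prems(2)[of "True # _"] False in auto)
    have "mk p \<notin> D" using prems(2)[of "[]"] by auto
    moreover obtain f K where "prep s mk (p @ [False]) X = f (prep s mk (p @ False # c) T)"
      "pedg D s mk (p @ [False]) X = pedg D s mk (p @ False # c) T \<union> K (prep s mk (p @ False # c) T)"
      and hole: "hole_switching X c f K"
      using "4.IH"[of "p @ [False]"] prems(1) False prems(2)[of "False # _"] by auto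
    ultimately show ?thesis
      using hole_switching_Parr(1)[OF hole sib, of "s (mk p)"] False
      by (intro exI conjI) (assumption | auto)+
  qed
qed simp

lemma subt_names: "subt P c = Some T \<Longrightarrow> names T \<subseteq> names P"
  by (induction P c rule: subt.induct) (auto split: if_splits)

lemma ntens_repl: "subt P c = Some T \<Longrightarrow> ntens (repl P c T') + ntens T = ntens P + ntens T'"
  by (induction P c rule: subt.induct) auto

text \<open>If \<open>i\<close> reached a leaf \<open>x\<close> of \<open>S\<close> outside of \<open>S\<close>, then switching \<open>S\<close> to be represented by \<open>x\<close>
  would make the edge between \<open>S\<close> and \<open>i\<close> redundant.\<close>
lemma not_conn_to_bot:
  fixes P :: "('v, 'a) tree"
  assumes leaf_correct: "leaf_correct P0 \<Gamma>" and P0: "P0 = repl P c (Tens S (Leaf (i, LBot)))" and c: "subt P c = Some T"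
    and plug: "\<And>T' t E. sw T' t E \<Longrightarrow> \<exists>r. sw (repl P c T') r (E \<union> K t)"
    and K: "\<And>x y e. e \<in> K x \<Longrightarrow> x \<notin> e \<Longrightarrow> e \<in> K y"
    and Es: "sws \<Gamma> Es"
    and S: "sw S \<rho> ES" and t: "t \<in> {\<rho>, i}" and x: "x \<in> names S"
  shows "\<not> conn (ES \<union> K t \<union> \<Union> (set Es)) i x"
proof -
  let ?F = "\<Union> (set Es)"
  have fin: "finite (E \<union> K t \<union> ?F)" and card: "card (E \<union> K t \<union> ?F) + 1 < card (names P0)"
    if E: "sw S r E" for r E t
  proof -
    \<comment> \<open>Plugging a single leaf into the hole isolates the context edges, so that
      \<open>sw_card\<close> bounds \<open>K t\<close>.\<close>
    obtain r' where r': "sw (repl P c (Leaf (t, LBot))) r' ({} \<union> K t)"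
      using plug[OF sw_leaf[of "(t, LBot)"]] by auto
    note b = sw_card[OF r'] sw_card[OF E] sws_card[OF Es]
    show "finite (E \<union> K t \<union> ?F)" using b by simp
    have "card (E \<union> K t \<union> ?F) \<le> card E + card (K t) + card ?F"
      using card_Un_le[of E "K t"] card_Un_le[of "E \<union> K t" ?F] by linarith
    moreover have "ntens (repl P c (Leaf (t, LBot))) + ntens S + 1 = ntens P0"
      using ntens_repl[OF c, of "Leaf (t, LBot)"] ntens_repl[OF c, of "Tens S (Leaf (i, LBot))"] P0 by simp
    moreover have "card (names P0) = ntens P0 + sum_list (map ntens \<Gamma>) + 1"
      using leaf_correct unfolding leaf_correct_def by blast
    ultimately show "card (E \<union> K t \<union> ?F) + 1 < card (names P0)" using b by simp
  qed
  have sp: "spans (insert {r, i} (E \<union> K t \<union> ?F)) (names P0)" if E: "sw S r E" and t: "t \<in> {r, i}" for r E t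
  proof -
    have "sw (Tens S (Leaf (i, LBot))) t (insert {r, i} (E \<union> {}))"
      using sw_tens[OF E sw_leaf[of "(i, LBot)"], of t] t by simp
    then obtain r' where "sw P0 r' (insert {r, i} (E \<union> {}) \<union> K t)" unfolding P0 using plug by blast
    from leaf_correct_spans[OF leaf_correct this Es] show ?thesis by (simp add: Un_ac)
  qed
  have indep: "\<not> conn (E \<union> K t \<union> ?F) r i" if "sw S r E" "t \<in> {r, i}" for r E t
    using tight_spans_not_conn[OF fin[OF that(1)] _ card[OF that(1)] sp[OF that]] by simp
  have bot: "\<not> conn (ES \<union> K i \<union> ?F) i y" if y: "y \<in> names S" for y
  proof
    assume y': "conn (ES \<union> K i \<union> ?F) i y"
    \<comment> \<open>This is what \<open>i\<close> reaches without edges of \<open>S\<close>. It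
      contains no leaf of \<open>S\<close>, since \<open>S\<close> could be switched to be
      represented by that leaf while \<open>K i\<close> stays the same. Hence edges of
      \<open>S\<close> never extend it.\<close>
    define R where "R = {z. conn (K i \<union> ?F) i z}"
    have disj: "z \<notin> names S" if z: "z \<in> R" for z
    proof
      assume "z \<in> names S"
      then obtain E where E: "sw S z E" using sw_root_ex by metis
      have "conn (E \<union> K i \<union> ?F) i z"
        using z unfolding R_def by (auto intro: conn_mono)
      from conn_sym[OF this] indep[OF E, of i] show False by simp
    qed
    have "y \<in> R"
    proof (rule conn_closed[OF y'])
      show "i \<in> R" unfolding R_def by simp
      fix a b assume ab: "{a, b} \<in> ES \<union> K i \<union> ?F" and a: "a \<in> R"
      have "{a, b} \<notin> ES"
        using sw_edges[OF S, of "{a, b}"] disj[OF a] by (auto simp: doubleton_eq_iff)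
      then have "conn (K i \<union> ?F) a b" using ab by (intro conn_edge) auto
      then show "b \<in> R" using a unfolding R_def by (auto intro: conn_trans)
    qed
    then show False using disj y by blast
  qed
  show ?thesis
  proof (cases "t = i")
    case True
    then show ?thesis using bot[OF x] by simp
  next
    case False
    then have t: "t = \<rho>" using t by simp
    show ?thesis
    proof
      assume ix: "conn (ES \<union> K t \<union> ?F) i x"
      \<comment> \<open>A path from \<open>i\<close> never meets \<open>t\<close>, the
        representative of \<open>S\<close>, so by \<open>K\<close> its context edges belong to
        \<open>K i\<close> as well, and the case already settled applies.\<close>
      define U where "U = {z. conn (ES \<union> K i \<union> ?F) i z \<and> conn (ES \<union> K t \<union> ?F) i z}"
      have "x \<in> U"
      proof (rule conn_closed[OF ix])
        show "i \<in> U" unfolding U_def by simp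
        fix a b assume ab: "{a, b} \<in> ES \<union> K t \<union> ?F" and a: "a \<in> U"
        have cb: "conn (ES \<union> K t \<union> ?F) i b"
          using a conn_edge[OF ab] unfolding U_def by (auto intro: conn_trans)
        have "t \<notin> {a, b}"
        proof
          assume "t \<in> {a, b}"
          then have "conn (ES \<union> K t \<union> ?F) i t" using a cb unfolding U_def by auto
          from conn_sym[OF this] indep[OF S, of t] t show False by simp
        qed
        then have "{a, b} \<in> ES \<union> K i \<union> ?F" using ab K[of "{a, b}" t i] by blast
        then have "conn (ES \<union> K i \<union> ?F) a b" by (rule conn_edge)
        then show "b \<in> U" using a cb unfolding U_def by (auto intro: conn_trans)
      qed
      then show False using bot[OF x] unfolding U_def by simp
    qed
  qed
qed

text \<open>An end of an edge may slide along a path formed by the other edges.\<close>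

lemma spans_replace:
  assumes "spans (insert {q, i} X) V" "conn X r q"
  shows "spans (insert {r, i} X) V"
  unfolding spans_def
proof (intro ballI)
  fix x y assume "x \<in> V" "y \<in> V"
  then have "conn (insert {q, i} X) x y" using assms(1) unfolding spans_def by blast
  then show "conn (insert {r, i} X) x y"
  proof (rule conn_map[where g = "\<lambda>x. x"])
    have rq: "conn (insert {r, i} X) r q" using assms(2) by (rule conn_mono) auto
    have "conn (insert {r, i} X) r i" by (rule conn_edge) simp
    then have qi: "conn (insert {r, i} X) q i" using conn_sym[OF rq] by (rule conn_trans[rotated])
    fix a b assume "{a, b} \<in> insert {q, i} X"
    then consider "{a, b} \<in> X" | "a = q" "b = i" | "a = i" "b = q" by (auto simp: doubleton_eq_iff)
    then show "conn (insert {r, i} X) a b"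
      by cases (auto intro: conn_edge qi conn_sym[OF qi])
  qed
qed

lemma names_mset: "mset (leaves P) = mset (leaves P') \<Longrightarrow> names P = names P'"
  by (metis set_mset_mset)

text \<open>After the jump the edge at \<open>i\<close> starts from the representative
  \<open>r\<close> of \<open>R\<close>. Only the case where the whole redex is represented by
  \<open>q\<close> in \<open>Q\<close> is new. There the old switching has the edge from
  \<open>q\<close> to \<open>i\<close>; without it \<open>r\<close> does not reach \<open>i\<close>,
  so \<open>r\<close> reaches \<open>q\<close>, and the edge can slide from \<open>q\<close> to
  \<open>r\<close>.\<close>

lemma leaf_correct_jump:
  fixes P0 :: "('v, 'a) tree"
  assumes leaf_correct: "leaf_correct P0 \<Gamma>" and c: "subt P0 c = Some (Tens (Parr Q R) (Leaf (i, LBot)))"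
    and P1: "P1 = repl P0 c (Parr Q (Tens R (Leaf (i, LBot))))"
  shows "leaf_correct P1 \<Gamma>"
proof -
  let ?T0 = "Tens (Parr Q R) (Leaf (i, LBot))" and ?T1 = "Parr Q (Tens R (Leaf (i, LBot)))"
  have c1: "subt P1 c = Some ?T1" unfolding P1 using c by (rule subt_repl)
  have P0: "P0 = repl P1 c ?T0" unfolding P1 using repl_repl[OF c] by simp
  have names: "names P1 = names P0"
    unfolding P1 by (rule names_mset, rule mset_leaves_repl[OF c]) simp
  have "ntens P1 = ntens P0" using ntens_repl[OF c, of ?T1] unfolding P1 by simp
  moreover have "spans (E \<union> \<Union> (set Es)) (names P0)"
    if E: "sw P1 r' E" and Es: "sws \<Gamma> Es" for r' E Es
  proof -
    let ?F = "\<Union> (set Es)"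
    have "inj PN" by (simp add: inj_def)
    then obtain s where s: "pedg {} s PN [] P1 = E"
      using sw_pos_ex[OF _ E, of PN "[]"] by blast
    define t where "t = prep s PN c ?T1"
    obtain f K where K: "pedg {} s PN [] P1 = pedg {} s PN c ?T1 \<union> K t" "hole_switching P1 c f K"
      using context_switching[OF c1, of PN "[]" "{}" s] unfolding t_def by auto
    have plug: "\<And>T' t E. sw T' t E \<Longrightarrow> \<exists>r. sw (repl P1 c T') r (E \<union> K t)"
      using K(2) unfolding hole_switching_def by blast
    have mono: "\<And>x y e. e \<in> K x \<Longrightarrow> x \<notin> e \<Longrightarrow> e \<in> K y"
      using K(2) unfolding hole_switching_def by blast
    have "sw ?T1 t (pedg {} s PN c ?T1)" unfolding t_def by (rule sw_pos) simp
    then obtain q EQ r ER where Q: "sw Q q EQ" and R: "sw R r ER"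
      and T1: "pedg {} s PN c ?T1 = EQ \<union> insert {r, i} ER" and t: "t \<in> {q, r, i}"
      by (auto elim!: sw_parrE sw_tensE sw_leafE)
    have S: "sw (Parr Q R) q (EQ \<union> ER)" "sw (Parr Q R) r (EQ \<union> ER)"
      using sw_parr[OF Q R] by simp_all
    have sp: "spans (insert {u, i} (EQ \<union> ER \<union> K v \<union> ?F)) (names P0)"
      if u: "sw (Parr Q R) u (EQ \<union> ER)" and v: "v \<in> {u, i}" for u v
    proof -
      have "sw ?T0 v (insert {u, i} (EQ \<union> ER \<union> {}))"
        using sw_tens[OF u sw_leaf[of "(i, LBot)"], of v] v by simp
      then obtain r' where "sw P0 r' (insert {u, i} (EQ \<union> ER \<union> {}) \<union> K v)"
        using plug P0 by metis
      from leaf_correct_spans[OF leaf_correct this Es] show ?thesis by (simp add: Un_ac)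
    qed
    have "spans (insert {r, i} (EQ \<union> ER \<union> K t \<union> ?F)) (names P0)"
    proof (cases "t = q")
      case True
      let ?X = "EQ \<union> ER \<union> K t \<union> ?F"
      have 1: "spans (insert {q, i} ?X) (names P0)" using sp[OF S(1), of t] True by simp
      have "r \<in> names (Parr Q R)" "q \<in> names (Parr Q R)"
        using sw_in_names[OF S(1)] sw_in_names[OF S(2)] by auto
      from not_conn_to_bot[OF leaf_correct P0 c1 plug mono Es S(1) _ this(1), where t = t] True
      have ri: "\<not> conn ?X r i" using conn_sym by fastforce
      have "q \<in> names P0" "r \<in> names P0"
        using sw_in_names[OF Q] sw_in_names[OF R] subt_names[OF c] by auto
      then have "conn (insert {q, i} ?X) r q" using 1 unfolding spans_def by blast
      from conn_insert_cases[OF this] ri have "conn ?X r q" by blast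
      with 1 show ?thesis by (rule spans_replace)
    next
      case False
      then show ?thesis using sp[OF S(2), of t] t by auto
    qed
    moreover have "E \<union> ?F = insert {r, i} (EQ \<union> ER \<union> K t \<union> ?F)"
      unfolding s[symmetric] K(1) T1 by blast
    ultimately show ?thesis by simp
  qed
  ultimately show ?thesis using leaf_correct names unfolding leaf_correct_def by simp
qed

lemma rep_node_in_names:
  assumes "u \<in> tnodes PN c Q" "subt P c = Some Q"
  shows "rep_node P \<Gamma> s u \<in> names Q"
proof -
  from assms(1) consider x where "u = LN x" "x \<in> names Q" | q where "u = PN q" "q \<in> ipos c Q"
    unfolding tnodes_eq by blast
  then show ?thesis
  proof cases
    case 1
    then show ?thesis by (simp add: rep_node_def)
  next
    case 2
    have "\<exists>q' U. q = p @ q' \<and> subt T q' = Some U" if "q \<in> ipos p T" for p and T :: "('a, 'b) tree"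
      using that
    proof (induction T arbitrary: p)
      case (Tens A B)
      then show ?case using Tens.IH(1)[of "p @ [False]"] Tens.IH(2)[of "p @ [True]"]
        by (auto intro: exI[of _ "[]"] exI[of _ "False # _"] exI[of _ "True # _"])
    next
      case (Parr A B)
      then show ?case using Parr.IH(1)[of "p @ [False]"] Parr.IH(2)[of "p @ [True]"]
        by (auto intro: exI[of _ "[]"] exI[of _ "False # _"] exI[of _ "True # _"])
    qed simp
    then obtain q' U where q: "q = c @ q'" "subt Q q' = Some U" using 2(2) by blast
    then have "subt P q = Some U" using assms(2) by (simp add: subt_append)
    then have "rep_node P \<Gamma> s u = prep s PN q U" using 2(1) by (simp add: rep_node_def)
    also have "\<dots> \<in> names U" using sw_in_names[OF sw_pos[of PN q "{}" U s]] by simp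
    finally show ?thesis using subt_names[OF q(2)] by blast
  qed
qed

text \<open>With the edge to \<open>i\<close> removed, the tensor below \<open>R\<close> is
  represented by a leaf of \<open>R\<close>. What remains is a switching of the original context
  with the par of \<open>Q\<close> and \<open>R\<close> in its hole and no edge to \<open>i\<close>,
  so \<open>not_conn_to_bot\<close> applies.\<close>

lemma jump_ok_inward:
  fixes P0 :: "('v, 'a) tree"
  assumes leaf_correct: "leaf_correct P0 \<Gamma>" and c: "subt P0 c = Some (Tens (Parr Q R) (Leaf (i, LBot)))"
    and P1: "P1 = repl P0 c (Parr Q (Tens R (Leaf (i, LBot))))"
  shows "jump_ok P1 \<Gamma> c Q i"
  unfolding jump_ok_def
proof (intro allI ballI notI)
  fix s u
  let ?T0 = "Tens (Parr Q R) (Leaf (i, LBot))" and ?T1 = "Parr Q (Tens R (Leaf (i, LBot)))"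
  let ?d = "PN (c @ [True])"
  assume u: "u \<in> tnodes PN (c @ [False]) Q"
    and path: "(adj (switch_edges s (gedges P1 \<Gamma>) - {(?d, LN i, None)}))\<^sup>*\<^sup>* u (LN i)"
  have c1: "subt P1 c = Some ?T1" unfolding P1 using c by (rule subt_repl)
  have P0: "P0 = repl P1 c ?T0" unfolding P1 using repl_repl[OF c] by simp
  \<comment> \<open>The node \<open>?d\<close> is a tensor, so its value affects no edge of the
    switching; \<open>True\<close> makes its representative come from \<open>R\<close>.\<close>
  define s' where "s' = s(?d := True)"
  have d: "subt P1 (c @ [True]) = Some (Tens R (Leaf (i, LBot)))" using c1 by (simp add: subt_append)
  have dedge: "k = None \<and> (v = nid PN (c @ [True, False]) R \<or> v = LN i)"
    if e: "(?d, v, k) \<in> gedges P1 \<Gamma>" for v k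
  proof -
    obtain mk T q A B b where 1: "mk = PN \<and> T = P1 \<or> (\<exists>i. mk = GN i \<and> T = \<Gamma> ! i \<and> i < length \<Gamma>)" "?d = mk q"
      "subt T q = Some (Tens A B) \<and> k = None \<or> subt T q = Some (Parr A B) \<and> k = Some b"
      "v = nid mk (q @ [b]) (if b then B else A)"
      using e by (rule gedges_subt)
    then have "mk = PN" "T = P1" "q = c @ [True]" by auto
    then show ?thesis using 1(3,4) d by (cases b) auto
  qed
  have "switch_edges s (gedges P1 \<Gamma>) = switch_edges s' (gedges P1 \<Gamma>)"
  proof -
    have "k \<noteq> Some (s w) \<longleftrightarrow> k \<noteq> Some (s' w)" if "(w, v, k) \<in> gedges P1 \<Gamma>" for w v k
      using dedge[of v k] that unfolding s'_def by (cases "w = ?d") auto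
    then show ?thesis unfolding switch_edges_def by blast
  qed
  with path have path': "(adj (switch_edges s' (gedges P1 \<Gamma>) - {(?d, LN i, None)}))\<^sup>*\<^sup>* u (LN i)" by simp
  have path1: "conn (graph_edg {?d} P1 \<Gamma> s') (rep_node P1 \<Gamma> s' u) (rep_node P1 \<Gamma> s' (LN i))"
  proof (rule graph_to_leaf[OF path'])
    fix w v k assume e: "(w, v, k) \<in> switch_edges s' (gedges P1 \<Gamma>) - {(?d, LN i, None)}" "w \<in> {?d}"
    then have w: "w = ?d" "(?d, v, k) \<in> gedges P1 \<Gamma>" unfolding switch_edges_def by auto
    from dedge[OF w(2)] e w(1) have v: "v = nid PN (c @ [True, False]) R" by auto
    have "rep_node P1 \<Gamma> s' v = prep s' PN (c @ [True, False]) R"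
      unfolding v using c1 by (cases R) (auto simp: rep_node_def subt_append)
    then show "rep_node P1 \<Gamma> s' v = rep_node P1 \<Gamma> s' w"
      unfolding w(1) using d by (simp add: rep_node_def s'_def)
  qed blast
  have uQ: "rep_node P1 \<Gamma> s' u \<in> names Q"
    by (rule rep_node_in_names[OF u]) (simp add: subt_append c1)
  obtain Es where Es: "sws \<Gamma> Es"
    "\<Union> (set Es) = (\<Union>j<length \<Gamma>. pedg {?d} s' (GN j) [] (\<Gamma> ! j))"
  proof (rule that)
    show "sws \<Gamma> (map (\<lambda>j. pedg {?d} s' (GN j) [] (\<Gamma> ! j)) [0..<length \<Gamma>])"
      unfolding list_all2_conv_all_nth using sw_pos[of "GN _" "[]" "{?d}"] by (auto intro!: exI)
  qed auto
  define t where "t = prep s' PN c ?T1"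
  obtain f K where K: "pedg {?d} s' PN [] P1 = pedg {?d} s' PN c ?T1 \<union> K t" "hole_switching P1 c f K"
    using context_switching[OF c1, of PN "[]" "{?d}" s'] unfolding t_def by auto
  have plug: "\<And>T' t E. sw T' t E \<Longrightarrow> \<exists>r. sw (repl P1 c T') r (E \<union> K t)"
      using K(2) unfolding hole_switching_def by blast
  have mono: "\<And>x y e. e \<in> K x \<Longrightarrow> x \<notin> e \<Longrightarrow> e \<in> K y"
      using K(2) unfolding hole_switching_def by blast
  have Q: "sw Q (prep s' PN (c @ [False]) Q) (pedg {?d} s' PN (c @ [False]) Q)" by (rule sw_pos) simp
  have R: "sw R (prep s' PN (c @ [True, False]) R) (pedg {?d} s' PN (c @ [True, False]) R)" by (rule sw_pos) simp
  have "pedg {?d} s' PN c ?T1 = pedg {?d} s' PN (c @ [False]) Q \<union> pedg {?d} s' PN (c @ [True, False]) R"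
    by simp
  moreover have "t \<in> {prep s' PN (c @ [False]) Q, prep s' PN (c @ [True, False]) R}"
    unfolding t_def s'_def by simp
  ultimately have S: "sw (Parr Q R) t (pedg {?d} s' PN c ?T1)" using sw_parr[OF Q R] by simp
  have nc: "\<not> conn (pedg {?d} s' PN c ?T1 \<union> K t \<union> \<Union> (set Es)) i x" if x: "x \<in> names Q" for x
  proof -
    have "x \<in> names (Parr Q R)" using x by auto
    from not_conn_to_bot[OF leaf_correct P0 c1 plug mono Es(1) S _ this, where t = t] show ?thesis by simp
  qed
  have "graph_edg {?d} P1 \<Gamma> s' = pedg {?d} s' PN c ?T1 \<union> K t \<union> \<Union> (set Es)"
    unfolding graph_edg_def using K(1) Es(2) by simp
  with conn_sym[OF path1] nc[OF uQ] show False by (simp add: rep_node_def)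
qed

text \<open>The orientation, bottoms on the left and the positive atom first, is that produced by
  the id and bottom rules.\<close>

inductive block :: "('v, 'a) tree \<Rightarrow> bool" where
  block_one: "block (Leaf (x, LOne))"
| block_ax: "block (Tens (Leaf (x, Pos a)) (Leaf (y, Neg a)))"
| block_bot: "block L \<Longrightarrow> block (Tens (Leaf (x, LBot)) L)"

inductive normal :: "('v, 'a) tree \<Rightarrow> bool" where
  normal_block: "block L \<Longrightarrow> normal L"
| normal_parr: "normal A \<Longrightarrow> normal B \<Longrightarrow> normal (Parr A B)"

lemma repl_append: "subt P c = Some T \<Longrightarrow> repl P (c @ d) X = repl P c (repl T d X)"
  by (induction P c rule: subt.induct) auto

lemma sw_repl:
  assumes "subt P c = Some T" "\<And>r E. sw T' r E \<Longrightarrow> sw T r E" "sw (repl P c T') r E"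
  shows "sw P r E"
  using assms(1,3)
proof (induction P c arbitrary: r E rule: subt.induct)
  case (1 U)
  then show ?case using assms(2) by simp
next
  case (3 A B b c)
  then show ?case
    by (cases b) (auto elim!: sw_tensE intro: sw_tens)
next
  case (4 A B b c)
  then show ?case
    by (cases b) (auto elim!: sw_parrE intro: sw_parr)
qed simp

lemma sw_tens_comm:
  assumes "sw (Tens B A) r E"
  shows "sw (Tens A B) r E"
proof -
  obtain b EB a EA where "E = insert {b, a} (EB \<union> EA)" "sw B b EB" "sw A a EA" "r \<in> {b, a}"
    using assms by (auto elim!: sw_tensE)
  then show ?thesis using sw_tens[of A a EA B b EB r] by (auto simp: Un_commute insert_commute)
qed

section \<open>Rewriting correct graphs to normal linkings\<close>

definition net :: "('v, 'a) tree list \<Rightarrow> ('v, 'a) tree \<Rightarrow> bool" where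
  "net \<Gamma> P \<longleftrightarrow> pre_proof_graph P \<Gamma> \<and> leaf_correct P \<Gamma>"

lemma sim_refl: "sim \<Gamma> P P"
  unfolding sim_def by simp

lemma sim_trans: "sim \<Gamma> P Q \<Longrightarrow> sim \<Gamma> Q R \<Longrightarrow> sim \<Gamma> P R"
  unfolding sim_def by (rule rtranclp_trans)

lemma sim_step_sim: "sim_step \<Gamma> P Q \<Longrightarrow> sim \<Gamma> P Q" "sim_step \<Gamma> P Q \<Longrightarrow> sim \<Gamma> Q P"
  unfolding sim_def symclp_def by (auto intro: r_into_rtranclp)

lemma net_tens_comm:
  assumes "net \<Gamma> P" "subt P c = Some (Tens A B)"
  shows "sim \<Gamma> P (repl P c (Tens B A)) \<and> net \<Gamma> (repl P c (Tens B A))"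
proof -
  let ?P = "repl P c (Tens B A)"
  have st: "sim_step \<Gamma> P ?P"
    unfolding sim_step_def using assms(2) tens_comm by blast
  have "names ?P = names P"
    by (rule names_mset, rule mset_leaves_repl[OF assms(2)]) simp
  moreover have "ntens ?P = ntens P" using ntens_repl[OF assms(2), of "Tens B A"] by simp
  moreover have "sw P r E" if "sw ?P r E" for r E
    using assms(2) sw_tens_comm that by (rule sw_repl)
  ultimately have "leaf_correct ?P \<Gamma>" using assms(1) unfolding net_def leaf_correct_def by metis
  then show ?thesis
    using sim_step_pre[OF st] sim_step_sim(1)[OF st] assms(1) unfolding net_def by blast
qed

lemma net_jump:
  assumes "net \<Gamma> P" "subt P c = Some (Tens (Parr Q R) (Leaf (i, LBot)))"
  defines "P' \<equiv> repl P c (Parr Q (Tens R (Leaf (i, LBot))))"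
  shows "sim \<Gamma> P P' \<and> net \<Gamma> P'"
proof -
  have leaf_correct: "leaf_correct P \<Gamma>" using assms(1) unfolding net_def by simp
  have "P = repl P' c (Tens (Parr Q R) (Leaf (i, LBot)))"
    unfolding P'_def using repl_repl[OF assms(2)] by simp
  moreover have "subt P' c = Some (Parr Q (Tens R (Leaf (i, LBot))))"
    unfolding P'_def using assms(2) by (rule subt_repl)
  moreover have "jump_ok P' \<Gamma> c Q i"
    by (rule jump_ok_inward[OF leaf_correct assms(2)]) (simp add: P'_def)
  ultimately have st: "sim_step \<Gamma> P' P" unfolding sim_step_def by blast
  have "leaf_correct P' \<Gamma>" by (rule leaf_correct_jump[OF leaf_correct assms(2)]) (simp add: P'_def)
  then show ?thesis
    using sim_step_pre[OF st] sim_step_sim(2)[OF st] assms(1) unfolding net_def by blast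
qed

text \<open>The bottom jumps into the right component of each par until it meets a block, where
  commutativity moves it to the left.\<close>

lemma normalise_bot:
  assumes "normal N" "net \<Gamma> P" "subt P c = Some (Tens N (Leaf (i, LBot)))"
  shows "\<exists>N'. normal N' \<and> sim \<Gamma> P (repl P c N') \<and> net \<Gamma> (repl P c N')"
  using assms
proof (induction arbitrary: P c rule: normal.induct)
  case (normal_block L)
  then show ?case
    using net_tens_comm[OF normal_block.prems] normal.normal_block[OF block_bot[OF normal_block.hyps, of i]] by blast
next
  case (normal_parr A B)
  let ?P = "repl P c (Parr A (Tens B (Leaf (i, LBot))))"
  have 1: "sim \<Gamma> P ?P" "net \<Gamma> ?P" using net_jump[OF normal_parr.prems] by auto
  have c: "subt ?P c = Some (Parr A (Tens B (Leaf (i, LBot))))"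
    using normal_parr.prems(2) by (rule subt_repl)
  then have "subt ?P (c @ [True]) = Some (Tens B (Leaf (i, LBot)))" by (simp add: subt_append)
  from normal_parr.IH(2)[OF 1(2) this] obtain N' where N': "normal N'"
    "sim \<Gamma> ?P (repl ?P (c @ [True]) N')" "net \<Gamma> (repl ?P (c @ [True]) N')" by blast
  have "repl ?P (c @ [True]) N' = repl P c (Parr A N')"
    using repl_append[OF c, of "[True]" N'] repl_repl2[OF normal_parr.prems(2)] by simp
  then show ?case
    using N' 1 normal.normal_parr[OF normal_parr.hyps(1) N'(1)] sim_trans by metis
qed

lemma normalise_left_bot:
  assumes IH: "\<And>P c. net \<Gamma> P \<Longrightarrow> subt P c = Some L \<Longrightarrow>
      \<exists>N. normal N \<and> sim \<Gamma> P (repl P c N) \<and> net \<Gamma> (repl P c N)"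
    and P: "net \<Gamma> P" and c: "subt P c = Some (Tens L (Leaf (x, LBot)))"
  shows "\<exists>N. normal N \<and> sim \<Gamma> P (repl P c N) \<and> net \<Gamma> (repl P c N)"
proof -
  have "subt P (c @ [False]) = Some L" using c by (simp add: subt_append)
  from IH[OF P this] obtain N where N: "normal N"
    "sim \<Gamma> P (repl P (c @ [False]) N)" "net \<Gamma> (repl P (c @ [False]) N)" by blast
  let ?P = "repl P c (Tens N (Leaf (x, LBot)))"
  have eq: "repl P (c @ [False]) N = ?P" using repl_append[OF c, of "[False]" N] by simp
  have "subt ?P c = Some (Tens N (Leaf (x, LBot)))" using c by (rule subt_repl)
  from normalise_bot[OF N(1) _ this] N(3) eq obtain N' where
    "normal N'" "sim \<Gamma> ?P (repl ?P c N')" "net \<Gamma> (repl ?P c N')" by auto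
  moreover have "repl ?P c N' = repl P c N'" using c by (rule repl_repl2)
  ultimately show ?thesis using N(2) eq sim_trans by metis
qed

text \<open>The induction is on the subterm while the surrounding graph varies: correctness and the
  side condition of a jump concern the whole graph and cannot be stated for the subterm
  alone.\<close>

lemma normalise_at:
  assumes "is_linking L" "net \<Gamma> P" "subt P c = Some L"
  shows "\<exists>N. normal N \<and> sim \<Gamma> P (repl P c N) \<and> net \<Gamma> (repl P c N)"
  using assms
proof (induction arbitrary: P c rule: is_linking.induct)
  case (lk_one x)
  then show ?case using repl_same[OF lk_one.prems(2)] sim_refl normal_block[OF block_one] by metis
next
  case (lk_ax1 x a y)
  then show ?case using repl_same[OF lk_ax1.prems(2)] sim_refl normal_block[OF block_ax] by metis
next
  case (lk_ax2 y a x)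
  then show ?case using net_tens_comm[OF lk_ax2.prems] normal_block[OF block_ax] by metis
next
  case (lk_botr L x)
  show ?case by (rule normalise_left_bot[OF lk_botr.IH lk_botr.prems])
next
  case (lk_botl L x)
  let ?Q = "repl P c (Tens L (Leaf (x, LBot)))"
  have Q: "sim \<Gamma> P ?Q" "net \<Gamma> ?Q" using net_tens_comm[OF lk_botl.prems] by auto
  have c: "subt ?Q c = Some (Tens L (Leaf (x, LBot)))"
    using lk_botl.prems(2) by (rule subt_repl)
  have "\<exists>N. normal N \<and> sim \<Gamma> ?Q (repl ?Q c N) \<and> net \<Gamma> (repl ?Q c N)"
    by (rule normalise_left_bot[OF lk_botl.IH Q(2) c])
  then obtain N where "normal N" "sim \<Gamma> ?Q (repl ?Q c N)" "net \<Gamma> (repl ?Q c N)" by blast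
  moreover have "repl ?Q c N = repl P c N" using lk_botl.prems(2) by (rule repl_repl2)
  ultimately show ?case using Q(1) sim_trans by metis
next
  case (lk_par L L')
  have "subt P (c @ [False]) = Some L" using lk_par.prems(2) by (simp add: subt_append)
  from lk_par.IH(1)[OF lk_par.prems(1) this] obtain N where N: "normal N"
    "sim \<Gamma> P (repl P (c @ [False]) N)" "net \<Gamma> (repl P (c @ [False]) N)" by blast
  let ?P = "repl P c (Parr N L')"
  have eq: "repl P (c @ [False]) N = ?P"
    using repl_append[OF lk_par.prems(2), of "[False]" N] by simp
  have c: "subt ?P c = Some (Parr N L')" using lk_par.prems(2) by (rule subt_repl)
  then have "subt ?P (c @ [True]) = Some L'" by (simp add: subt_append)
  from lk_par.IH(2)[OF _ this] N(3) eq obtain N' where N': "normal N'"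
    "sim \<Gamma> ?P (repl ?P (c @ [True]) N')" "net \<Gamma> (repl ?P (c @ [True]) N')" by auto
  have "repl ?P (c @ [True]) N' = repl P c (Parr N N')"
    using repl_append[OF c, of "[True]" N'] repl_repl2[OF lk_par.prems(2)] by simp
  then show ?case using N N' eq sim_trans normal_parr by metis
qed

lemma normalise:
  assumes "net \<Gamma> P"
  obtains N where "normal N" "sim \<Gamma> P N" "net \<Gamma> N"
proof -
  have "is_linking P" using assms unfolding net_def pre_proof_graph_def by simp
  from normalise_at[OF this assms, of "[]"] that show ?thesis by auto
qed

section \<open>Par components\<close>

text \<open>Represents a tree up to associativity and commutativity of its outermost pars; tensors
  are opaque.\<close>

fun comps :: "('v, 'a) tree \<Rightarrow> ('v, 'a) tree multiset" where
  "comps (Parr A B) = comps A + comps B"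
| "comps (Leaf l) = {#Leaf l#}"
| "comps (Tens A B) = {#Tens A B#}"

text \<open>Restricting to the rules without side condition gives a relation closed under contexts,
  which \<open>sim_step\<close> does not offer directly.\<close>

definition bstep :: "('v, 'a) tree \<Rightarrow> ('v, 'a) tree \<Rightarrow> bool" where
  "bstep P P' \<longleftrightarrow> (\<exists>c T T'. subt P c = Some T \<and> P' = repl P c T' \<and> basic_rw T T')"

definition beq :: "('v, 'a) tree \<Rightarrow> ('v, 'a) tree \<Rightarrow> bool" where
  "beq = (symclp bstep)\<^sup>*\<^sup>*"

lemma beq_sim:
  assumes "beq P P'"
  shows "sim \<Gamma> P P'"
proof -
  have "bstep X Y \<Longrightarrow> sim_step \<Gamma> X Y" for X Y
    unfolding bstep_def sim_step_def by blast
  then have "symclp bstep \<le> symclp (sim_step \<Gamma>)" unfolding symclp_def by blast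
  from rtranclp_mono[OF this] assms show ?thesis unfolding beq_def sim_def by blast
qed

lemma beq_refl: "beq P P"
  unfolding beq_def by simp

lemma beq_trans [trans]: "beq P Q \<Longrightarrow> beq Q R \<Longrightarrow> beq P R"
  unfolding beq_def by (rule rtranclp_trans)

lemma beq_sym: "beq P Q \<Longrightarrow> beq Q P"
  unfolding beq_def
  by (induction rule: rtranclp_induct)
    (auto simp: symclp_def intro: converse_rtranclp_into_rtranclp)

lemma beq_basic: "basic_rw T T' \<Longrightarrow> beq T T'"
proof -
  assume "basic_rw T T'"
  then have "bstep T T'" unfolding bstep_def by (intro exI[of _ "[]"]) simp
  then show ?thesis unfolding beq_def symclp_def by blast
qed

lemma beq_Parr: "beq B B' \<Longrightarrow> beq (Parr A B) (Parr A B')"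
  unfolding beq_def
proof (induction rule: rtranclp_induct)
  case (step Y Z)
  have *: "bstep (Parr A X) (Parr A X')" if X: "bstep X X'" for X X'
  proof -
    obtain c T T' where "subt X c = Some T" "X' = repl X c T'" "basic_rw T T'"
      using X unfolding bstep_def by blast
    then show ?thesis unfolding bstep_def by (intro exI[of _ "True # c"]) auto
  qed
  then have "symclp bstep (Parr A Y) (Parr A Z)" using step(2) unfolding symclp_def by blast
  with step.IH show ?case by (rule rtranclp.rtrancl_into_rtrancl)
qed simp

lemma comps_nonempty: "comps T \<noteq> {#}"
  by (induction T) auto

lemma comps_extract:
  "K \<in># comps T \<Longrightarrow> comps T = {#K#} \<and> T = K \<or> (\<exists>R. beq T (Parr K R) \<and> comps T = add_mset K (comps R))"
proof (induction T)
  case (Parr A B)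
  have ext: "\<exists>R. beq (Parr A B) (Parr K R) \<and> comps A + comps B = add_mset K (comps R)"
    if A: "comps A = {#K#} \<and> A = K \<or> (\<exists>R. beq A (Parr K R) \<and> comps A = add_mset K (comps R))" for A B
    using A
  proof (elim disjE conjE exE)
    assume "comps A = {#K#}" "A = K"
    then show ?thesis by (intro exI[of _ B]) (auto simp: beq_refl)
  next
    fix R assume R: "beq A (Parr K R)" "comps A = add_mset K (comps R)"
    have "beq (Parr A B) (Parr B A)" by (rule beq_basic[OF par_comm])
    also have "beq (Parr B A) (Parr B (Parr K R))" using R(1) by (rule beq_Parr)
    also have "beq (Parr B (Parr K R)) (Parr (Parr K R) B)" by (rule beq_basic[OF par_comm])
    also have "beq (Parr (Parr K R) B) (Parr K (Parr R B))" by (rule beq_basic[OF par_assoc])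
    finally show ?thesis using R(2) by (intro exI[of _ "Parr R B"]) auto
  qed
  from Parr.prems consider "K \<in># comps A" | "K \<in># comps B" by auto
  then show ?case
  proof cases
    case 1
    then show ?thesis using ext[OF Parr.IH(1)[OF 1], of B] by auto
  next
    case 2
    obtain R where R: "beq (Parr B A) (Parr K R)" "comps B + comps A = add_mset K (comps R)"
      using ext[OF Parr.IH(2)[OF 2], of A] by blast
    have "beq (Parr A B) (Parr K R)"
      using beq_trans[OF beq_basic[OF par_comm] R(1)] .
    then show ?thesis using R(2) by (auto simp: add.commute)
  qed
qed auto

text \<open>Bring the same component to the front of both trees and recurse on what remains.\<close>

lemma comps_eq_beq: "comps T = comps T' \<Longrightarrow> beq T T'"
proof (induction "size (comps T)" arbitrary: T T' rule: less_induct)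
  case less
  obtain K where K: "K \<in># comps T" using comps_nonempty[of T] by blast
  then have K': "K \<in># comps T'" using less.prems by simp
  from comps_extract[OF K] show ?case
  proof (elim disjE conjE exE)
    assume 1: "comps T = {#K#}" "T = K"
    from comps_extract[OF K'] show ?case
    proof (elim disjE conjE exE)
      fix R assume "comps T' = add_mset K (comps R)"
      then show ?case using 1 less.prems comps_nonempty[of R] by simp
    qed (simp add: 1 beq_refl)
  next
    fix R assume R: "beq T (Parr K R)" "comps T = add_mset K (comps R)"
    from comps_extract[OF K'] obtain R' where R': "beq T' (Parr K R')" "comps T' = add_mset K (comps R')"
      using R(2) less.prems comps_nonempty[of R] by auto
    have "beq R R'" using R(2) R'(2) less.prems by (intro less.hyps) auto
    then have "beq (Parr K R) (Parr K R')" by (rule beq_Parr)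
    then show ?case using R(1) beq_sym[OF R'(1)] beq_trans by blast
  qed
qed

section \<open>Subterms and switchings indexed by subterms\<close>

fun subs :: "('v, 'a) tree \<Rightarrow> ('v, 'a) tree set" where
  "subs (Leaf l) = {Leaf l}"
| "subs (Tens A B) = insert (Tens A B) (subs A \<union> subs B)"
| "subs (Parr A B) = insert (Parr A B) (subs A \<union> subs B)"

text \<open>An opaque copy of the abbreviation \<open>names\<close>, which keeps automation from unfolding it.\<close>
definition nms :: "('v, 'a) tree \<Rightarrow> 'v set" where
  "nms T = names T"

lemma nms_simps [simp]:
  "nms (Leaf l) = {fst l}" "nms (Tens A B) = nms A \<union> nms B" "nms (Parr A B) = nms A \<union> nms B"
  by (auto simp: nms_def)

lemma finite_nms [simp]: "finite (nms T)"
  by (simp add: nms_def)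

lemma nms_nonempty [simp]: "nms T \<noteq> {}"
  by (simp add: nms_def)

abbreviation dnames :: "('v, 'a) tree \<Rightarrow> bool" where
  "dnames T \<equiv> distinct (map fst (leaves T))"

lemma subs_refl [simp]: "T \<in> subs T"
  by (cases T) auto

lemma subs_names: "A \<in> subs B \<Longrightarrow> nms A \<subseteq> nms B"
  by (induction B) auto

lemma subs_dnames: "A \<in> subs B \<Longrightarrow> dnames B \<Longrightarrow> dnames A"
  by (induction B) auto

lemma subs_size: "A \<in> subs B \<Longrightarrow> A = B \<or> size A < size B"
  by (induction B) auto

lemma subs_disjoint:
  assumes "nms A \<inter> nms B = {}"
  shows "subs A \<inter> subs B = {}"
proof (rule equals0I)
  fix U assume "U \<in> subs A \<inter> subs B"
  then have "nms U \<subseteq> nms A \<inter> nms B" using subs_names[of U] by blast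
  then show False using assms nms_nonempty[of U] by blast
qed

lemma dnames_Tens: "dnames (Tens A B) \<longleftrightarrow> dnames A \<and> dnames B \<and> nms A \<inter> nms B = {}"
  and dnames_Parr: "dnames (Parr A B) \<longleftrightarrow> dnames A \<and> dnames B \<and> nms A \<inter> nms B = {}"
  by (simp_all add: nms_def)

lemma not_subs_child:
  "Tens A B \<notin> subs A" "Tens A B \<notin> subs B" "Parr A B \<notin> subs A" "Parr A B \<notin> subs B"
  using subs_size by fastforce+

text \<open>Here a switching is indexed by subterms instead of positions.  With distinct leaf names this loses nothing,
  and no positions have to be tracked when tensors are removed from consideration.\<close>
fun vrep :: "(('v, 'a) tree \<Rightarrow> bool) \<Rightarrow> ('v, 'a) tree \<Rightarrow> 'v" where
  "vrep \<sigma> (Leaf l) = fst l"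
| "vrep \<sigma> (Tens A B) = (if \<sigma> (Tens A B) then vrep \<sigma> A else vrep \<sigma> B)"
| "vrep \<sigma> (Parr A B) = (if \<sigma> (Parr A B) then vrep \<sigma> A else vrep \<sigma> B)"

fun tedge :: "('v \<Rightarrow> 'b) \<Rightarrow> (('v, 'a) tree \<Rightarrow> bool) \<Rightarrow> ('v, 'a) tree \<Rightarrow> 'b set" where
  "tedge f \<sigma> (Tens A B) = {f (vrep \<sigma> A), f (vrep \<sigma> B)}"
| "tedge f \<sigma> (Leaf l) = {}"
| "tedge f \<sigma> (Parr A B) = {}"

lemma vrep_in_names: "vrep \<sigma> T \<in> nms T"
  by (induction T) auto

lemma vrep_cong: "(\<And>U. U \<in> subs T \<Longrightarrow> \<sigma> U = \<sigma>' U) \<Longrightarrow> vrep \<sigma> T = vrep \<sigma>' T"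
  by (induction T) auto

lemma vrep_upd [simp]: "t \<notin> subs T \<Longrightarrow> vrep (\<sigma>(t := b)) T = vrep \<sigma> T"
  by (rule vrep_cong) auto

lemma vrep_extend:
  assumes "\<And>\<sigma>. \<sigma> T = b \<Longrightarrow> vrep \<sigma> T = vrep \<sigma> C" "T \<notin> subs C" "subs C \<subseteq> subs T"
    "\<forall>U. U \<notin> subs C \<longrightarrow> \<sigma>' U = \<sigma> U" "vrep \<sigma>' C = x"
  shows "\<exists>\<tau>. (\<forall>U. U \<notin> subs T \<longrightarrow> \<tau> U = \<sigma> U) \<and> vrep \<tau> T = x"
proof (intro exI[of _ "\<sigma>'(T := b)"] conjI allI impI)
  fix U assume "U \<notin> subs T"
  then show "(\<sigma>'(T := b)) U = \<sigma> U" using assms(3,4) by auto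
next
  show "vrep (\<sigma>'(T := b)) T = x" using assms(1)[of "\<sigma>'(T := b)"] assms(2,5) by simp
qed

lemma vrep_choose:
  "x \<in> nms A \<Longrightarrow> \<exists>\<sigma>'. (\<forall>U. U \<notin> subs A \<longrightarrow> \<sigma>' U = \<sigma> U) \<and> vrep \<sigma>' A = x"
proof (induction A arbitrary: \<sigma>)
  case (Leaf l)
  then show ?case by auto
next
  case (Tens A B)
  then consider "x \<in> nms A" | "x \<in> nms B" by auto
  then show ?case
  proof cases
    case 1
    then obtain \<sigma>' where "\<forall>U. U \<notin> subs A \<longrightarrow> \<sigma>' U = \<sigma> U" "vrep \<sigma>' A = x" using Tens.IH(1)[of \<sigma>] by blast
    then show ?thesis
      by (rule vrep_extend[rotated 3, where b = True])
        (use not_subs_child(1)[of A B] in auto)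
  next
    case 2
    then obtain \<sigma>' where "\<forall>U. U \<notin> subs B \<longrightarrow> \<sigma>' U = \<sigma> U" "vrep \<sigma>' B = x" using Tens.IH(2)[of \<sigma>] by blast
    then show ?thesis
      by (rule vrep_extend[rotated 3, where b = False])
        (use not_subs_child(2)[of A B] in auto)
  qed
next
  case (Parr A B)
  then consider "x \<in> nms A" | "x \<in> nms B" by auto
  then show ?case
  proof cases
    case 1
    then obtain \<sigma>' where "\<forall>U. U \<notin> subs A \<longrightarrow> \<sigma>' U = \<sigma> U" "vrep \<sigma>' A = x" using Parr.IH(1)[of \<sigma>] by blast
    then show ?thesis
      by (rule vrep_extend[rotated 3, where b = True])
        (use not_subs_child(3)[of A B] in auto)
  next
    case 2
    then obtain \<sigma>' where "\<forall>U. U \<notin> subs B \<longrightarrow> \<sigma>' U = \<sigma> U" "vrep \<sigma>' B = x" using Parr.IH(2)[of \<sigma>] by blast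
    then show ?thesis
      by (rule vrep_extend[rotated 3, where b = False])
        (use not_subs_child(4)[of A B] in auto)
  qed
qed

lemma vrep_choose2:
  assumes "nms A \<inter> nms B = {}" "a \<in> nms A" "b \<in> nms B"
  obtains \<sigma>' where "\<And>U. U \<notin> subs A \<Longrightarrow> U \<notin> subs B \<Longrightarrow> \<sigma>' U = \<sigma> U" "vrep \<sigma>' A = a" "vrep \<sigma>' B = b"
proof -
  obtain \<sigma>1 where 1: "\<forall>U. U \<notin> subs A \<longrightarrow> \<sigma>1 U = \<sigma> U" "vrep \<sigma>1 A = a"
    using vrep_choose[OF assms(2), of \<sigma>] by blast
  obtain \<sigma>2 where 2: "\<forall>U. U \<notin> subs B \<longrightarrow> \<sigma>2 U = \<sigma>1 U" "vrep \<sigma>2 B = b"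
    using vrep_choose[OF assms(3), of \<sigma>1] by blast
  have "vrep \<sigma>2 A = vrep \<sigma>1 A"
    by (rule vrep_cong) (use 2(1) subs_disjoint[OF assms(1)] in blast)
  then show ?thesis using 1 2 by (intro that[of \<sigma>2]) auto
qed

text \<open>The subtree \<open>t\<close> influences its surroundings only through its own
  representative. Either the choices below \<open>C\<close> never lead into \<open>t\<close>, or
  they hand on whatever represents \<open>t\<close>.\<close>

lemma vrep_agree:
  assumes "dnames C" "t \<in> subs C \<or> nms C \<inter> nms t = {}" "\<And>U. U \<notin> subs t \<Longrightarrow> \<sigma> U = \<sigma>' U"
  shows "vrep \<sigma> C = vrep \<sigma>' C \<or> vrep \<sigma> C = vrep \<sigma> t \<and> vrep \<sigma>' C = vrep \<sigma>' t"
  using assms(1,2)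
proof (induction C)
  case (Leaf l)
  then show ?case by auto
next
  case (Tens A B)
  have dAB: "nms A \<inter> nms B = {}" and d: "dnames A" "dnames B"
    using Tens.prems(1) unfolding dnames_Tens by blast+
  show ?case
  proof (cases "t = Tens A B")
    case False
    have "t \<in> subs A \<or> nms A \<inter> nms t = {}" "t \<in> subs B \<or> nms B \<inter> nms t = {}"
      using Tens.prems(2) False subs_names[of t A] subs_names[of t B] dAB by auto
    with Tens.IH d have
      "vrep \<sigma> A = vrep \<sigma>' A \<or> vrep \<sigma> A = vrep \<sigma> t \<and> vrep \<sigma>' A = vrep \<sigma>' t"
      "vrep \<sigma> B = vrep \<sigma>' B \<or> vrep \<sigma> B = vrep \<sigma> t \<and> vrep \<sigma>' B = vrep \<sigma>' t" by blast+
    moreover have "Tens A B \<notin> subs t"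
    proof
      assume "Tens A B \<in> subs t"
      then have "nms (Tens A B) \<subseteq> nms t" "size (Tens A B) < size t"
        using subs_names[of "Tens A B" t] subs_size[of "Tens A B" t] False by auto
      then show False
        using Tens.prems(2) subs_size[of t "Tens A B"] nms_nonempty[of A]
        by (auto simp: Int_Un_distrib2 Int_absorb2)
    qed
    ultimately show ?thesis using assms(3)[of "Tens A B"] by auto
  qed simp
next
  case (Parr A B)
  have dAB: "nms A \<inter> nms B = {}" and d: "dnames A" "dnames B"
    using Parr.prems(1) unfolding dnames_Parr by blast+
  show ?case
  proof (cases "t = Parr A B")
    case False
    have "t \<in> subs A \<or> nms A \<inter> nms t = {}" "t \<in> subs B \<or> nms B \<inter> nms t = {}"
      using Parr.prems(2) False subs_names[of t A] subs_names[of t B] dAB by auto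
    with Parr.IH d have
      "vrep \<sigma> A = vrep \<sigma>' A \<or> vrep \<sigma> A = vrep \<sigma> t \<and> vrep \<sigma>' A = vrep \<sigma>' t"
      "vrep \<sigma> B = vrep \<sigma>' B \<or> vrep \<sigma> B = vrep \<sigma> t \<and> vrep \<sigma>' B = vrep \<sigma>' t" by blast+
    moreover have "Parr A B \<notin> subs t"
    proof
      assume "Parr A B \<in> subs t"
      then have "nms (Parr A B) \<subseteq> nms t" "size (Parr A B) < size t"
        using subs_names[of "Parr A B" t] subs_size[of "Parr A B" t] False by auto
      then show False
        using Parr.prems(2) subs_size[of t "Parr A B"] nms_nonempty[of A]
        by (auto simp: Int_Un_distrib2 Int_absorb2)
    qed
    ultimately show ?thesis using assms(3)[of "Parr A B"] by auto
  qed simp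
qed

lemma tedge_comp: "tedge (m \<circ> f) \<sigma> s = m ` tedge f \<sigma> s"
  by (cases s) auto

section \<open>A tensor that can be contracted\<close>

text \<open>\<open>S\<close> is the set of tensors still to be performed, all other nodes are treated as pars, and \<open>f\<close> maps
  a leaf to the block that contains it.\<close>
definition tight :: "('v, 'a) tree set \<Rightarrow> ('v \<Rightarrow> 'b) \<Rightarrow> 'b set \<Rightarrow> bool" where
  "tight S f V \<longleftrightarrow> finite S \<and> finite V \<and> card V = card S + 1 \<and>
     (\<forall>s\<in>S. (\<exists>A B. s = Tens A B) \<and> dnames s \<and> f ` nms s \<subseteq> V) \<and>
     (\<forall>s\<in>S. \<forall>t\<in>S. s \<in> subs t \<or> t \<in> subs s \<or> nms s \<inter> nms t = {}) \<and>
     (\<forall>\<sigma>. spans (tedge f \<sigma> ` S) V)"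

definition minimal :: "('v, 'a) tree set \<Rightarrow> ('v, 'a) tree \<Rightarrow> bool" where
  "minimal S t \<longleftrightarrow> t \<in> S \<and> (\<forall>s\<in>S. s \<in> subs t \<longrightarrow> s = t)"

lemma tightD:
  assumes "tight S f V"
  shows "finite S" "finite V" "card V = card S + 1"
    "\<And>s. s \<in> S \<Longrightarrow> \<exists>A B. s = Tens A B" "\<And>s. s \<in> S \<Longrightarrow> dnames s" "\<And>s. s \<in> S \<Longrightarrow> f ` nms s \<subseteq> V"
    "\<And>s t. s \<in> S \<Longrightarrow> t \<in> S \<Longrightarrow> s \<in> subs t \<or> t \<in> subs s \<or> nms s \<inter> nms t = {}"
    "\<And>\<sigma>. spans (tedge f \<sigma> ` S) V"
  using assms unfolding tight_def by blast+

lemma tight_indep: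
  assumes "tight S f V" "s \<in> S" "tedge f \<sigma> s = {u, v}"
  shows "\<not> conn (tedge f \<sigma> ` (S - {s})) u v"
proof (rule tight_spans_not_conn)
  show "finite (tedge f \<sigma> ` (S - {s}))" "finite V" using assms(1) unfolding tight_def by auto
  have "insert {u, v} (tedge f \<sigma> ` (S - {s})) = tedge f \<sigma> ` S" using assms(2,3) by auto
  then show "spans (insert {u, v} (tedge f \<sigma> ` (S - {s}))) V"
    using assms(1) unfolding tight_def by simp
  have "card (tedge f \<sigma> ` (S - {s})) \<le> card (S - {s})"
    using assms(1) unfolding tight_def by (intro card_image_le) simp
  also have "card (S - {s}) < card S"
    using assms(1,2) unfolding tight_def by (intro card_Diff1_less) auto
  finally show "card (tedge f \<sigma> ` (S - {s})) + 1 < card V"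
    using assms(1) unfolding tight_def by simp
qed

lemma tight_sides:
  assumes "tight S f V" "Tens A B \<in> S"
  shows "nms A \<inter> nms B = {}" "dnames A" "dnames B"
  using tightD(5)[OF assms] unfolding dnames_Tens by blast+

text \<open>A block occurring on both sides would make the tensor contribute a loop in some
  switching, and a loop is redundant.\<close>

lemma tight_no_loop:
  assumes "tight S f V" "Tens A B \<in> S"
  shows "f ` nms A \<inter> f ` nms B = {}"
proof (rule equals0I)
  fix z assume "z \<in> f ` nms A \<inter> f ` nms B"
  then obtain a b where ab: "a \<in> nms A" "b \<in> nms B" "f a = z" "f b = z" by auto
  obtain \<sigma> where "vrep \<sigma> A = a" "vrep \<sigma> B = b"
    using vrep_choose2[OF tight_sides(1)[OF assms] ab(1,2), of "\<lambda>_. True"] by blast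
  then have "tedge f \<sigma> (Tens A B) = {z, z}" using ab by simp
  from tight_indep[OF assms this] show False by simp
qed

text \<open>By minimality \<open>s\<close> is not inside \<open>t\<close>, so a change of the
  switching inside \<open>t\<close> reaches the edge of \<open>s\<close> only if that edge ends at
  the representative of \<open>t\<close>.\<close>

lemma tight_agree:
  assumes "tight S f V" "minimal S t" "s \<in> S - {t}" "\<And>U. U \<notin> subs t \<Longrightarrow> \<sigma> U = \<sigma>' U"
    "vrep \<sigma> t = vrep \<sigma>' t \<or> f (vrep \<sigma> t) \<notin> tedge f \<sigma> s"
  shows "tedge f \<sigma> s = tedge f \<sigma>' s"
proof -
  have s: "s \<in> S" "t \<in> S" "s \<noteq> t" "s \<notin> subs t" using assms(2,3) unfolding minimal_def by auto
  obtain C D where C: "s = Tens C D" using tightD(4)[OF assms(1) s(1)] by blast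
  note d = tight_sides[OF assms(1) s(1)[unfolded C]]
  have "t \<in> subs s \<or> nms s \<inter> nms t = {}" using tightD(7)[OF assms(1) s(1,2)] s(4) by blast
  then have t: "t \<in> subs C \<or> nms C \<inter> nms t = {}" "t \<in> subs D \<or> nms D \<inter> nms t = {}"
    using s(3) d(1) subs_names[of t C] subs_names[of t D] unfolding C by auto
  have "vrep \<sigma> C = vrep \<sigma>' C \<or> vrep \<sigma> C = vrep \<sigma> t \<and> vrep \<sigma>' C = vrep \<sigma>' t"
    using d(2) t(1) assms(4) by (rule vrep_agree)
  moreover have "vrep \<sigma> D = vrep \<sigma>' D \<or> vrep \<sigma> D = vrep \<sigma> t \<and> vrep \<sigma>' D = vrep \<sigma>' t"
    using d(3) t(2) assms(4) by (rule vrep_agree)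
  ultimately show ?thesis using assms(5) unfolding C by auto
qed

text \<open>The edge of \<open>t\<close> may be fixed to \<open>{f x, f w}\<close> while \<open>t\<close> keeps an arbitrary representative, i.e. \<open>t\<close> may be
  treated as a par.  Representing \<open>t\<close> by \<open>w\<close> shows that \<open>x\<close> and the representative of \<open>C\<close> are connected by a path
  that avoids \<open>w\<close>, hence also without the edges that depend on the representative of \<open>t\<close>.\<close>
lemma tight_exchange:
  assumes T: "tight S f V" and min: "minimal S t"
    and t: "t = Tens C D \<and> side \<or> t = Tens D C \<and> \<not> side"
    and x: "x \<in> nms C" and w: "w \<in> nms D" and \<sigma>: "\<sigma> t = side"
  shows "spans (insert {f x, f w} (tedge f \<sigma> ` (S - {t}))) V"
proof -
  have tS: "t \<in> S" using min unfolding minimal_def by simp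
  have CD: "nms C \<inter> nms D = {}"
    using t tight_sides(1)[OF T, of C D] tight_sides(1)[OF T, of D C] tS by blast
  have sub: "subs C \<subseteq> subs t" "subs D \<subseteq> subs t" "t \<notin> subs C" "t \<notin> subs D"
    using t not_subs_child(1,2) by auto
  have V: "f ` nms C \<subseteq> V" "f ` nms D \<subseteq> V"
  proof -
    have "f ` nms t \<subseteq> V" using tightD(6)[OF T tS] .
    then show "f ` nms C \<subseteq> V" "f ` nms D \<subseteq> V" using t by auto
  qed
  have vt: "vrep \<sigma> t = (if \<sigma> t = side then vrep \<sigma> C else vrep \<sigma> D)" for \<sigma>
    using t by auto
  have et: "tedge f \<sigma> t = {f (vrep \<sigma> C), f (vrep \<sigma> D)}" for \<sigma>
    using t by auto
  have sp: "spans (insert {f (vrep \<sigma> C), f (vrep \<sigma> D)} (tedge f \<sigma> ` (S - {t}))) V" for \<sigma>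
  proof -
    have "insert {f (vrep \<sigma> C), f (vrep \<sigma> D)} (tedge f \<sigma> ` (S - {t})) = tedge f \<sigma> ` S"
      using tS et[of \<sigma>] by auto
    then show ?thesis using T unfolding tight_def by simp
  qed
  define a where "a = vrep \<sigma> C"
  have aC: "a \<in> nms C" unfolding a_def by (rule vrep_in_names)
  \<comment> \<open>The switchings agree outside \<open>t\<close>. In \<sigma>1 the tensor is still
    represented by \<open>a\<close>, but its edge joins \<open>a\<close> and \<open>w\<close>;
    \<sigma>2 keeps that edge and lets \<open>w\<close> represent \<open>t\<close>; \<sigma>3
    changes the edge to join \<open>x\<close> and \<open>w\<close>, with \<open>w\<close> still the
    representative.\<close>
  obtain \<sigma>1 where s1: "\<And>U. U \<notin> subs C \<Longrightarrow> U \<notin> subs D \<Longrightarrow> \<sigma>1 U = \<sigma> U" "vrep \<sigma>1 C = a" "vrep \<sigma>1 D = w"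
    using vrep_choose2[OF CD aC w, of \<sigma>] by blast
  have s1t: "\<sigma>1 t = side" using s1(1) sub \<sigma> by simp
  define \<sigma>2 where "\<sigma>2 = \<sigma>1(t := \<not> side)"
  have s2: "vrep \<sigma>2 C = a" "vrep \<sigma>2 D = w"
    using sub(3,4) s1(2,3) unfolding \<sigma>2_def by simp_all
  obtain \<sigma>3 where s3: "\<And>U. U \<notin> subs C \<Longrightarrow> U \<notin> subs D \<Longrightarrow> \<sigma>3 U = \<sigma>2 U" "vrep \<sigma>3 C = x" "vrep \<sigma>3 D = w"
    using vrep_choose2[OF CD x w, of \<sigma>2] by blast
  have s3t: "\<sigma>3 t = (\<not> side)" using s3(1) sub unfolding \<sigma>2_def by simp
  let ?Ea = "tedge f \<sigma>1 ` (S - {t})" and ?Ew = "tedge f \<sigma>2 ` (S - {t})"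
  have Ea: "tedge f \<sigma> ` (S - {t}) = ?Ea"
  proof (rule image_cong[OF refl], rule tight_agree[OF T min], assumption)
    fix s U
    show "U \<notin> subs t \<Longrightarrow> \<sigma> U = \<sigma>1 U" using s1(1) sub(1,2) by blast
    show "vrep \<sigma> t = vrep \<sigma>1 t \<or> f (vrep \<sigma> t) \<notin> tedge f \<sigma> s"
      using vt \<sigma> s1t s1(2) a_def by simp
  qed
  have Ew: "tedge f \<sigma>3 ` (S - {t}) = ?Ew"
  proof (rule image_cong[OF refl], rule tight_agree[OF T min], assumption)
    fix s U
    show "U \<notin> subs t \<Longrightarrow> \<sigma>3 U = \<sigma>2 U" using s3(1) sub(1,2) by blast
    show "vrep \<sigma>3 t = vrep \<sigma>2 t \<or> f (vrep \<sigma>3 t) \<notin> tedge f \<sigma>3 s"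
      using vt s3t s3(3) s2(2) unfolding \<sigma>2_def by simp
  qed
  have nw: "\<not> conn ?Ew (f a) (f w)"
    using tight_indep[OF T tS, of \<sigma>2 "f a" "f w"] et[of \<sigma>2] s2 by simp
  have "conn (insert {f x, f w} ?Ew) (f a) (f x)"
    using sp[of \<sigma>3] V aC x unfolding s3 Ew spans_def by blast
  from conn_insert_cases[OF this] nw have ax: "conn ?Ew (f a) (f x)" by blast
  have "f x \<in> {z. conn ?Ea (f a) z \<and> conn ?Ew (f a) z}"
  proof (rule conn_closed[OF ax])
    fix p q assume pq: "{p, q} \<in> ?Ew" and p: "p \<in> {z. conn ?Ea (f a) z \<and> conn ?Ew (f a) z}"
    have q: "conn ?Ew (f a) q" using p conn_edge[OF pq] by (auto intro: conn_trans)
    have fw: "f w \<notin> {p, q}" using p q nw by auto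
    obtain s where s: "s \<in> S - {t}" "{p, q} = tedge f \<sigma>2 s" using pq by blast
    have "tedge f \<sigma>2 s = tedge f \<sigma>1 s"
    proof (rule tight_agree[OF T min s(1)])
      show "vrep \<sigma>2 t = vrep \<sigma>1 t \<or> f (vrep \<sigma>2 t) \<notin> tedge f \<sigma>2 s"
        using vt[of \<sigma>2] s2(2) fw s(2) unfolding \<sigma>2_def by simp
    qed (auto simp: \<sigma>2_def)
    then have "conn ?Ea p q" using s by (intro conn_edge) auto
    then show "q \<in> {z. conn ?Ea (f a) z \<and> conn ?Ew (f a) z}"
      using p q by (auto intro: conn_trans)
  qed simp
  then have xa: "conn ?Ea (f x) (f a)" by (auto intro: conn_sym)
  have "spans (insert {f a, f w} ?Ea) V" using sp[of \<sigma>1] s1(2,3) by simp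
  from spans_replace[OF this xa] show ?thesis unfolding Ea .
qed

text \<open>Once \<open>t\<close> is a par with a fixed edge beside it, contracting this edge
  removes one vertex and one tensor. The two possible values of the switching at \<open>t\<close>
  are covered by \<open>tight_exchange\<close> with the sides in either order.\<close>

lemma tight_contract:
  assumes T: "tight S f V" and min: "minimal S (Tens A B)"
    and x: "x \<in> nms A" and w: "w \<in> nms B"
    and m: "m = (\<lambda>z. if z = f w then f x else z)"
  shows "tight (S - {Tens A B}) (m \<circ> f) (V - {f w})"
proof -
  let ?t = "Tens A B"
  have tS: "?t \<in> S" using min unfolding minimal_def by simp
  have ne: "f x \<noteq> f w" using tight_no_loop[OF T tS] x w by blast
  have V: "f x \<in> V" "f w \<in> V" using tightD(6)[OF T tS] x w by auto
  have ds: "spans (insert {f x, f w} (tedge f \<sigma> ` (S - {?t}))) V" for \<sigma>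
  proof (cases "\<sigma> ?t")
    case True
    then show ?thesis using tight_exchange[OF T min, of A B True x w \<sigma>] x w by simp
  next
    case False
    then show ?thesis
      using tight_exchange[OF T min, of B A False w x \<sigma>] x w by (simp add: insert_commute)
  qed
  have sp: "spans (tedge (m \<circ> f) \<sigma> ` (S - {?t})) (V - {f w})" for \<sigma>
    unfolding spans_def
  proof (intro ballI)
    fix p q assume pq: "p \<in> V - {f w}" "q \<in> V - {f w}"
    then have "conn (insert {f x, f w} (tedge f \<sigma> ` (S - {?t}))) p q"
      using ds[of \<sigma>] unfolding spans_def by blast
    then have "conn (tedge (m \<circ> f) \<sigma> ` (S - {?t})) (m p) (m q)"
    proof (rule conn_map)
      fix a b assume "{a, b} \<in> insert {f x, f w} (tedge f \<sigma> ` (S - {?t}))"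
      then consider "{a, b} = {f x, f w}" | s where "s \<in> S - {?t}" "{a, b} = tedge f \<sigma> s" by blast
      then show "conn (tedge (m \<circ> f) \<sigma> ` (S - {?t})) (m a) (m b)"
      proof cases
        case 1
        then have "m a = m b" using m by (auto simp: doubleton_eq_iff)
        then show ?thesis by simp
      next
        case 2
        then have "{m a, m b} = tedge (m \<circ> f) \<sigma> s" unfolding tedge_comp 2(2)[symmetric] by simp
        then show ?thesis using 2(1) by (intro conn_edge) auto
      qed
    qed
    then show "conn (tedge (m \<circ> f) \<sigma> ` (S - {?t})) p q" using pq m by simp
  qed
  have "m z \<in> V - {f w}" if "z \<in> V" for z using that V ne m by simp
  then have "(m \<circ> f) ` nms s \<subseteq> V - {f w}" if "s \<in> S" for s
    using tightD(6)[OF T that] by auto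
  moreover have "card (V - {f w}) = card (S - {?t}) + 1"
    using card_Suc_Diff1[OF tightD(2)[OF T] V(2)] card_Suc_Diff1[OF tightD(1)[OF T] tS] tightD(3)[OF T]
    by simp
  ultimately show ?thesis using T sp unfolding tight_def by simp
qed

section \<open>Existence of a contractible tensor by double counting\<close>

definition uniform :: "('v \<Rightarrow> 'b) \<Rightarrow> ('v, 'a) tree \<Rightarrow> bool" where
  "uniform f t \<longleftrightarrow> (\<exists>A B a b. t = Tens A B \<and> f ` nms A = {a} \<and> f ` nms B = {b})"

text \<open>For distinct leaf names these are the edges that the tensor contributes in the various
  switchings.\<close>

fun pairs :: "('v \<Rightarrow> 'b) \<Rightarrow> ('v, 'a) tree \<Rightarrow> 'b set set" where
  "pairs f (Tens A B) = (\<lambda>(a, b). {a, b}) ` (f ` nms A \<times> f ` nms B)"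
| "pairs f (Leaf l) = {}"
| "pairs f (Parr A B) = {}"

text \<open>The shape of a tensor that fails to be uniform but becomes so when the two blocks in
  \<open>e\<close> are identified.\<close>

definition fat :: "('v \<Rightarrow> 'b) \<Rightarrow> ('v, 'a) tree \<Rightarrow> 'b set \<Rightarrow> bool" where
  "fat f t e \<longleftrightarrow> card e = 2 \<and> (\<exists>C D d. (t = Tens C D \<or> t = Tens D C) \<and> f ` nms C = e \<and> f ` nms D = {d})"

text \<open>Exactly one side of the tensor has two blocks, so \<open>e\<close> can be read off. This
  makes the map from pairs to tensors injective.\<close>

lemma fat_unique:
  assumes "fat f t e" "fat f t e'"
  shows "e = e'"
proof -
  obtain C D d where 1: "t = Tens C D \<or> t = Tens D C" "f ` nms C = e" "f ` nms D = {d}" "card e = 2"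
    using assms(1) unfolding fat_def by blast
  obtain C' D' d' where 2: "t = Tens C' D' \<or> t = Tens D' C'" "f ` nms C' = e'" "f ` nms D' = {d'}" "card e' = 2"
    using assms(2) unfolding fat_def by blast
  have "C \<noteq> D'" "C' \<noteq> D" using 1 2 by auto
  then show ?thesis using 1(1,2) 2(1,2) by auto
qed

lemma pairs_card:
  assumes "\<not> uniform f (Tens A B)"
  shows "2 \<le> card (pairs f (Tens A B))"
proof -
  have two: "\<exists>z1\<in>X. \<exists>z2\<in>X. z1 \<noteq> z2" if "X \<noteq> {}" "\<nexists>a. X = {a}" for X :: "'b set"
    using that by blast
  have "\<exists>e1\<in>pairs f (Tens A B). \<exists>e2\<in>pairs f (Tens A B). e1 \<noteq> e2"
  proof (cases "\<exists>a. f ` nms A = {a}")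
    case True
    then have "\<nexists>b. f ` nms B = {b}" using assms unfolding uniform_def by blast
    then obtain b b' where b: "b \<in> f ` nms B" "b' \<in> f ` nms B" "b \<noteq> b'" using two[of "f ` nms B"] by auto
    obtain a where a: "a \<in> f ` nms A" using nms_nonempty[of A] by blast
    have "{a, b} \<in> pairs f (Tens A B)" "{a, b'} \<in> pairs f (Tens A B)" using a b(1,2) by force+
    moreover have "{a, b} \<noteq> {a, b'}" using b(3) by (auto simp: doubleton_eq_iff)
    ultimately show ?thesis by (intro bexI)
  next
    case False
    then obtain a a' where a: "a \<in> f ` nms A" "a' \<in> f ` nms A" "a \<noteq> a'" using two[of "f ` nms A"] by auto
    obtain b where b: "b \<in> f ` nms B" using nms_nonempty[of B] by blast
    have "{a, b} \<in> pairs f (Tens A B)" "{a', b} \<in> pairs f (Tens A B)" using b a(1,2) by force+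
    moreover have "{a, b} \<noteq> {a', b}" using a(3) by (auto simp: doubleton_eq_iff)
    ultimately show ?thesis by (intro bexI)
  qed
  then obtain e1 e2 where e: "{e1, e2} \<subseteq> pairs f (Tens A B)" "e1 \<noteq> e2" by blast
  have "finite (pairs f (Tens A B))" by simp
  from card_mono[OF this e(1)] e(2) show ?thesis by simp
qed

lemma pairs_disjoint:
  assumes T: "tight S f V" and min: "minimal S t" "minimal S t'" and ne: "t \<noteq> t'"
  shows "pairs f t \<inter> pairs f t' = {}"
proof (rule equals0I)
  fix e assume e: "e \<in> pairs f t \<inter> pairs f t'"
  have tS: "t \<in> S" "t' \<in> S" using min unfolding minimal_def by auto
  obtain A B C D where t: "t = Tens A B" "t' = Tens C D" using tightD(4)[OF T] tS by metis
  have "t \<notin> subs t'" "t' \<notin> subs t" using min ne tS unfolding minimal_def by blast+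
  then have disj: "nms t \<inter> nms t' = {}" using tightD(7)[OF T tS] by blast
  obtain a b where ab: "a \<in> nms A" "b \<in> nms B" "e = {f a, f b}" using e t by auto
  obtain c d where cd: "c \<in> nms C" "d \<in> nms D" "e = {f c, f d}" using e t by auto
  obtain \<sigma>1 where s1: "vrep \<sigma>1 A = a" "vrep \<sigma>1 B = b"
    using vrep_choose2[OF tight_sides(1)[OF T tS(1)[unfolded t]] ab(1,2), of "\<lambda>_. True"] by blast
  obtain \<sigma>2 where s2: "\<And>U. U \<notin> subs C \<Longrightarrow> U \<notin> subs D \<Longrightarrow> \<sigma>2 U = \<sigma>1 U" "vrep \<sigma>2 C = c" "vrep \<sigma>2 D = d"
    using vrep_choose2[OF tight_sides(1)[OF T tS(2)[unfolded t]] cd(1,2), of \<sigma>1] by blast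
  have "subs A \<inter> subs C = {}" "subs A \<inter> subs D = {}" "subs B \<inter> subs C = {}" "subs B \<inter> subs D = {}"
    using disj unfolding t by (auto intro!: subs_disjoint)
  then have "vrep \<sigma>2 A = a" "vrep \<sigma>2 B = b"
    using s1 vrep_cong[of A \<sigma>2 \<sigma>1] vrep_cong[of B \<sigma>2 \<sigma>1] s2(1) by blast+
  then have "tedge f \<sigma>2 t = e" "tedge f \<sigma>2 t' = e" using s2 ab(3) cd(3) t by auto
  then have "e \<in> tedge f \<sigma>2 ` (S - {t'})" using tS(1) ne by blast
  then have "conn (tedge f \<sigma>2 ` (S - {t'})) (f c) (f d)" unfolding cd(3) by (rule conn_edge)
  moreover have "tedge f \<sigma>2 t' = {f c, f d}" using \<open>tedge f \<sigma>2 t' = e\<close> cd(3) by simp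
  ultimately show False using tight_indep[OF T tS(2)] by blast
qed

lemma minimal_ex:
  assumes "finite S" "S \<noteq> {}"
  shows "\<exists>t. minimal S t"
proof -
  obtain t where t: "t \<in> S" "\<forall>s\<in>S. size t \<le> size s"
    using assms ex_min_if_finite[of "size ` S"] by (auto simp: not_less)
  then show ?thesis unfolding minimal_def using subs_size by (meson not_less)
qed

lemma image_merge_single:
  assumes "(\<lambda>z. if z = q then p else z) ` X = {c}"
  shows "(\<exists>a. X = {a}) \<or> X = {p, q}"
proof -
  have c: "(if z = q then p else z) = c" if "z \<in> X" for z using assms that by blast
  have "X \<noteq> {}" using assms by blast
  show ?thesis
  proof (cases "q \<in> X")
    case True
    then have "c = p" using c[of q] by simp
    then have "X \<subseteq> {p, q}" using c by (metis insertCI subsetI)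
    then show ?thesis using True by blast
  next
    case False
    then have "X = {c}" using c \<open>X \<noteq> {}\<close> by (metis insertI1 is_singletonI' is_singleton_the_elem singletonD)
    then show ?thesis by blast
  qed
qed

theorem uniform_minimal_tensor:
  fixes f :: "'v \<Rightarrow> 'b"
  assumes "tight S f V" "S \<noteq> {}"
  shows "\<exists>t. minimal S t \<and> uniform f t"
  using assms
proof (induction "card S" arbitrary: S f V rule: less_induct)
  case less
  note T = less.prems(1)
  show ?case
  proof (rule ccontr)
    assume no: "\<not> ?thesis"
    define M where "M = {t. minimal S t}"
    have MS: "M \<subseteq> S" unfolding M_def minimal_def by blast
    then have finM: "finite M" using tightD(1)[OF T] by (rule finite_subset)
    have M0: "M \<noteq> {}" using minimal_ex[OF tightD(1)[OF T] less.prems(2)] unfolding M_def by blast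
    have ex: "\<exists>t'\<in>M. fat f t' e" if t: "t \<in> M" and e: "e \<in> pairs f t" for t e
    proof -
      have min: "minimal S t" and tS: "t \<in> S" using t MS unfolding M_def by auto
      obtain A B where AB: "t = Tens A B" using tightD(4)[OF T tS] by blast
      obtain x w where xw: "x \<in> nms A" "w \<in> nms B" "e = {f x, f w}" using e AB by auto
      note noloop = tight_no_loop[OF T tS[unfolded AB]]
      have ne: "f x \<noteq> f w" using noloop xw by blast
      define m where "m = (\<lambda>z. if z = f w then f x else z)"
      have T': "tight (S - {t}) (m \<circ> f) (V - {f w})"
        using tight_contract[OF T min[unfolded AB] xw(1,2) m_def] AB by simp
      \<comment> \<open>The sides of \<open>t\<close> have no block in common, so if only these two
        blocks occur in \<open>t\<close>, each side has one and \<open>t\<close> is already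
        uniform.\<close>
      have small: False if sub: "f ` nms t \<subseteq> {f x, f w}"
      proof -
        have gen: "X = {p} \<and> Y = {q}" if "p \<in> X" "q \<in> Y" "X \<union> Y \<subseteq> {p, q}" "X \<inter> Y = {}"
          for p q :: 'b and X Y using that by blast
        have "f ` nms A = {f x} \<and> f ` nms B = {f w}"
        proof (rule gen)
          show "f ` nms A \<union> f ` nms B \<subseteq> {f x, f w}" using sub AB by (simp add: image_Un)
        qed (use xw noloop in auto)
        then have "uniform f t" using AB unfolding uniform_def by blast
        then show False using no min by blast
      qed
      \<comment> \<open>If \<open>t\<close> were the only tensor, there would be just two
        blocks.\<close>
      have "S - {t} \<noteq> {}"
      proof
        assume "S - {t} = {}"
        then have "card V = 2" using tightD(3)[OF T] tS
          by (metis Diff_eq_empty_iff card_1_singleton_iff one_add_one subset_singleton_iff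
              empty_iff One_nat_def)
        moreover have fV: "f ` nms t \<subseteq> V" by (rule tightD(6)[OF T tS])
        then have "{f x, f w} \<subseteq> V" using xw AB by auto
        ultimately have "{f x, f w} = V"
          using ne tightD(2)[OF T] by (intro card_subset_eq) auto
        then show False using small fV by blast
      qed
      moreover have "card (S - {t}) < card S" using tightD(1)[OF T] tS by (rule card_Diff1_less)
      ultimately obtain t' where t': "minimal (S - {t}) t'" "uniform (m \<circ> f) t'"
        using less.hyps[OF _ T'] by blast
      obtain C D c d where CD: "t' = Tens C D" "m ` f ` nms C = {c}" "m ` f ` nms D = {d}"
        using t'(2) unfolding uniform_def by (auto simp: image_comp)
      have t'S: "t' \<in> S" "t' \<noteq> t" using t'(1) unfolding minimal_def by auto
      \<comment> \<open>The tensor found after the contraction is minimal only among the others. If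
        it had \<open>t\<close> above it, the side containing \<open>t\<close> would have exactly
        the two merged blocks, and so \<open>t\<close> would be uniform.\<close>
      have noC: "t \<notin> subs X" if X: "m ` f ` nms X = {z}" for X z
      proof
        assume "t \<in> subs X"
        then have sub: "nms t \<subseteq> nms X" by (rule subs_names)
        then have "f x \<in> f ` nms X" "f w \<in> f ` nms X" using xw AB by auto
        moreover have "(\<exists>a. f ` nms X = {a}) \<or> f ` nms X = {f x, f w}"
          using X unfolding m_def by (rule image_merge_single)
        ultimately have "f ` nms X = {f x, f w}" using ne by (metis singletonD)
        then show False using small sub by blast
      qed
      have "t \<notin> subs t'" using noC[OF CD(2)] noC[OF CD(3)] t'S(2) CD(1) by auto
      then have min': "minimal S t'" using t'(1) unfolding minimal_def by blast
      have cd: "f ` nms C \<inter> f ` nms D = {}" using tight_no_loop[OF T] t'S(1) CD(1) by blast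
      have C: "(\<exists>a. f ` nms C = {a}) \<or> f ` nms C = {f x, f w}"
        using CD(2) unfolding m_def by (rule image_merge_single)
      have D: "(\<exists>a. f ` nms D = {a}) \<or> f ` nms D = {f x, f w}"
        using CD(3) unfolding m_def by (rule image_merge_single)
      \<comment> \<open>Not uniform before the merge but uniform after it: one side consists of
        exactly the merged blocks, and not both, as the sides are disjoint.\<close>
      have "\<not> uniform f t'" using no min' by blast
      then have "\<not> ((\<exists>a. f ` nms C = {a}) \<and> (\<exists>a. f ` nms D = {a}))"
        using CD(1) unfolding uniform_def by blast
      then have "f ` nms C = e \<and> (\<exists>d. f ` nms D = {d}) \<or> f ` nms D = e \<and> (\<exists>d. f ` nms C = {d})"
        using C D cd xw(3) by auto
      moreover have "card e = 2" using ne xw(3) by simp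
      ultimately have "fat f t' e" unfolding fat_def using CD(1) by blast
      then show ?thesis using min' unfolding M_def by blast
    qed
    define PP where "PP = (\<Union>t\<in>M. pairs f t)"
    have "\<forall>e\<in>PP. \<exists>t'. t' \<in> M \<and> fat f t' e" using ex unfolding PP_def by blast
    then obtain g where g: "\<forall>e\<in>PP. g e \<in> M \<and> fat f (g e) e" by (rule bchoice[THEN exE])
    have "inj_on g PP" using g fat_unique unfolding inj_on_def by metis
    moreover have "g ` PP \<subseteq> M" using g by blast
    ultimately have le: "card PP \<le> card M" using finM by (rule card_inj_on_le)
    have finp: "finite (pairs f t)" for t :: "('v, 'c) tree" by (cases t) auto
    have "card PP = (\<Sum>t\<in>M. card (pairs f t))"
      unfolding PP_def
      by (rule card_UN_disjoint) (use finM finp pairs_disjoint[OF T] in \<open>auto simp: M_def\<close>)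
    also have "\<dots> \<ge> (\<Sum>t\<in>M. 2)"
    proof (rule sum_mono)
      fix t assume "t \<in> M"
      then have "minimal S t" "t \<in> S" using MS unfolding M_def by auto
      moreover obtain A B where "t = Tens A B" using tightD(4)[OF T \<open>t \<in> S\<close>] by blast
      ultimately show "2 \<le> card (pairs f t)" using no pairs_card[of f A B] by blast
    qed
    finally have "2 * card M \<le> card PP" by simp
    moreover have "card M > 0" using finM M0 by (simp add: card_gt_0_iff)
    ultimately show False using le by simp
  qed
qed

section \<open>Sequentialisation\<close>

text \<open>The formulas proved so far once the tensors outside \<open>S\<close> have been performed; par rules are applied
  only when the result is needed as a premise of a tensor rule.\<close>
fun frontier :: "('v, 'a) tree set \<Rightarrow> ('v, 'a) tree \<Rightarrow> ('v, 'a) tree list" where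
  "frontier S (Leaf l) = [Leaf l]"
| "frontier S (Tens A B) = (if Tens A B \<in> S then frontier S A @ frontier S B else [Tens A B])"
| "frontier S (Parr A B) = frontier S A @ frontier S B"

abbreviation frontiers :: "('v, 'a) tree set \<Rightarrow> ('v, 'a) tree list \<Rightarrow> ('v, 'a) tree list" where
  "frontiers S \<Gamma> \<equiv> concat (map (frontier S) \<Gamma>)"

definition label_of :: "('v \<Rightarrow> 'b) \<Rightarrow> ('v, 'a) tree \<Rightarrow> 'b" where
  "label_of f T = f (fst (hd (leaves T)))"

lemma label_of_in: "label_of f T \<in> f ` nms T"
  unfolding label_of_def nms_def by simp

lemma label_of_comp: "label_of (m \<circ> f) T = m (label_of f T)"
  unfolding label_of_def by simp

lemma frontier_subs: "U \<in> set (frontier S T) \<Longrightarrow> U \<in> subs T"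
  by (induction T) (auto split: if_splits)

lemma frontier_diff: "t \<notin> subs T \<Longrightarrow> frontier (S - {t}) T = frontier S T"
  by (induction T) auto

text \<open>The deferred par rules are performed here: with no pending tensor inside
  \<open>A\<close>, its frontier differs from \<open>A\<close> by pars alone.\<close>

lemma seq_graph_close:
  "(\<And>s. s \<in> subs A \<Longrightarrow> s \<notin> S) \<Longrightarrow> seq_graph P (frontier S A @ \<Sigma>) \<Longrightarrow> seq_graph P (A # \<Sigma>)"
proof (induction A arbitrary: \<Sigma>)
  case (Parr A B)
  have "seq_graph P (frontier S A @ (frontier S B @ \<Sigma>))" using Parr.prems(2) by simp
  then have "seq_graph P (A # (frontier S B @ \<Sigma>))" using Parr.prems(1) by (intro Parr.IH(1)) auto
  then have "seq_graph P (frontier S B @ (A # \<Sigma>))" by (rule sq_exch) simp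
  then have "seq_graph P (B # A # \<Sigma>)" using Parr.prems(1) by (intro Parr.IH(2)) auto
  then have "seq_graph P (A # B # \<Sigma>)" by (rule sq_exch) simp
  then show ?case by (rule sq_par)
qed auto

lemma seq_graph_close_all:
  "seq_graph P (frontiers {} \<Gamma> @ \<Sigma>) \<Longrightarrow> seq_graph P (\<Gamma> @ \<Sigma>)"
proof (induction \<Gamma> arbitrary: \<Sigma>)
  case (Cons T \<Gamma>)
  then have "seq_graph P (frontier {} T @ (frontiers {} \<Gamma> @ \<Sigma>))" by simp
  then have "seq_graph P (T # (frontiers {} \<Gamma> @ \<Sigma>))" by (rule seq_graph_close[rotated]) simp
  then have "seq_graph P (frontiers {} \<Gamma> @ (T # \<Sigma>))" by (rule sq_exch) simp
  from Cons.IH[OF this] show ?case by (rule sq_exch) simp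
qed simp

lemma frontier_contract_pair:
  assumes d: "nms X \<inter> nms Y = {}" and U: "U = X \<or> U = Y" "t \<in> subs U"
    and M: "\<exists>M. mset (frontier S U) = M + R \<and> mset (frontier (S - {t}) U) = M + {#t#}"
  shows "\<exists>M. mset (frontier S X @ frontier S Y) = M + R \<and> mset (frontier (S - {t}) X @ frontier (S - {t}) Y) = M + {#t#}"
proof -
  obtain M where M: "mset (frontier S U) = M + R" "mset (frontier (S - {t}) U) = M + {#t#}" using M by blast
  from U(1) show ?thesis
  proof
    assume "U = X"
    moreover from this have "frontier (S - {t}) Y = frontier S Y"
      using U(2) subs_disjoint[OF d] by (intro frontier_diff) blast
    ultimately show ?thesis using M by (intro exI[of _ "M + mset (frontier S Y)"]) simp
  next
    assume "U = Y"
    moreover from this have "frontier (S - {t}) X = frontier S X"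
      using U(2) subs_disjoint[OF d] by (intro frontier_diff) blast
    ultimately show ?thesis using M by (intro exI[of _ "M + mset (frontier S X)"]) simp
  qed
qed

text \<open>By \<open>up\<close> every tensor on the way from the root to \<open>t\<close> is still
  pending, so \<open>t\<close> is visible to the frontier; distinct names make its occurrence
  unique.\<close>

lemma frontier_contract:
  assumes t: "t = Tens A B" "t \<in> S" and "t \<in> subs T" "dnames T"
    and up: "\<And>X Y. Tens X Y \<in> subs T \<Longrightarrow> t \<in> subs (Tens X Y) \<Longrightarrow> Tens X Y \<in> S"
  shows "\<exists>M. mset (frontier S T) = M + (mset (frontier S A) + mset (frontier S B)) \<and> mset (frontier (S - {t}) T) = M + {#t#}"
  using assms(3,4) up
proof (induction T)
  case (Leaf l)
  then show ?case using t by simp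
next
  case (Tens X Y)
  show ?case
  proof (cases "t = Tens X Y")
    case True
    then show ?thesis using t by (intro exI[of _ "{#}"]) auto
  next
    case False
    have S: "Tens X Y \<in> S - {t}" using Tens.prems(1,3) False by simp
    have d: "dnames X" "dnames Y" "nms X \<inter> nms Y = {}" using Tens.prems(2) unfolding dnames_Tens by auto
    obtain U where U: "U = X \<or> U = Y" "t \<in> subs U" using Tens.prems(1) False by auto
    have "\<exists>M. mset (frontier S U) = M + (mset (frontier S A) + mset (frontier S B)) \<and> mset (frontier (S - {t}) U) = M + {#t#}"
      using U Tens.IH(1)[OF _ d(1)] Tens.IH(2)[OF _ d(2)] Tens.prems(3) by auto
    from frontier_contract_pair[OF d(3) U this] show ?thesis using S by simp
  qed
next
  case (Parr X Y)
  have d: "dnames X" "dnames Y" "nms X \<inter> nms Y = {}" using Parr.prems(2) unfolding dnames_Parr by auto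
  obtain U where U: "U = X \<or> U = Y" "t \<in> subs U" using Parr.prems(1) t by auto
  have "\<exists>M. mset (frontier S U) = M + (mset (frontier S A) + mset (frontier S B)) \<and> mset (frontier (S - {t}) U) = M + {#t#}"
    using U Parr.IH(1)[OF _ d(1)] Parr.IH(2)[OF _ d(2)] Parr.prems(3) by auto
  from frontier_contract_pair[OF d(3) U this] show ?case by simp
qed

definition dforest :: "('v, 'a) tree list \<Rightarrow> bool" where
  "dforest \<Gamma> \<longleftrightarrow> distinct (map fst (concat (map leaves \<Gamma>)))"

lemma dforest_split:
  assumes "dforest (\<Gamma>1 @ T # \<Gamma>2)"
  shows "dnames T" "\<And>U. U \<in> set \<Gamma>1 \<union> set \<Gamma>2 \<Longrightarrow> nms U \<inter> nms T = {}"
proof -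
  have eq: "fst ` set (concat (map leaves \<Delta>)) = \<Union> (nms ` set \<Delta>)" for \<Delta> :: "('a, 'b) tree list"
    unfolding nms_def by (auto simp: image_UN)
  have *: "dnames T" "\<Union> (nms ` set \<Gamma>1) \<inter> (nms T \<union> \<Union> (nms ` set \<Gamma>2)) = {}"
    "nms T \<inter> \<Union> (nms ` set \<Gamma>2) = {}"
    using assms unfolding dforest_def
    by (simp_all add: eq[symmetric] nms_def[symmetric] image_Un del: set_concat)
  show "dnames T" by (rule *(1))
  show "nms U \<inter> nms T = {}" if "U \<in> set \<Gamma>1 \<union> set \<Gamma>2" for U
    using *(2,3) that by blast
qed

lemma frontiers_contract:
  assumes t: "t = Tens A B" "t \<in> S" and T: "T \<in> set \<Gamma>" "t \<in> subs T" and d: "dforest \<Gamma>"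
    and up: "\<And>X Y. Tens X Y \<in> subs T \<Longrightarrow> t \<in> subs (Tens X Y) \<Longrightarrow> Tens X Y \<in> S"
  obtains M where "mset (frontiers S \<Gamma>) = M + mset (frontier S A) + mset (frontier S B)"
    "mset (frontiers (S - {t}) \<Gamma>) = M + {#t#}"
proof -
  obtain \<Gamma>1 \<Gamma>2 where \<Gamma>: "\<Gamma> = \<Gamma>1 @ T # \<Gamma>2" using T(1) by (meson split_list)
  note d' = dforest_split[OF d[unfolded \<Gamma>]]
  have "t \<notin> subs U" if "U \<in> set \<Gamma>1 \<union> set \<Gamma>2" for U
    using subs_disjoint[OF d'(2)[OF that]] T(2) by blast
  then have same: "frontiers (S - {t}) \<Gamma>1 = frontiers S \<Gamma>1" "frontiers (S - {t}) \<Gamma>2 = frontiers S \<Gamma>2"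
    using frontier_diff[of t _ S] by (auto intro!: arg_cong[where f = concat])
  obtain M where "mset (frontier S T) = M + (mset (frontier S A) + mset (frontier S B))" "mset (frontier (S - {t}) T) = M + {#t#}"
    using frontier_contract[OF t T(2) d'(1) up] by blast
  then show ?thesis
    using same by (intro that[of "M + mset (frontiers S \<Gamma>1) + mset (frontiers S \<Gamma>2)"]) (simp_all add: \<Gamma>)
qed

lemma filter_mset_disj:
  "(\<And>U. \<not> (p U \<and> q U)) \<Longrightarrow> filter_mset (\<lambda>U. p U \<or> q U) M = filter_mset p M + filter_mset q M"
  by (induction M) auto

text \<open>\<open>P v\<close> is the linking of a sequent proof whose conclusion is the part of the
  frontier lying in block \<open>v\<close>. Contracting a uniform tensor is one tensor rule between
  the proofs of its two blocks. Describing the leaves of \<open>P v\<close> as a fibre of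
  \<open>f\<close> supplies the disjoint names that this rule demands; the sum of components records
  that the given linkings are merely joined by pars.\<close>

lemma sequentialise:
  fixes f :: "'v \<Rightarrow> 'b" and P :: "'b \<Rightarrow> ('v, 'a) tree"
  assumes "tight S f V" and d: "dforest \<Gamma>"
    and "\<And>s. s \<in> S \<Longrightarrow> \<exists>T\<in>set \<Gamma>. s \<in> subs T"
    and "\<And>T t X Y. T \<in> set \<Gamma> \<Longrightarrow> t \<in> S \<Longrightarrow> Tens X Y \<in> subs T \<Longrightarrow> t \<in> subs (Tens X Y) \<Longrightarrow> Tens X Y \<in> S"
    and "\<And>T. T \<in> set \<Gamma> \<Longrightarrow> f ` nms T \<subseteq> V"
    and "\<And>v. v \<in> V \<Longrightarrow> seq_graph (P v) (filter (\<lambda>T. label_of f T = v) (frontiers S \<Gamma>))"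
    and "\<And>T. T \<in> set (frontiers S \<Gamma>) \<Longrightarrow> f ` nms T = {label_of f T}"
    and "\<And>v. v \<in> V \<Longrightarrow> nms (P v) = {x \<in> N. f x = v}"
  shows "\<exists>Q. seq_graph Q \<Gamma> \<and> comps Q = (\<Sum>v\<in>V. comps (P v))"
  using assms(1,3-)
proof (induction "card S" arbitrary: S f V P rule: less_induct)
  case less
  note T = less.prems(1) and inG = less.prems(2) and up = less.prems(3) and inV = less.prems(4)
    and seq = less.prems(5) and unif = less.prems(6) and nm = less.prems(7)
  show ?case
  proof (cases "S = {}")
    case True
    \<comment> \<open>With no tensor left there is one block, and its proof concludes the whole
      frontier; only par rules are missing.\<close>
    then obtain v where v: "V = {v}" using tightD(3)[OF T] by (auto simp: card_1_singleton_iff)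
    have "label_of f U = v" if U: "U \<in> set (frontiers S \<Gamma>)" for U
    proof -
      obtain T where "T \<in> set \<Gamma>" "U \<in> set (frontier S T)" using U by auto
      then have "f ` nms U \<subseteq> V" using inV[of T] subs_names[OF frontier_subs[of U S T]] by blast
      then show ?thesis using label_of_in[of f U] v by blast
    qed
    then have "filter (\<lambda>T. label_of f T = v) (frontiers S \<Gamma>) = frontiers S \<Gamma>" by (intro filter_True) blast
    then have "seq_graph (P v) (frontiers {} \<Gamma> @ [])" using seq[of v] v True by simp
    from seq_graph_close_all[OF this] have "seq_graph (P v) \<Gamma>" by simp
    then show ?thesis using v by auto
  next
    case False
    obtain t where min: "minimal S t" and "uniform f t"
      using uniform_minimal_tensor[OF T False] by blast
    then obtain A B a b where t: "t = Tens A B" and A: "f ` nms A = {a}" and B: "f ` nms B = {b}"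
      unfolding uniform_def by blast
    have tS: "t \<in> S" using min unfolding minimal_def by simp
    obtain x where x: "x \<in> nms A" using nms_nonempty[of A] by blast
    obtain w where w: "w \<in> nms B" using nms_nonempty[of B] by blast
    have fx: "f x = a" and fw: "f w = b" using x w A B by auto
    have ab: "a \<noteq> b" using tight_no_loop[OF T tS[unfolded t]] A B by auto
    have V: "a \<in> V" "b \<in> V" using tightD(6)[OF T tS] x w fx fw t by auto
    define m where "m = (\<lambda>z. if z = b then a else z)"
    have T': "tight (S - {t}) (m \<circ> f) (V - {b})"
      using tight_contract[OF T min[unfolded t] x w, unfolded fx fw, OF m_def] t by simp
    define P' where "P' = P(a := Parr (P a) (P b))"
    obtain U where U: "U \<in> set \<Gamma>" "t \<in> subs U" using inG[OF tS] by blast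
    obtain M where M: "mset (frontiers S \<Gamma>) = M + mset (frontier S A) + mset (frontier S B)"
      "mset (frontiers (S - {t}) \<Gamma>) = M + {#t#}"
      using frontiers_contract[OF t tS U d up[OF U(1) tS]] by blast
    have MS: "set (frontiers S \<Gamma>) = set_mset M \<union> set (frontier S A) \<union> set (frontier S B)"
      using arg_cong[OF M(1), of set_mset] by simp
    have MS': "set (frontiers (S - {t}) \<Gamma>) = insert t (set_mset M)"
      using arg_cong[OF M(2), of set_mset] by simp
    have labA: "label_of f W = a" if "W \<in> set (frontier S A)" for W
      using label_of_in[of f W] subs_names[OF frontier_subs[OF that]] A by blast
    have labB: "label_of f W = b" if "W \<in> set (frontier S B)" for W
      using label_of_in[of f W] subs_names[OF frontier_subs[OF that]] B by blast
    have filt: "mset (filter (\<lambda>T. label_of f T = v) (frontiers S \<Gamma>)) = filter_mset (\<lambda>T. label_of f T = v) M +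
        (if v = a then mset (frontier S A) else {#}) + (if v = b then mset (frontier S B) else {#})" for v
    proof -
      have "filter_mset (\<lambda>T. label_of f T = v) (mset (frontier S A)) = (if v = a then mset (frontier S A) else {#})"
        using labA by (auto intro!: filter_mset_True filter_mset_False simp: filter_mset_eq_conv)
      moreover have "filter_mset (\<lambda>T. label_of f T = v) (mset (frontier S B)) = (if v = b then mset (frontier S B) else {#})"
        using labB by (auto intro!: filter_mset_True filter_mset_False simp: filter_mset_eq_conv)
      ultimately show ?thesis unfolding mset_filter M(1) filter_union_mset by simp
    qed
    have labt: "label_of (m \<circ> f) t = a"
      using label_of_in[of "m \<circ> f" t] A B unfolding t m_def by auto
    have filt': "mset (filter (\<lambda>T. label_of (m \<circ> f) T = v) (frontiers (S - {t}) \<Gamma>)) =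
        filter_mset (\<lambda>T. m (label_of f T) = v) M + (if v = a then {#t#} else {#})" for v
      unfolding mset_filter M(2) filter_union_mset using labt by (simp add: label_of_comp)
    have inA: "s \<notin> S" if "s \<in> subs A" for s
      using min that not_subs_child(1)[of A B] unfolding minimal_def t by auto
    have inB: "s \<notin> S" if "s \<in> subs B" for s
      using min that not_subs_child(2)[of A B] unfolding minimal_def t by auto
    have seq': "seq_graph (P' v) (filter (\<lambda>T. label_of (m \<circ> f) T = v) (frontiers (S - {t}) \<Gamma>))"
      if v: "v \<in> V - {b}" for v
    proof (cases "v = a")
      case False
      have "filter_mset (\<lambda>T. m (label_of f T) = v) M = filter_mset (\<lambda>T. label_of f T = v) M"
        using False v unfolding m_def by (intro filter_mset_cong) auto
      then have eq: "mset (filter (\<lambda>T. label_of (m \<circ> f) T = v) (frontiers (S - {t}) \<Gamma>)) =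
          mset (filter (\<lambda>T. label_of f T = v) (frontiers S \<Gamma>))"
        unfolding filt filt' using False v by simp
      have "seq_graph (P' v) (filter (\<lambda>T. label_of f T = v) (frontiers S \<Gamma>))"
        using seq[of v] v False unfolding P'_def by simp
      then show ?thesis using eq by (rule sq_exch)
    next
      case True
      \<comment> \<open>The tensor rule wants \<open>A\<close> last and \<open>B\<close> first. As
        \<open>t\<close> is minimal, nothing inside \<open>A\<close> or \<open>B\<close> is pending,
        so par rules suffice to build both.\<close>
      obtain Ma where Ma: "mset Ma = filter_mset (\<lambda>T. label_of f T = a) M" using ex_mset by blast
      obtain Mb where Mb: "mset Mb = filter_mset (\<lambda>T. label_of f T = b) M" using ex_mset by blast
      have "seq_graph (P a) (frontier S A @ Ma)"
        by (rule sq_exch[OF seq[OF V(1)]]) (use filt[of a] ab Ma in simp)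
      have eqA: "mset (Ma @ [A]) = mset (A # Ma)" by simp
      have 1: "seq_graph (P a) (Ma @ [A])" using seq_graph_close[OF inA \<open>seq_graph (P a) (frontier S A @ Ma)\<close>] eqA
        by (rule sq_exch)
      have "seq_graph (P b) (frontier S B @ Mb)"
        by (rule sq_exch[OF seq[OF V(2)]]) (use filt[of b] ab Mb in simp)
      from seq_graph_close[OF inB this] have 2: "seq_graph (P b) (B # Mb)" .
      have "names (P a) \<inter> names (P b) = {}"
        unfolding nms_def[symmetric] nm[OF V(1)] nm[OF V(2)] using ab by auto
      from sq_tens[OF 1 2 this] have 3: "seq_graph (Parr (P a) (P b)) (Ma @ [t] @ Mb)" unfolding t .
      have "filter_mset (\<lambda>T. m (label_of f T) = a) M = filter_mset (\<lambda>T. label_of f T = a \<or> label_of f T = b) M"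
        unfolding m_def by (intro filter_mset_cong) auto
      also have "\<dots> = mset Ma + mset Mb" unfolding Ma Mb using ab by (intro filter_mset_disj) auto
      finally have "mset (filter (\<lambda>T. label_of (m \<circ> f) T = a) (frontiers (S - {t}) \<Gamma>)) = mset (Ma @ [t] @ Mb)"
        unfolding filt' by simp
      from sq_exch[OF 3 this] show ?thesis using True unfolding P'_def by simp
    qed
    have small: "card (S - {t}) < card S" using tightD(1)[OF T] tS by (rule card_Diff1_less)
    have inG': "\<exists>T\<in>set \<Gamma>. s \<in> subs T" if "s \<in> S - {t}" for s using inG that by blast
    \<comment> \<open>\<open>Tens X Y\<close> cannot be \<open>t\<close> itself, because by
      minimality no other member of \<open>S\<close> is a subterm of \<open>t\<close>.\<close>
    have up': "Tens X Y \<in> S - {t}"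
      if "T \<in> set \<Gamma>" "u \<in> S - {t}" "Tens X Y \<in> subs T" "u \<in> subs (Tens X Y)" for T u X Y
      using up[of T u X Y] that min unfolding minimal_def by auto
    have inV': "(m \<circ> f) ` nms T \<subseteq> V - {b}" if "T \<in> set \<Gamma>" for T
      using inV[OF that] V(1) ab unfolding m_def by auto
    have unif': "(m \<circ> f) ` nms W = {label_of (m \<circ> f) W}" if W: "W \<in> set (frontiers (S - {t}) \<Gamma>)" for W
    proof (cases "W = t")
      case True
      have "(m \<circ> f) ` nms t = m ` (f ` nms A \<union> f ` nms B)" unfolding t by (simp add: image_Un image_comp)
      also have "\<dots> = {a}" unfolding A B m_def by auto
      finally show ?thesis using labt True by simp
    next
      case False
      then have "f ` nms W = {label_of f W}" using W MS MS' by (intro unif) auto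
      then show ?thesis unfolding label_of_comp image_comp[symmetric] by simp
    qed
    have nm': "nms (P' v) = {x \<in> N. (m \<circ> f) x = v}" if v: "v \<in> V - {b}" for v
    proof (cases "v = a")
      case True
      then have "nms (P' v) = nms (P a) \<union> nms (P b)" unfolding P'_def by simp
      also have "\<dots> = {x \<in> N. (m \<circ> f) x = v}"
        unfolding nm[OF V(1)] nm[OF V(2)] True m_def by auto
      finally show ?thesis .
    next
      case False
      then show ?thesis using nm[of v] v unfolding P'_def m_def by auto
    qed
    have "\<exists>Q. seq_graph Q \<Gamma> \<and> comps Q = (\<Sum>v\<in>V - {b}. comps (P' v))"
      by (rule less.hyps[where P = P', OF small T' inG' up' inV' seq' unif' nm'])
    moreover have "(\<Sum>v\<in>V - {b}. comps (P' v)) = (\<Sum>v\<in>V. comps (P v))"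
    proof -
      have fin: "finite (V - {b})" "a \<in> V - {b}" using tightD(2)[OF T] V ab by auto
      have "(\<Sum>v\<in>V - {b}. comps (P' v)) = comps (P' a) + (\<Sum>v\<in>V - {b} - {a}. comps (P' v))"
        by (rule sum.remove[OF fin])
      also have "(\<Sum>v\<in>V - {b} - {a}. comps (P' v)) = (\<Sum>v\<in>V - {b} - {a}. comps (P v))"
        by (rule sum.cong) (auto simp: P'_def)
      also have "comps (P' a) = comps (P b) + comps (P a)" by (simp add: P'_def)
      also have "comps (P b) + comps (P a) + (\<Sum>v\<in>V - {b} - {a}. comps (P v)) =
          comps (P b) + (\<Sum>v\<in>V - {b}. comps (P v))"
        using sum.remove[OF fin, of "\<lambda>v. comps (P v)"] by simp
      also have "\<dots> = (\<Sum>v\<in>V. comps (P v))"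
        using sum.remove[OF tightD(2)[OF T] V(2), of "\<lambda>v. comps (P v)"] by simp
      finally show ?thesis .
    qed
    ultimately show ?thesis by simp
  qed
qed

section \<open>From a correct graph with normal linking to a tight family of tensors\<close>

fun tsubs :: "('v, 'a) tree \<Rightarrow> ('v, 'a) tree set" where
  "tsubs (Leaf l) = {}"
| "tsubs (Tens A B) = insert (Tens A B) (tsubs A \<union> tsubs B)"
| "tsubs (Parr A B) = tsubs A \<union> tsubs B"

lemma finite_tsubs [simp]: "finite (tsubs T)"
  by (induction T) auto

lemma tsubs_iff: "s \<in> tsubs T \<longleftrightarrow> s \<in> subs T \<and> (\<exists>A B. s = Tens A B)"
  by (induction T) auto

lemma card_tsubs: "card (tsubs T) \<le> ntens T"
proof (induction T)
  case (Tens A B)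
  have "card (tsubs (Tens A B)) \<le> Suc (card (tsubs A \<union> tsubs B))"
    by (simp add: card_insert_if)
  also have "card (tsubs A \<union> tsubs B) \<le> card (tsubs A) + card (tsubs B)" by (rule card_Un_le)
  finally show ?case using Tens by simp
next
  case (Parr A B)
  have "card (tsubs A \<union> tsubs B) \<le> card (tsubs A) + card (tsubs B)" by (rule card_Un_le)
  then show ?case using Parr by simp
qed simp

text \<open>As a set of terms, \<open>tsubs\<close> could identify occurrences, so only this
  direction is immediate; the other one will come from connectedness.\<close>

lemma card_tsubs_list: "card (\<Union> (tsubs ` set \<Gamma>)) \<le> sum_list (map ntens \<Gamma>)"
proof (induction \<Gamma>)
  case (Cons T \<Gamma>)
  have "card (tsubs T \<union> \<Union> (tsubs ` set \<Gamma>)) \<le> card (tsubs T) + card (\<Union> (tsubs ` set \<Gamma>))"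
    by (rule card_Un_le)
  then show ?case using Cons card_tsubs[of T] by simp
qed simp

lemma sw_vrep: "sw T (vrep \<sigma> T) (tedge (\<lambda>x. x) \<sigma> ` tsubs T)"
proof (induction T)
  case (Leaf l)
  then show ?case by (simp add: sw_leaf)
next
  case (Tens A B)
  then show ?case using sw_tens[OF Tens.IH, of "vrep \<sigma> (Tens A B)"] by (simp add: image_Un)
next
  case (Parr A B)
  then show ?case using sw_parr[OF Parr.IH, of "vrep \<sigma> (Parr A B)"] by (simp add: image_Un)
qed

lemma subs_laminar:
  "dnames T \<Longrightarrow> s \<in> subs T \<Longrightarrow> t \<in> subs T \<Longrightarrow> s \<in> subs t \<or> t \<in> subs s \<or> nms s \<inter> nms t = {}"
proof (induction T)
  case (Tens A B)
  have d: "dnames A" "dnames B" "nms A \<inter> nms B = {}" using Tens.prems(1) unfolding dnames_Tens by auto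
  consider "s = Tens A B" | "t = Tens A B" | "s \<in> subs A" "t \<in> subs A" | "s \<in> subs B" "t \<in> subs B"
    | "s \<in> subs A" "t \<in> subs B" | "s \<in> subs B" "t \<in> subs A" using Tens.prems(2,3) by auto
  then show ?case
    by cases (use Tens.prems Tens.IH d subs_names[of s A] subs_names[of s B] subs_names[of t A]
        subs_names[of t B] in blast)+
next
  case (Parr A B)
  have d: "dnames A" "dnames B" "nms A \<inter> nms B = {}" using Parr.prems(1) unfolding dnames_Parr by auto
  consider "s = Parr A B" | "t = Parr A B" | "s \<in> subs A" "t \<in> subs A" | "s \<in> subs B" "t \<in> subs B"
    | "s \<in> subs A" "t \<in> subs B" | "s \<in> subs B" "t \<in> subs A" using Parr.prems(2,3) by auto
  then show ?case
    by cases (use Parr.prems Parr.IH d subs_names[of s A] subs_names[of s B] subs_names[of t A]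
        subs_names[of t B] in blast)+
qed auto

lemma dforest_laminar:
  assumes "dforest \<Gamma>" "T \<in> set \<Gamma>" "T' \<in> set \<Gamma>" "s \<in> subs T" "t \<in> subs T'"
  shows "s \<in> subs t \<or> t \<in> subs s \<or> nms s \<inter> nms t = {}"
proof (cases "T = T'")
  case True
  obtain \<Gamma>1 \<Gamma>2 where "\<Gamma> = \<Gamma>1 @ T # \<Gamma>2" using assms(2) by (meson split_list)
  then have "dnames T" using assms(1) dforest_split(1) by blast
  then show ?thesis using True assms(4,5) by (intro subs_laminar) auto
next
  case False
  obtain \<Gamma>1 \<Gamma>2 where \<Gamma>: "\<Gamma> = \<Gamma>1 @ T # \<Gamma>2" using assms(2) by (meson split_list)
  then have "T' \<in> set \<Gamma>1 \<union> set \<Gamma>2" using assms(3) False by auto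
  then have "nms T' \<inter> nms T = {}" using dforest_split(2) assms(1) \<Gamma> by blast
  then show ?thesis using subs_names[OF assms(4)] subs_names[OF assms(5)] by blast
qed

lemma block_comps: "block K \<Longrightarrow> comps K = {#K#}"
  by (induction rule: block.induct) auto

lemma normal_comps_block: "normal N \<Longrightarrow> K \<in># comps N \<Longrightarrow> block K"
  by (induction rule: normal.induct) (auto simp: block_comps)

lemma comps_leaves: "K \<in># comps T \<Longrightarrow> set (leaves K) \<subseteq> set (leaves T)"
  by (induction T) auto

lemma comps_nms: "K \<in># comps T \<Longrightarrow> nms K \<subseteq> nms T"
  unfolding nms_def by (intro image_mono comps_leaves)

lemma comps_dnames: "K \<in># comps T \<Longrightarrow> dnames T \<Longrightarrow> dnames K"
  by (induction T) auto

lemma comps_cover: "x \<in> nms T \<Longrightarrow> \<exists>K. K \<in># comps T \<and> x \<in> nms K"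
  by (induction T) auto

lemma comps_disjoint:
  "dnames T \<Longrightarrow> K \<in># comps T \<Longrightarrow> L \<in># comps T \<Longrightarrow> K = L \<or> nms K \<inter> nms L = {}"
proof (induction T)
  case (Parr A B)
  have d: "dnames A" "dnames B" "nms A \<inter> nms B = {}" using Parr.prems(1) unfolding dnames_Parr by auto
  consider "K \<in># comps A" "L \<in># comps A" | "K \<in># comps B" "L \<in># comps B"
    | "K \<in># comps A" "L \<in># comps B" | "K \<in># comps B" "L \<in># comps A" using Parr.prems(2,3) by auto
  then show ?case
  proof cases
    case 1
    then show ?thesis using Parr.IH(1) d by blast
  next
    case 2
    then show ?thesis using Parr.IH(2) d by blast
  next
    case 3
    then show ?thesis using comps_nms[of K A] comps_nms[of L B] d(3) by blast
  next
    case 4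
    then show ?thesis using comps_nms[of K B] comps_nms[of L A] d(3) by blast
  qed
qed auto

lemma comps_set: "dnames T \<Longrightarrow> mset_set (set_mset (comps T)) = comps T"
proof (induction T)
  case (Parr A B)
  have d: "dnames A" "dnames B" "nms A \<inter> nms B = {}" using Parr.prems(1) unfolding dnames_Parr by auto
  have "set_mset (comps A) \<inter> set_mset (comps B) = {}"
  proof (rule equals0I)
    fix K assume "K \<in> set_mset (comps A) \<inter> set_mset (comps B)"
    then have "nms K \<subseteq> nms A \<inter> nms B" using comps_nms[of K] by auto
    then show False using d(3) nms_nonempty[of K] by blast
  qed
  then show ?case using Parr.IH d by (simp add: mset_set_Union)
qed auto

lemma block_count: "block K \<Longrightarrow> dnames K \<Longrightarrow> card (nms K) = ntens K + 1"
proof (induction rule: block.induct)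
  case (block_bot L x)
  then have "x \<notin> nms L" by (auto simp: nms_def)
  then show ?case using block_bot by simp
qed auto

text \<open>Each block has one leaf more than it has tensors. This converts the count of leaves into
  a count of blocks.\<close>

lemma normal_count: "normal N \<Longrightarrow> dnames N \<Longrightarrow> card (nms N) = ntens N + size (comps N)"
proof (induction rule: normal.induct)
  case (normal_block L)
  then show ?case by (simp add: block_comps block_count)
next
  case (normal_parr A B)
  have d: "dnames A" "dnames B" "nms A \<inter> nms B = {}" using normal_parr.prems unfolding dnames_Parr by auto
  then show ?case using normal_parr.IH by (simp add: card_Un_disjoint)
qed

lemma block_seq_graph: "block K \<Longrightarrow> dnames K \<Longrightarrow> seq_graph K (map Leaf (leaves K))"
proof (induction rule: block.induct)
  case (block_bot L x)
  then show ?case using sq_bot[of L "map Leaf (leaves L)" x] by auto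
qed (auto intro: sq_one sq_id)

text \<open>The outer pars contribute no edges, so the edges of the linking disappear when its
  components are contracted to vertices.\<close>

lemma sw_edges_comps: "sw T r E \<Longrightarrow> e \<in> E \<Longrightarrow> \<exists>K. K \<in># comps T \<and> e \<subseteq> nms K"
proof (induction rule: sw.induct)
  case (sw_tens A a E B b F r)
  have "sw (Tens A B) r (insert {a, b} (E \<union> F))" using sw_tens.hyps by (rule sw.sw_tens)
  from sw_edges[OF this sw_tens.prems] show ?case unfolding nms_def[symmetric] by auto
next
  case (sw_parr A a E B b F r)
  then show ?case by auto
qed simp

lemma frontier_all: "tsubs T \<subseteq> S \<Longrightarrow> frontier S T = map Leaf (leaves T)"
  by (induction T) auto

text \<open>The blocks themselves serve as vertices, and all tensors of \<Gamma> are pending. The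
  initial frontier then consists of leaves, and each block is already the linking of a proof of its
  own leaves.\<close>

theorem normal_sequentialisable:
  assumes net: "net \<Gamma> N" and normal: "normal N"
  shows "\<exists>Q. seq_graph Q \<Gamma> \<and> comps Q = comps N"
proof -
  have leaf_correct: "leaf_correct N \<Gamma>" and dN: "dnames N" and dG: "dforest \<Gamma>"
    and leq: "set (leaves N) = set (concat (map leaves \<Gamma>))"
    using net unfolding net_def pre_proof_graph_def dforest_def by auto
  define V where "V = set_mset (comps N)"
  define S where "S = \<Union> (tsubs ` set \<Gamma>)"
  define f where "f = (\<lambda>x. THE K. K \<in> V \<and> x \<in> nms K)"
  have f: "f x = K" if "K \<in> V" "x \<in> nms K" for x K
    unfolding f_def
  proof (rule the_equality)
    fix L assume "L \<in> V \<and> x \<in> nms L"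
    then show "L = K" using comps_disjoint[OF dN, of L K] that unfolding V_def by blast
  qed (use that in blast)
  have fV: "f x \<in> V \<and> x \<in> nms (f x)" if x: "x \<in> nms N" for x
  proof -
    obtain K where "K \<in> V" "x \<in> nms K" using comps_cover[OF x] unfolding V_def by blast
    then show ?thesis using f by simp
  qed
  have nG: "nms T \<subseteq> nms N" if "T \<in> set \<Gamma>" for T
    unfolding nms_def using leq that by (intro image_mono) auto
  have finS: "finite S" unfolding S_def by simp
  have Sin: "\<exists>T\<in>set \<Gamma>. s \<in> subs T" "\<exists>A B. s = Tens A B" if "s \<in> S" for s
    using that unfolding S_def by (auto simp: tsubs_iff)
  have sp: "spans (tedge f \<sigma> ` S) V" for \<sigma>
    unfolding spans_def
  proof (intro ballI)
    fix K L assume KL: "K \<in> V" "L \<in> V"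
    obtain x where x: "x \<in> nms K" using nms_nonempty[of K] by blast
    obtain y where y: "y \<in> nms L" using nms_nonempty[of L] by blast
    obtain r E where E: "sw N r E" using sw_ex[of N] by (elim exE)
    have "sws \<Gamma> (map (\<lambda>T. tedge (\<lambda>x. x) \<sigma> ` tsubs T) \<Gamma>)"
      unfolding list_all2_map2 by (rule list.rel_refl_strong) (rule exI, rule sw_vrep)
    from leaf_correct_spans[OF leaf_correct E this]
    have span: "spans (E \<union> tedge (\<lambda>x. x) \<sigma> ` S) (nms N)" unfolding S_def nms_def by (simp add: image_UN)
    have "x \<in> nms N" "y \<in> nms N"
      using x y KL comps_nms[of K N] comps_nms[of L N] unfolding V_def by auto
    then have "conn (E \<union> tedge (\<lambda>x. x) \<sigma> ` S) x y" using span unfolding spans_def by simp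
    then have "conn (tedge f \<sigma> ` S) (f x) (f y)"
    proof (rule conn_map)
      fix a b assume "{a, b} \<in> E \<union> tedge (\<lambda>x. x) \<sigma> ` S"
      then consider "{a, b} \<in> E" | s where "s \<in> S" "{a, b} = tedge (\<lambda>x. x) \<sigma> s" by blast
      then show "conn (tedge f \<sigma> ` S) (f a) (f b)"
      proof cases
        case 1
        then obtain M where "M \<in> V" "{a, b} \<subseteq> nms M" using sw_edges_comps[OF E] unfolding V_def by blast
        then have "f a = M" "f b = M" using f by auto
        then show ?thesis by simp
      next
        case 2
        have "tedge f \<sigma> s = f ` {a, b}" using tedge_comp[of f "\<lambda>x. x" \<sigma> s] 2(2) by (simp add: comp_def)
        then show ?thesis using 2(1) by (intro conn_edge) auto
      qed
    qed
    then show "conn (tedge f \<sigma> ` S) K L" using f[OF KL(1) x] f[OF KL(2) y] by simp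
  qed
  have finV: "finite V" unfolding V_def by simp
  have "card V = size (comps N)"
    using comps_set[OF dN] unfolding V_def by (metis size_mset_set)
  moreover have "card (nms N) = ntens N + sum_list (map ntens \<Gamma>) + 1"
    using leaf_correct unfolding leaf_correct_def nms_def by blast
  ultimately have cV: "card V = sum_list (map ntens \<Gamma>) + 1" using normal_count[OF normal dN] by simp
  \<comment> \<open>Connectedness on the blocks gives the missing lower bound on
    \<open>card S\<close>.\<close>
  have "card V \<le> card (tedge f (\<lambda>_. True) ` S) + 1"
    using finS finV sp by (intro spans_card) auto
  also have "\<dots> \<le> card S + 1" using finS by (simp add: card_image_le)
  finally have "card V = card S + 1"
    using cV card_tsubs_list[of \<Gamma>] unfolding S_def by linarith
  moreover have "dnames s" if s: "s \<in> S" for s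
  proof -
    obtain T where T: "T \<in> set \<Gamma>" "s \<in> subs T" using Sin(1)[OF s] by blast
    obtain \<Gamma>1 \<Gamma>2 where "\<Gamma> = \<Gamma>1 @ T # \<Gamma>2" using T(1) by (meson split_list)
    then have "dnames T" using dG dforest_split(1) by blast
    then show ?thesis using subs_dnames[OF T(2)] by blast
  qed
  moreover have "f ` nms s \<subseteq> V" if s: "s \<in> S" for s
  proof -
    obtain T where T: "T \<in> set \<Gamma>" "s \<in> subs T" using Sin(1)[OF s] by blast
    then show ?thesis using subs_names[OF T(2)] nG[OF T(1)] fV by auto
  qed
  moreover have "s \<in> subs t \<or> t \<in> subs s \<or> nms s \<inter> nms t = {}" if st: "s \<in> S" "t \<in> S" for s t
  proof -
    obtain T T' where "T \<in> set \<Gamma>" "s \<in> subs T" "T' \<in> set \<Gamma>" "t \<in> subs T'"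
      using Sin(1)[OF st(1)] Sin(1)[OF st(2)] by blast
    then show ?thesis using dforest_laminar[OF dG, of T T' s t] by simp
  qed
  ultimately have T: "tight S f V"
    unfolding tight_def using finS finV sp Sin(2) by simp
  have frontiers: "frontiers S \<Gamma> = map Leaf (concat (map leaves \<Gamma>))"
  proof -
    have "map (frontier S) \<Gamma> = map (\<lambda>T. map Leaf (leaves T)) \<Gamma>"
      by (rule map_cong[OF refl], rule frontier_all) (auto simp: S_def)
    then have "frontiers S \<Gamma> = concat (map (\<lambda>T. map Leaf (leaves T)) \<Gamma>)" by (rule arg_cong)
    then show ?thesis by (simp add: map_concat comp_def)
  qed
  have injN: "inj_on fst (set (leaves N))" using dN by (simp add: distinct_map)
  have up: "Tens X Y \<in> S"
    if "T \<in> set \<Gamma>" "t \<in> S" "Tens X Y \<in> subs T" "t \<in> subs (Tens X Y)" for T t X Y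
    using that unfolding S_def by (auto simp: tsubs_iff)
  have inV: "f ` nms T \<subseteq> V" if "T \<in> set \<Gamma>" for T using nG[OF that] fV by auto
  have unif: "f ` nms U = {label_of f U}" if "U \<in> set (frontiers S \<Gamma>)" for U
    using that unfolding frontiers by (auto simp: label_of_def)
  have nm: "nms K = {x \<in> nms N. f x = K}" if K: "K \<in> V" for K
  proof (intro equalityI subsetI CollectI conjI)
    fix x assume x: "x \<in> nms K"
    then show "f x = K" by (rule f[OF K])
    show "x \<in> nms N" using x comps_nms[of K N] K unfolding V_def by auto
  next
    fix x assume "x \<in> {x \<in> nms N. f x = K}"
    then show "x \<in> nms K" using fV[of x] by auto
  qed
  have seq: "seq_graph K (filter (\<lambda>T. label_of f T = K) (frontiers S \<Gamma>))" if K: "K \<in> V" for K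
  proof (rule sq_exch)
    have dK: "dnames K" and bK: "block K"
      using K comps_dnames[OF _ dN] normal_comps_block[OF normal] unfolding V_def by auto
    show "seq_graph K (map Leaf (leaves K))" using bK dK by (rule block_seq_graph)
    have "filter (\<lambda>T. label_of f T = K) (frontiers S \<Gamma>) =
        map Leaf (filter (\<lambda>l. f (fst l) = K) (concat (map leaves \<Gamma>)))"
      unfolding frontiers by (simp add: filter_map comp_def label_of_def)
    moreover have "mset (filter (\<lambda>l. f (fst l) = K) (concat (map leaves \<Gamma>))) = mset (leaves K)"
    proof (rule set_eq_iff_mset_eq_distinct[THEN iffD1])
      show "distinct (filter (\<lambda>l. f (fst l) = K) (concat (map leaves \<Gamma>)))"
        using dG unfolding dforest_def by (simp add: distinct_map)
      show "distinct (leaves K)" using dK by (simp add: distinct_map)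
      have sub: "set (leaves K) \<subseteq> set (leaves N)" using K comps_leaves unfolding V_def by blast
      have "l \<in> set (leaves K)" if l: "l \<in> set (leaves N)" "f (fst l) = K" for l
      proof -
        have "fst l \<in> nms K" using fV[of "fst l"] l unfolding nms_def by auto
        then obtain l' where l': "l' \<in> set (leaves K)" "fst l' = fst l" unfolding nms_def by auto
        then have "l' = l" using injN l(1) sub unfolding inj_on_def by blast
        then show ?thesis using l' by simp
      qed
      moreover have "f (fst l) = K" if "l \<in> set (leaves K)" for l
        using f[OF K] that unfolding nms_def by auto
      ultimately show "set (filter (\<lambda>l. f (fst l) = K) (concat (map leaves \<Gamma>))) = set (leaves K)"
        using sub unfolding set_filter leq[symmetric] by blast
    qed
    ultimately show "mset (filter (\<lambda>T. label_of f T = K) (frontiers S \<Gamma>)) = mset (map Leaf (leaves K))"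
      by simp
  qed
  have "\<exists>Q. seq_graph Q \<Gamma> \<and> comps Q = (\<Sum>K\<in>V. comps K)"
    by (rule sequentialise[where P = "\<lambda>K. K", OF T dG Sin(1) up inV seq unif nm])
  moreover have "(\<Sum>K\<in>V. comps K) = comps N"
  proof -
    have "(\<Sum>K\<in>V. comps K) = (\<Sum>K\<in>V. {#K#})"
      by (rule sum.cong) (auto simp: V_def intro!: block_comps normal_comps_block[OF normal])
    also have "\<dots> = mset_set V" by (rule sum_multiset_singleton)
    finally show ?thesis using comps_set[OF dN] unfolding V_def by simp
  qed
  ultimately show ?thesis by simp
qed

theorem theorem1p8:
  fixes P :: "('v, 'a) tree" and \<Gamma> :: "('v, 'a) tree list"
  assumes "pre_proof_graph P \<Gamma>"
  shows "sequentializable P \<Gamma> \<longleftrightarrow> proof_net P \<Gamma>"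
proof
  assume "sequentializable P \<Gamma>"
  then obtain P' where P': "sim \<Gamma> P P'" "seq_graph P' \<Gamma>" unfolding sequentializable_def by blast
  have "correct P' \<Gamma>"
    using correct_iff_leaf_correct[OF sim_pre[OF P'(1) assms]] seq_graph_leaf_correct[OF P'(2)] by blast
  then show "proof_net P \<Gamma>" using P'(1) unfolding proof_net_def by blast
next
  assume "proof_net P \<Gamma>"
  then obtain P' where P': "sim \<Gamma> P P'" "correct P' \<Gamma>" unfolding proof_net_def by blast
  have pre: "pre_proof_graph P' \<Gamma>" using sim_pre[OF P'(1) assms] .
  then have "net \<Gamma> P'" using correct_iff_leaf_correct[OF pre] P'(2) unfolding net_def by blast
  then obtain N where N: "normal N" "sim \<Gamma> P' N" "net \<Gamma> N" by (rule normalise)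
  obtain Q where Q: "seq_graph Q \<Gamma>" "comps Q = comps N" using normal_sequentialisable[OF N(3,1)] by blast
  \<comment> \<open>\<open>N\<close> and \<open>Q\<close> have the same blocks and differ in the
    arrangement of the pars between them, which the context-free rules absorb.\<close>
  have "sim \<Gamma> N Q" using comps_eq_beq[of N Q] Q(2) by (intro beq_sim) simp
  then have "sim \<Gamma> P Q" using P'(1) N(2) sim_trans by blast
  then show "sequentializable P \<Gamma>" using Q(1) unfolding sequentializable_def by blast
qed

end
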